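(* Let $r\ge 2$ and let $a_1,a_2,\dots,a_r,s_1,s_2,\dots,s_{r-1}$ be positive integers such that $a_1<s_1\le s_2\le\cdots\le s_{r-1}$ and $a_i\le s_{i-1}$ for each $2\le i\le r$. Then there exists a constant $c>0$ such that for every integer $p\ge c$, $$ex\big(n,K^{(r)}_{a_1,a_2,\dots,a_r},K^{(r)}_{s_1,s_2,\dots,s_{r-1},p}\big)=\Theta\!\left(n^{(a_1+a_2+\cdots+a_r)-\frac{a_1a_2\cdots a_r}{s_1s_2\cdots s_{r-1}}}\right)$$ as $n\to\infty$ (the implied constants may depend on $r,a_i,s_i,p$ but not on $n$).
   Context: For $r$-uniform hypergraphs $T$ and $H$, a hypergraph is $H$-free if it contains no (not necessarily induced) subhypergraph isomorphic to $H$, and $ex(n,T,H)$ denotes the maximum number of copies of $T$ (subhypergraphs isomorphic to $T$) in an $n$-vertex $H$-free $r$-uniform hypergraph. $K^{(r)}_{t_1,\dots,t_r}$ denotes the complete $r$-partite $r$-uniform hypergraph with parts of sizes $t_1,\dots,t_r$: its vertex set is a disjoint union of parts $V_1,\dots,V_r$ with $|V_i|=t_i$, and its edges are exactly the $r$-sets containing one vertex from each part. *)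

theory Defs
  imports Complex_Main "HOL-Library.Landau_Symbols"
begin

text \<open>A hypergraph is a pair of a vertex set and an edge set.\<close>

type_synonym 'a hypergraph = "'a set \<times> 'a set set"

abbreviation verts :: "'a hypergraph \<Rightarrow> 'a set" where "verts G \<equiv> fst G"
abbreviation edges :: "'a hypergraph \<Rightarrow> 'a set set" where "edges G \<equiv> snd G"

definition hypergraph :: "'a hypergraph \<Rightarrow> bool" where
  "hypergraph G \<longleftrightarrow> finite (verts G) \<and> edges G \<subseteq> Pow (verts G)"

definition uniform :: "nat \<Rightarrow> 'a hypergraph \<Rightarrow> bool" where
  "uniform r G \<longleftrightarrow> hypergraph G \<and> (\<forall>e\<in>edges G. card e = r)"

definition subhypergraph :: "'a hypergraph \<Rightarrow> 'a hypergraph \<Rightarrow> bool" where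
  "subhypergraph G' G \<longleftrightarrow> hypergraph G' \<and> verts G' \<subseteq> verts G \<and> edges G' \<subseteq> edges G"

definition isomorphic :: "'a hypergraph \<Rightarrow> 'b hypergraph \<Rightarrow> bool" where
  "isomorphic G H \<longleftrightarrow> (\<exists>f. bij_betw f (verts G) (verts H) \<and> edges H = (\<lambda>e. f ` e) ` edges G)"

definition copies :: "'t hypergraph \<Rightarrow> 'a hypergraph \<Rightarrow> 'a hypergraph set" where
  "copies T G = {T'. subhypergraph T' G \<and> isomorphic T T'}"

definition free_of :: "'h hypergraph \<Rightarrow> 'a hypergraph \<Rightarrow> bool" where
  "free_of H G \<longleftrightarrow> copies H G = {}"

text \<open>Up to isomorphism, every hypergraph on \<open>n\<close> vertices has vertex set \<open>{..<n}\<close>. The maximum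
  below is over a finite set, which is nonempty as soon as \<open>H\<close> has an edge (see the lemmas at the
  end of this theory).\<close>

definition ex_number :: "nat \<Rightarrow> nat \<Rightarrow> 't hypergraph \<Rightarrow> 'h hypergraph \<Rightarrow> nat" where
  "ex_number r n T H =
     Max {card (copies T G) | G :: nat hypergraph. verts G = {..<n} \<and> uniform r G \<and> free_of H G}"

text \<open>The complete \<open>r\<close>-partite \<open>r\<close>-uniform hypergraph with parts of sizes \<open>t 1, \<dots>, t r\<close>;
  the values of \<open>t\<close> outside \<open>{1..r}\<close> are irrelevant.\<close>

definition part :: "(nat \<Rightarrow> nat) \<Rightarrow> nat \<Rightarrow> (nat \<times> nat) set" where
  "part t i = {i} \<times> {..<t i}"

definition complete_partite :: "nat \<Rightarrow> (nat \<Rightarrow> nat) \<Rightarrow> (nat \<times> nat) hypergraph" where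
  "complete_partite r t =
     (let V = (\<Union>i\<in>{1..r}. part t i)
      in (V, {e. e \<subseteq> V \<and> card e = r \<and> (\<forall>i\<in>{1..r}. card (e \<inter> part t i) = 1)}))"

lemma uniform_complete_partite: "uniform r (complete_partite r t)"
  by (auto simp: uniform_def hypergraph_def complete_partite_def part_def Let_def)

lemma complete_partite_has_edge:
  assumes "\<forall>i\<in>{1..r}. t i > 0"
  shows "edges (complete_partite r t) \<noteq> {}"
proof -
  let ?e = "(\<lambda>i. (i, 0::nat)) ` {1..r}"
  have "?e \<inter> part t i = {(i, 0)}" if "i \<in> {1..r}" for i
    using assms that by (auto simp: part_def)
  moreover have "card ?e = r"
    by (simp add: card_image inj_on_def)
  moreover have "?e \<subseteq> (\<Union>i\<in>{1..r}. part t i)"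
    using assms by (auto simp: part_def)
  ultimately have "?e \<in> edges (complete_partite r t)"
    by (simp add: complete_partite_def Let_def)
  then show ?thesis by blast
qed

lemma ex_number_set_finite:
  "finite {card (copies T G) | G :: nat hypergraph. verts G = {..<n} \<and> uniform r G \<and> free_of H G}"
proof -
  have "finite {G :: nat hypergraph. verts G = {..<n} \<and> uniform r G \<and> free_of H G}"
    by (rule finite_subset[of _ "{{..<n}} \<times> Pow (Pow {..<n})"])
       (fastforce simp: uniform_def hypergraph_def)+
  then show ?thesis by (rule finite_image_set)
qed

lemma ex_number_set_nonempty:
  assumes "edges H \<noteq> {}"
  shows "{card (copies T G) | G :: nat hypergraph.
            verts G = {..<n} \<and> uniform r G \<and> free_of H G} \<noteq> {}"
proof -
  have "free_of H ({..<n}, {})"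
    using assms by (auto simp: free_of_def copies_def subhypergraph_def isomorphic_def)
  moreover have "uniform r ({..<n}, {})"
    by (simp add: uniform_def hypergraph_def)
  ultimately show ?thesis by fastforce
qed

end

theory Submission
  imports Defs "HOL-Library.FuncSet" "HOL-Library.Function_Algebras" "HOL-Library.Z2"
    "HOL-Algebra.Algebraic_Closure_Type"
begin

text \<open>
  Upper bound. Let \<open>N t\<close> be the number of tuples of vertex sets of sizes \<open>t_1, ..., t_r\<close> all of whose
  transversals are edges. Freeness gives \<open>N (s_1, ..., s_(r-1), a_1) = O(n^(s_1 + ... + s_(r-1)))\<close>, a
  saving of \<open>\<delta> = a_1\<close> in the exponent. Lowering one size from \<open>s_i\<close> to \<open>a_(i+1)\<close> costs a power-mean
  inequality and multiplies \<open>\<delta>\<close> by \<open>a_(i+1) / s_i\<close>; after \<open>r - 1\<close> such steps the sizes are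
  \<open>a_2, ..., a_r, a_1\<close>.

  Lower bound. Put \<open>k = s_1 * ... * s_(r-1)\<close> and let every part be the affine \<open>k\<close>-space over the field
  with \<open>q\<close> elements, \<open>q\<close> a power of 2. A tuple \<open>x\<close> is an edge if \<open>Norm (H x) = b\<close>, where \<open>H\<close> is a random
  polynomial over the extension \<open>K\<close> of degree \<open>m\<close>: in each block of variables a combination of the
  monomials of degree below \<open>D\<close> and of the pure powers \<open>x_j^D\<close>. Fixing an \<open>s_1, ..., s_(r-1)\<close> grid in all
  parts but one leaves \<open>k\<close> equations in \<open>k\<close> unknowns. The leading form of each equation is a product of
  \<open>m\<close> conjugate linear forms in the \<open>x_j^D\<close>. If no choice of one factor per equation is linearly
  dependent, then the leading forms generate all monomials of large degree, so the number of
  solutions is bounded independently of \<open>q\<close>. A dependent choice has probability \<open>O(1 / q^m)\<close>; for large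
  \<open>m\<close> this beats the number of grids, whereas the edge density is at least \<open>1 / q\<close> whatever \<open>m\<close> is. Hence
  no Lang-Weil type estimate is needed.
\<close>

section \<open>Counting complete partite subhypergraphs\<close>

text \<open>In the upper bound the part of size \<open>p\<close> is the free one: once the other
  parts are fixed it has fewer than \<open>p\<close> candidates, so choosing \<open>a_1\<close> of
  them costs only a constant factor. A lowering step is sound as long as \<delta> is at most the
  size being lowered. It always is, because \<delta> never exceeds \<open>a_1\<close> and every
  \<open>s_i\<close> is at least \<open>s_1\<close>.

  In the lower bound \<open>n\<close> is about \<open>q^k\<close>, and a tuple of sets of sizes
  \<open>a_1, ..., a_r\<close> spans a copy with probability at least q to the power -(a_1 ... a_r).
  Dividing that exponent by \<open>k\<close> gives the term subtracted in the theorem. One outcome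
  must avoid every dependent grid and still have many copies, so the bad outcomes must have at most
  half the probability of a single copy. This fixes \<open>m\<close>: the exponent of
  \<open>q\<close> in the number of grids, plus a_1 ... a_r, plus 1, where the last factor
  \<open>q\<close> absorbs constants. The degree \<open>D\<close> bounds the sizes of all sets in
  the grids considered; polynomials of degree below \<open>D\<close> then separate the points of
  each set, which makes the values on a grid independent.\<close>

definition grids :: "nat \<Rightarrow> (nat \<Rightarrow> nat) \<Rightarrow> 'a hypergraph \<Rightarrow> (nat \<Rightarrow> 'a set) set" where
  "grids r t G = {A \<in> PiE {1..r} (\<lambda>i. {S. S \<subseteq> verts G \<and> card S = t i}).
     \<forall>x\<in>PiE {1..r} A. x ` {1..r} \<in> edges G}"

definition extension :: "nat set \<Rightarrow> 'a hypergraph \<Rightarrow> (nat \<Rightarrow> 'a set) \<Rightarrow> 'a set" where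
  "extension I G R = {v \<in> verts G. \<forall>y\<in>PiE I R. insert v (y ` I) \<in> edges G}"

definition transversals :: "nat \<Rightarrow> (nat \<Rightarrow> 'a set) \<Rightarrow> 'a set set" where
  "transversals r A = (\<lambda>x. x ` {1..r}) ` PiE {1..r} A"

section \<open>Transversals, grids and copies\<close>

lemma PiE_image_reindex:
  assumes "bij_betw \<pi> I J"
  shows "(\<lambda>x. x ` I) ` PiE I (\<lambda>i. A (\<pi> i)) = (\<lambda>x. x ` J) ` PiE J A"
proof (intro equalityI subsetI)
  fix e assume "e \<in> (\<lambda>x. x ` I) ` PiE I (\<lambda>i. A (\<pi> i))"
  then obtain x where x: "x \<in> PiE I (\<lambda>i. A (\<pi> i))" "e = x ` I" by blast
  let ?y = "restrict (x \<circ> inv_into I \<pi>) J"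
  have inv: "inv_into I \<pi> j \<in> I" "\<pi> (inv_into I \<pi> j) = j" if "j \<in> J" for j
    using assms that by (auto simp: bij_betw_def inv_into_into f_inv_into_f)
  have "?y \<in> PiE J A" using x(1) inv by (auto simp: PiE_iff) (metis inv)
  moreover have "?y ` J = e"
  proof -
    have "inv_into I \<pi> ` J = I" using bij_betw_inv_into[OF assms] by (simp add: bij_betw_def)
    moreover have "?y ` J = x ` (inv_into I \<pi> ` J)" by (simp add: image_image)
    ultimately show ?thesis by (simp add: x(2))
  qed
  ultimately show "e \<in> (\<lambda>x. x ` J) ` PiE J A" by blast
next
  fix e assume "e \<in> (\<lambda>x. x ` J) ` PiE J A"
  then obtain y where y: "y \<in> PiE J A" "e = y ` J" by blast
  have "restrict (y \<circ> \<pi>) I \<in> PiE I (\<lambda>i. A (\<pi> i))"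
    using y(1) assms by (auto simp: bij_betw_def)
  moreover have "restrict (y \<circ> \<pi>) I ` I = y ` (\<pi> ` I)" by (simp add: image_image)
  then have "restrict (y \<circ> \<pi>) I ` I = e"
    using assms y(2) by (simp add: bij_betw_def)
  ultimately show "e \<in> (\<lambda>x. x ` I) ` PiE I (\<lambda>i. A (\<pi> i))" by blast
qed

lemma PiE_image_image:
  "(\<lambda>e. f ` e) ` (\<lambda>x. x ` I) ` PiE I P = (\<lambda>x. x ` I) ` PiE I (\<lambda>i. f ` P i)"
proof (intro equalityI subsetI)
  fix e assume "e \<in> (\<lambda>e. f ` e) ` (\<lambda>x. x ` I) ` PiE I P"
  then obtain x where x: "x \<in> PiE I P" "e = f ` x ` I" by blast
  then have "restrict (f \<circ> x) I \<in> PiE I (\<lambda>i. f ` P i)" "restrict (f \<circ> x) I ` I = e"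
    by (auto simp: image_comp[symmetric])
  then show "e \<in> (\<lambda>x. x ` I) ` PiE I (\<lambda>i. f ` P i)" by blast
next
  fix e assume "e \<in> (\<lambda>x. x ` I) ` PiE I (\<lambda>i. f ` P i)"
  then obtain y where y: "y \<in> PiE I (\<lambda>i. f ` P i)" "e = y ` I" by blast
  then have "\<forall>i\<in>I. \<exists>z. z \<in> P i \<and> y i = f z" by (auto simp: PiE_iff)
  then obtain x where x: "\<And>i. i \<in> I \<Longrightarrow> x i \<in> P i \<and> y i = f (x i)"
    using bchoice[of I "\<lambda>i z. z \<in> P i \<and> y i = f z"] by blast
  have "restrict x I \<in> PiE I P" using x by auto
  moreover have "f ` restrict x I ` I = e"
    unfolding y(2) image_image by (intro image_cong) (auto simp: x)
  ultimately show "e \<in> (\<lambda>e. f ` e) ` (\<lambda>x. x ` I) ` PiE I P" by blast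
qed

lemma verts_complete_partite: "verts (complete_partite r t) = (\<Union>i\<in>{1..r}. part t i)"
  by (simp add: complete_partite_def Let_def)

text \<open>Transversals are easier to transport than the cardinality condition of
  \<open>complete_partite\<close>: by \<open>PiE_image_image\<close> they commute with taking images
  under any map.\<close>

lemma edges_complete_partite: "edges (complete_partite r t) = transversals r (part t)"
proof (intro equalityI subsetI)
  fix e assume "e \<in> edges (complete_partite r t)"
  then have e: "e \<subseteq> (\<Union>i\<in>{1..r}. part t i)" "\<forall>i\<in>{1..r}. card (e \<inter> part t i) = 1"
    by (auto simp: complete_partite_def Let_def)
  then obtain x where x: "\<And>i. i \<in> {1..r} \<Longrightarrow> e \<inter> part t i = {x i}"
    using bchoice[of "{1..r}" "\<lambda>i z. e \<inter> part t i = {z}"] by (auto simp: card_1_singleton_iff)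
  have "restrict x {1..r} \<in> PiE {1..r} (part t)" using x by fastforce
  moreover have "restrict x {1..r} ` {1..r} = e"
  proof -
    have "e = (\<Union>i\<in>{1..r}. e \<inter> part t i)" using e(1) by auto
    also have "\<dots> = (\<Union>i\<in>{1..r}. {x i})" using x by auto
    also have "\<dots> = restrict x {1..r} ` {1..r}" by auto
    finally show ?thesis by simp
  qed
  ultimately show "e \<in> transversals r (part t)" unfolding transversals_def by blast
next
  fix e assume "e \<in> transversals r (part t)"
  then obtain x where x: "x \<in> PiE {1..r} (part t)" "e = x ` {1..r}" by (auto simp: transversals_def)
  have fst: "fst (x i) = i" if "i \<in> {1..r}" for i using PiE_mem[OF x(1) that] by (auto simp: Defs.part_def)
  have "inj_on x {1..r}" by (rule inj_on_inverseI[where g = fst]) (rule fst)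
  then have "card e = r" by (simp add: x(2) card_image)
  moreover have "card (e \<inter> part t i) = 1" if i: "i \<in> {1..r}" for i
  proof -
    have "v = x i" if v: "v \<in> e" "v \<in> part t i" for v
    proof -
      obtain i' where i': "i' \<in> {1..r}" "v = x i'" using v(1) x(2) by blast
      have "fst v = i" using v(2) by (auto simp: Defs.part_def)
      with fst[OF i'(1)] i'(2) show ?thesis by simp
    qed
    moreover have "x i \<in> e" "x i \<in> part t i" using PiE_mem[OF x(1) i] x(2) i by simp_all
    ultimately have "e \<inter> part t i = {x i}" by blast
    then show ?thesis by simp
  qed
  moreover have "e \<subseteq> (\<Union>i\<in>{1..r}. part t i)" unfolding x(2) using PiE_mem[OF x(1)] by blast
  ultimately show "e \<in> edges (complete_partite r t)"
    by (simp add: complete_partite_def Let_def)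
qed

text \<open>A vertex lying in two parts could represent both in one transversal, which would then be
  an edge with fewer than \<open>r\<close> vertices. Positive sizes ensure that the remaining parts
  have representatives. For this reason \<open>grids\<close> does not ask for disjoint
  parts.\<close>

lemma grid_parts_disjoint:
  assumes G: "uniform r G" and A: "A \<in> grids r t G" and t: "\<forall>i\<in>{1..r}. t i > 0"
    and ij: "i \<in> {1..r}" "j \<in> {1..r}" "i \<noteq> j"
  shows "A i \<inter> A j = {}"
proof (rule ccontr)
  assume "A i \<inter> A j \<noteq> {}"
  then obtain z where z: "z \<in> A i" "z \<in> A j" by blast
  have "\<forall>l\<in>{1..r}. \<exists>v. v \<in> A l"
  proof
    fix l assume l: "l \<in> {1..r}"
    then have "card (A l) > 0" using A t by (auto simp: grids_def PiE_iff)
    then show "\<exists>v. v \<in> A l" by (auto simp: card_gt_0_iff)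
  qed
  then obtain v where v: "\<And>l. l \<in> {1..r} \<Longrightarrow> v l \<in> A l"
    using bchoice[of "{1..r}" "\<lambda>l v. v \<in> A l"] by blast
  let ?x = "restrict (v(i := z, j := z)) {1..r}"
  have "?x \<in> PiE {1..r} A" using v z by auto
  then have "?x ` {1..r} \<in> edges G" using A unfolding grids_def by blast
  then have "card (?x ` {1..r}) = r" using G unfolding uniform_def by blast
  then have "inj_on ?x {1..r}" by (intro eq_card_imp_inj_on) auto
  then show False using ij by (auto dest!: inj_onD[of _ _ i j])
qed

lemma grid_copy:
  assumes G: "uniform r G" and A: "A \<in> grids r t G" and t: "\<forall>i\<in>{1..r}. t i > 0"
  shows "(\<Union>i\<in>{1..r}. A i, transversals r A) \<in> copies (complete_partite r t) G"
proof -
  let ?H = "(\<Union>i\<in>{1..r}. A i, transversals r A)"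
  have fin: "finite (verts G)" using G by (simp add: uniform_def hypergraph_def)
  have A': "A i \<subseteq> verts G" "card (A i) = t i" if "i \<in> {1..r}" for i
    using A that by (auto simp: grids_def PiE_iff)
  have finA: "finite (A i)" if "i \<in> {1..r}" for i
    using A'(1)[OF that] fin by (rule finite_subset)
  have "\<forall>i\<in>{1..r}. \<exists>h. bij_betw h {..<t i} (A i)"
    using A' finA by (auto intro!: finite_same_card_bij)
  then obtain h where h: "\<And>i. i \<in> {1..r} \<Longrightarrow> bij_betw (h i) {..<t i} (A i)"
    using bchoice[of "{1..r}" "\<lambda>i h. bij_betw h {..<t i} (A i)"] by blast
  define f where "f = (\<lambda>(i, v). h i v)"
  have fp: "f ` part t i = A i" if "i \<in> {1..r}" for i
  proof -
    have "f ` part t i = h i ` {..<t i}" by (auto simp: f_def Defs.part_def)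
    then show ?thesis using h[OF that] by (simp add: bij_betw_def)
  qed
  have "inj_on f (\<Union>i\<in>{1..r}. part t i)"
  proof (rule inj_onI)
    fix u v assume uv: "u \<in> (\<Union>i\<in>{1..r}. part t i)" "v \<in> (\<Union>i\<in>{1..r}. part t i)" "f u = f v"
    obtain i a where u: "u = (i, a)" "i \<in> {1..r}" "a < t i" using uv(1) by (auto simp: Defs.part_def)
    obtain j b where v: "v = (j, b)" "j \<in> {1..r}" "b < t j" using uv(2) by (auto simp: Defs.part_def)
    have "f u \<in> A i" "f v \<in> A j" using fp u v by (auto simp: Defs.part_def)
    then have "i = j" using uv(3) grid_parts_disjoint[OF G A t u(2) v(2)] by auto
    then show "u = v" using uv(3) u v h[OF u(2)] by (auto simp: f_def bij_betw_def inj_on_def)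
  qed
  then have "bij_betw f (verts (complete_partite r t)) (verts ?H)"
    by (auto simp: bij_betw_def verts_complete_partite image_UN fp)
  moreover have "edges ?H = (\<lambda>e. f ` e) ` edges (complete_partite r t)"
  proof -
    have "(\<lambda>e. f ` e) ` edges (complete_partite r t) = transversals r (\<lambda>i. f ` part t i)"
      by (simp only: edges_complete_partite transversals_def PiE_image_image)
    also have "\<dots> = transversals r A"
      unfolding transversals_def by (intro image_cong PiE_cong) (auto simp: fp)
    finally show ?thesis by simp
  qed
  moreover have "subhypergraph ?H G"
  proof -
    have "transversals r A \<subseteq> edges G" using A by (auto simp: grids_def transversals_def)
    moreover have "(\<Union>i\<in>{1..r}. A i) \<subseteq> verts G" by (rule UN_least) (rule A'(1))
    moreover have "finite (\<Union>i\<in>{1..r}. A i)" using finA by blast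
    moreover have "transversals r A \<subseteq> Pow (\<Union>i\<in>{1..r}. A i)" by (auto simp: transversals_def PiE_iff)
    ultimately show ?thesis by (simp add: subhypergraph_def hypergraph_def)
  qed
  ultimately show ?thesis unfolding copies_def isomorphic_def by blast
qed

lemma copies_partE:
  assumes "H \<in> copies (complete_partite r t) G"
  obtains A where "\<And>i. i \<in> {1..r} \<Longrightarrow> card (A i) = t i" "\<And>i. i \<in> {1..r} \<Longrightarrow> A i \<subseteq> verts G"
    "\<And>i j. i \<in> {1..r} \<Longrightarrow> j \<in> {1..r} \<Longrightarrow> i \<noteq> j \<Longrightarrow> A i \<inter> A j = {}"
    "H = (\<Union>i\<in>{1..r}. A i, transversals r A)" "transversals r A \<subseteq> edges G"
proof -
  from assms have sub: "subhypergraph H G" and "isomorphic (complete_partite r t) H"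
    by (auto simp: copies_def)
  then obtain f where f: "bij_betw f (verts (complete_partite r t)) (verts H)"
    "edges H = (\<lambda>e. f ` e) ` edges (complete_partite r t)" by (auto simp: isomorphic_def)
  define A where "A i = f ` part t i" for i
  have v: "verts H = (\<Union>i\<in>{1..r}. A i)"
    using f(1) by (simp add: A_def bij_betw_def verts_complete_partite image_UN)
  have e: "edges H = transversals r A"
    unfolding f(2) A_def by (simp only: edges_complete_partite transversals_def PiE_image_image)
  have inj: "inj_on f (\<Union>i\<in>{1..r}. part t i)"
    using f(1) by (simp add: bij_betw_def verts_complete_partite)
  show thesis
  proof
    show "card (A i) = t i" if "i \<in> {1..r}" for i
    proof -
      have "inj_on f (part t i)" using that by (intro inj_on_subset[OF inj]) auto
      then show ?thesis by (simp add: A_def card_image Defs.part_def)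
    qed
    show "A i \<inter> A j = {}" if "i \<in> {1..r}" "j \<in> {1..r}" "i \<noteq> j" for i j
    proof -
      have "part t i \<inter> part t j = {}" using that by (auto simp: Defs.part_def)
      moreover have "A i \<inter> A j = f ` (part t i \<inter> part t j)"
        unfolding A_def using that by (intro inj_on_image_Int[OF inj, symmetric]) auto
      ultimately show ?thesis by simp
    qed
    show "A i \<subseteq> verts G" if "i \<in> {1..r}" for i
    proof -
      have "A i \<subseteq> verts H" unfolding v using that by (rule UN_upper)
      then show ?thesis using sub by (auto simp: subhypergraph_def)
    qed
    show "H = (\<Union>i\<in>{1..r}. A i, transversals r A)" using v e by (simp add: prod_eq_iff)
    show "transversals r A \<subseteq> edges G" using sub e by (auto simp: subhypergraph_def)
  qed
qed

lemma finite_grids: "finite (verts G) \<Longrightarrow> finite (grids r t G)"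
  unfolding grids_def by (rule finite_subset[of _ "PiE {1..r} (\<lambda>_. Pow (verts G))"]) (auto intro: finite_PiE)

text \<open>Every copy arises from a grid, in whatever order \<pi> its parts are listed, so sending
  a grid to its union and its transversals covers all copies. The freedom in \<pi> serves the upper
  bound, whose last size vector is a cyclic shift of \<open>a\<close>.\<close>

lemma card_copies_le_grids:
  assumes G: "uniform r G" and \<pi>: "bij_betw \<pi> {1..r} {1..r}"
  shows "card (copies (complete_partite r t) G) \<le> card (grids r (\<lambda>i. t (\<pi> i)) G)"
proof -
  let ?F = "\<lambda>A. (\<Union>i\<in>{1..r}. A i, transversals r A)"
  have "copies (complete_partite r t) G \<subseteq> ?F ` grids r (\<lambda>i. t (\<pi> i)) G"
  proof
    fix H assume "H \<in> copies (complete_partite r t) G"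
    then obtain A where A: "\<And>i. i \<in> {1..r} \<Longrightarrow> card (A i) = t i" "\<And>i. i \<in> {1..r} \<Longrightarrow> A i \<subseteq> verts G"
      and H: "H = ?F A" and E: "transversals r A \<subseteq> edges G"
      by (rule copies_partE) blast
    let ?B = "restrict (\<lambda>i. A (\<pi> i)) {1..r}"
    have \<pi>': "\<pi> i \<in> {1..r}" if "i \<in> {1..r}" for i using \<pi> that by (auto simp: bij_betw_def)
    have PB: "PiE {1..r} ?B = PiE {1..r} (\<lambda>i. A (\<pi> i))" by (intro PiE_cong) auto
    have tr: "transversals r ?B = transversals r A"
      unfolding transversals_def PB by (rule PiE_image_reindex[OF \<pi>])
    have "?B \<in> grids r (\<lambda>i. t (\<pi> i)) G"
      unfolding grids_def mem_Collect_eq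
    proof
      show "?B \<in> (\<Pi>\<^sub>E i\<in>{1..r}. {S. S \<subseteq> verts G \<and> card S = t (\<pi> i)})"
        using A \<pi>' by (intro restrict_PiE_iff[THEN iffD2]) auto
      show "\<forall>x\<in>PiE {1..r} ?B. x ` {1..r} \<in> edges G"
        using E unfolding tr[symmetric] unfolding transversals_def by (rule image_subset_iff[THEN iffD1])
    qed
    moreover have "?F ?B = H"
    proof -
      have "(\<Union>i\<in>{1..r}. ?B i) = (\<Union>i\<in>\<pi> ` {1..r}. A i)" by auto
      also have "\<dots> = (\<Union>i\<in>{1..r}. A i)" using \<pi> by (simp add: bij_betw_def)
      finally show ?thesis using tr H by simp
    qed
    ultimately show "H \<in> ?F ` grids r (\<lambda>i. t (\<pi> i)) G" by blast
  qed
  moreover have "finite (grids r (\<lambda>i. t (\<pi> i)) G)"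
    using G by (intro finite_grids) (simp add: uniform_def hypergraph_def)
  ultimately show ?thesis by (rule surj_card_le[rotated])
qed

text \<open>A grid is a choice \<open>R\<close> of all parts but the \<open>j\<close>-th, together
  with a \<open>t j\<close>-subset of the common extension of \<open>R\<close>. Two size vectors
  that differ only at \<open>j\<close> give sums over the same \<open>R\<close> with the same
  extension sizes. Only the binomial coefficient changes, which is what turns a lowering step into a
  power-mean inequality.\<close>

lemma card_grids_eq:
  assumes fin: "finite (verts G)" and j: "j \<in> {1..r}"
  shows "card (grids r t G) = (\<Sum>R\<in>PiE ({1..r} - {j}) (\<lambda>i. {S. S \<subseteq> verts G \<and> card S = t i}).
           card (extension ({1..r} - {j}) G R) choose t j)"
proof -
  define J where "J = {1..r} - {j}"
  let ?RR = "PiE J (\<lambda>i. {S. S \<subseteq> verts G \<and> card S = t i})"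
  let ?S = "SIGMA R:?RR. {S. S \<subseteq> extension J G R \<and> card S = t j}"
  have I: "{1..r} = insert j J" and jJ: "j \<notin> J" using j by (auto simp: J_def)
  have key: "(\<forall>x\<in>PiE {1..r} A. x ` {1..r} \<in> edges G) \<longleftrightarrow>
      (\<forall>v\<in>A j. \<forall>y\<in>PiE J A. insert v (y ` J) \<in> edges G)" for A
  proof
    assume L: "\<forall>x\<in>PiE {1..r} A. x ` {1..r} \<in> edges G"
    show "\<forall>v\<in>A j. \<forall>y\<in>PiE J A. insert v (y ` J) \<in> edges G"
    proof (intro ballI)
      fix v y assume vy: "v \<in> A j" "y \<in> PiE J A"
      have "y(j := v) \<in> PiE {1..r} A" unfolding I by (rule PiE_fun_upd[of v A j y J, OF vy])
      moreover have "(y(j := v)) ` {1..r} = insert v (y ` J)"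
        unfolding I using jJ by auto
      ultimately show "insert v (y ` J) \<in> edges G" using L by metis
    qed
  next
    assume R: "\<forall>v\<in>A j. \<forall>y\<in>PiE J A. insert v (y ` J) \<in> edges G"
    show "\<forall>x\<in>PiE {1..r} A. x ` {1..r} \<in> edges G"
    proof
      fix x assume x: "x \<in> PiE {1..r} A"
      have "restrict x J \<in> PiE J A" "x j \<in> A j" using x unfolding I by auto
      then have "insert (x j) (restrict x J ` J) \<in> edges G" using R by blast
      moreover have "x ` {1..r} = insert (x j) (restrict x J ` J)"
        unfolding I by auto
      ultimately show "x ` {1..r} \<in> edges G" by metis
    qed
  qed
  have cong: "extension J G (restrict A J) = extension J G A" for A
  proof -
    have "PiE J (restrict A J) = PiE J A" by (rule PiE_cong) simp
    then show ?thesis by (simp add: extension_def)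
  qed
  have "bij_betw (\<lambda>A. (restrict A J, A j)) (grids r t G) ?S"
  proof (rule bij_betw_byWitness[where f' = "\<lambda>(R, S). R(j := S)"])
    show "\<forall>A\<in>grids r t G. (case (restrict A J, A j) of (R, S) \<Rightarrow> R(j := S)) = A"
    proof
      fix A assume "A \<in> grids r t G"
      then have "A \<in> extensional {1..r}" by (auto simp: grids_def PiE_def)
      then show "(case (restrict A J, A j) of (R, S) \<Rightarrow> R(j := S)) = A"
        unfolding I by (auto simp: extensional_def restrict_def fun_eq_iff)
    qed
    show "\<forall>p\<in>?S. (restrict ((case p of (R, S) \<Rightarrow> R(j := S))) J, (case p of (R, S) \<Rightarrow> R(j := S)) j) = p"
      using jJ by (auto simp: PiE_def extensional_def restrict_def fun_eq_iff)
    show "(\<lambda>A. (restrict A J, A j)) ` grids r t G \<subseteq> ?S"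
    proof (rule image_subsetI)
      fix A assume A: "A \<in> grids r t G"
      then have "restrict A J \<in> ?RR" unfolding grids_def I by auto
      moreover have "card (A j) = t j" "A j \<subseteq> verts G" using A j by (auto simp: grids_def)
      moreover have "\<forall>v\<in>A j. \<forall>y\<in>PiE J A. insert v (y ` J) \<in> edges G"
        using A unfolding key[symmetric] grids_def by blast
      ultimately have "A j \<subseteq> extension J G A" unfolding extension_def by blast
      then show "(restrict A J, A j) \<in> ?S"
        using \<open>restrict A J \<in> ?RR\<close> \<open>card (A j) = t j\<close> by (simp only: cong mem_Sigma_iff) simp
    qed
    show "(\<lambda>(R, S). R(j := S)) ` ?S \<subseteq> grids r t G"
    proof clarify
      fix R S assume R: "R \<in> ?RR" and S: "S \<subseteq> extension J G R" "card S = t j"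
      have "PiE J (R(j := S)) = PiE J R" using jJ by (intro PiE_cong) auto
      then have "\<forall>v\<in>(R(j := S)) j. \<forall>y\<in>PiE J (R(j := S)). insert v (y ` J) \<in> edges G"
        using S(1) by (auto simp: extension_def)
      moreover have "R(j := S) \<in> PiE {1..r} (\<lambda>i. {S. S \<subseteq> verts G \<and> card S = t i})"
        unfolding I by (rule PiE_fun_upd[OF _ R]) (use S in \<open>auto simp: extension_def\<close>)
      ultimately show "R(j := S) \<in> grids r t G"
        using key by (simp add: grids_def)
    qed
  qed
  then have "card (grids r t G) = card ?S" by (rule bij_betw_same_card)
  also have "\<dots> = (\<Sum>R\<in>?RR. card {S. S \<subseteq> extension J G R \<and> card S = t j})"
    using fin by (intro card_SigmaI finite_PiE) (auto simp: extension_def J_def)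
  also have "\<dots> = (\<Sum>R\<in>?RR. card (extension J G R) choose t j)"
    using fin by (intro sum.cong n_subsets) (auto simp: extension_def)
  finally show ?thesis unfolding J_def .
qed

section \<open>Upper bound by lowering one size at a time\<close>

lemma card_subset_tuples_le:
  assumes "finite V" "finite I"
  shows "card (PiE I (\<lambda>i. {S. S \<subseteq> V \<and> card S = t i})) \<le> card V ^ (\<Sum>i\<in>I. t i)"
proof -
  have "card (PiE I (\<lambda>i. {S. S \<subseteq> V \<and> card S = t i})) = (\<Prod>i\<in>I. card V choose t i)"
    using assms by (simp add: card_PiE n_subsets)
  also have "\<dots> \<le> (\<Prod>i\<in>I. card V ^ t i)"
  proof (intro prod_mono conjI)
    show "card V choose t i \<le> card V ^ t i" for i
      by (cases "t i \<le> card V") (auto intro: binomial_le_pow simp: binomial_eq_0)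
  qed auto
  also have "\<dots> = card V ^ (\<Sum>i\<in>I. t i)" by (simp add: power_sum)
  finally show ?thesis .
qed

text \<open>By \<open>card_grids_eq\<close> an extension with at least \<open>u r\<close> vertices
  contributes a grid, and by \<open>grid_copy\<close> a grid is a copy.\<close>

lemma extension_card_less:
  assumes G: "uniform r G" and free: "free_of (complete_partite r u) G"
    and u: "\<forall>i\<in>{1..r}. u i > 0" and "r \<ge> 1"
    and R: "R \<in> PiE ({1..r} - {r}) (\<lambda>i. {S. S \<subseteq> verts G \<and> card S = u i})"
  shows "card (extension ({1..r} - {r}) G R) < u r"
proof (rule ccontr)
  assume "\<not> ?thesis"
  then have pos: "card (extension ({1..r} - {r}) G R) choose u r > 0"
    by (simp add: zero_less_binomial)
  have fin: "finite (verts G)" using G by (simp add: uniform_def hypergraph_def)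
  then have finR: "finite (PiE ({1..r} - {r}) (\<lambda>i. {S. S \<subseteq> verts G \<and> card S = u i}))"
    by (intro finite_PiE) auto
  have "r \<in> {1..r}" using \<open>r \<ge> 1\<close> by simp
  have "card (extension ({1..r} - {r}) G R) choose u r \<le> card (grids r u G)"
    unfolding card_grids_eq[OF fin \<open>r \<in> {1..r}\<close>] by (rule member_le_sum[OF R _ finR]) simp
  with pos have "card (grids r u G) > 0" by (rule less_le_trans)
  then obtain A where "A \<in> grids r u G" by (metis card.empty equals0I less_nat_zero_code)
  from grid_copy[OF G this u] free show False by (auto simp: free_of_def)
qed

text \<open>A threshold \<open>\<Lambda>\<close> separating small and large \<open>d R\<close> replaces Hoelder's inequality.\<close>

lemma sum_choose_le:
  fixes d :: "'r \<Rightarrow> nat" and \<Lambda> M N :: real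
  assumes "finite \<R>" "card \<R> \<le> M" "(\<Sum>R\<in>\<R>. real (d R choose s)) \<le> N" "a \<le> s" "s > 0" "\<Lambda> \<ge> 1"
  shows "(\<Sum>R\<in>\<R>. real (d R choose a)) \<le> M * \<Lambda> ^ a + real s ^ s * (N + M) * (\<Lambda> ^ a / \<Lambda> ^ s)"
proof -
  have "real (d R choose a) \<le> \<Lambda> ^ a + real s ^ s * (real (d R choose s) + 1) * (\<Lambda> ^ a / \<Lambda> ^ s)" for R
  proof -
    have "d R choose a \<le> d R ^ a"
      by (cases "a \<le> d R") (auto intro: binomial_le_pow simp: binomial_eq_0)
    then have 1: "real (d R choose a) \<le> real (d R) ^ a" by (metis of_nat_le_iff of_nat_power)
    \<comment> \<open>The summand 1 covers \<open>d R < s\<close>, where the binomial coefficient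
      vanishes while the power is at most \<open>s ^ s\<close>.\<close>
    have 2: "real (d R) ^ s \<le> real s ^ s * (real (d R choose s) + 1)"
    proof (cases "s \<le> d R")
      case True
      have "(real (d R) / real s) ^ s \<le> real (d R choose s)"
        by (rule binomial_ge_n_over_k_pow_k[OF True])
      then show ?thesis using assms(5)
        by (simp add: power_divide divide_simps) (simp add: algebra_simps add_increasing)
    next
      case False
      then have "real (d R) ^ s \<le> real s ^ s" by (intro power_mono) auto
      also have "\<dots> \<le> real s ^ s * (real (d R choose s) + 1)" by (simp add: algebra_simps)
      finally show ?thesis .
    qed
    have nn: "0 \<le> real s ^ s * (real (d R choose s) + 1) * (\<Lambda> ^ a / \<Lambda> ^ s)" and lam: "0 \<le> \<Lambda> ^ a"
      using assms(6) by simp_all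
    show ?thesis
    proof (cases "real (d R) \<le> \<Lambda>")
      case True
      then have "real (d R) ^ a \<le> \<Lambda> ^ a" by (intro power_mono) auto
      with 1 nn show ?thesis by linarith
    next
      case False
      have "\<Lambda> ^ (s - a) \<le> real (d R) ^ (s - a)" using False assms(6) by (intro power_mono) auto
      then have "real (d R) ^ a * \<Lambda> ^ (s - a) \<le> real (d R) ^ a * real (d R) ^ (s - a)"
        by (intro mult_left_mono) auto
      also have "\<dots> = real (d R) ^ s" using assms(4) by (simp flip: power_add)
      finally have "real (d R) ^ a \<le> real (d R) ^ s / \<Lambda> ^ (s - a)"
        using assms(6) by (simp add: field_simps)
      also have "\<dots> = real (d R) ^ s * (\<Lambda> ^ a / \<Lambda> ^ s)"
        using assms(4,6) by (simp add: power_diff field_simps)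
      also have "\<dots> \<le> real s ^ s * (real (d R choose s) + 1) * (\<Lambda> ^ a / \<Lambda> ^ s)"
        using assms(6) 2 by (intro mult_right_mono) auto
      finally show ?thesis using 1 lam by linarith
    qed
  qed
  then have "(\<Sum>R\<in>\<R>. real (d R choose a))
      \<le> (\<Sum>R\<in>\<R>. \<Lambda> ^ a + real s ^ s * (real (d R choose s) + 1) * (\<Lambda> ^ a / \<Lambda> ^ s))"
    by (rule sum_mono)
  also have "\<dots> = card \<R> * \<Lambda> ^ a + real s ^ s * ((\<Sum>R\<in>\<R>. real (d R choose s)) + card \<R>) * (\<Lambda> ^ a / \<Lambda> ^ s)"
    by (simp add: sum.distrib sum_distrib_left sum_distrib_right sum_divide_distrib algebra_simps)
  also have "\<dots> \<le> M * \<Lambda> ^ a + real s ^ s * (N + M) * (\<Lambda> ^ a / \<Lambda> ^ s)"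
    using assms by (intro add_mono mult_mono mult_right_mono mult_left_mono) 
       (auto intro!: add_nonneg_nonneg sum_nonneg)
  finally show ?thesis .
qed

text \<open>The threshold \<Lambda> = n powr (1 - \<delta> / s) balances the two terms of
  \<open>sum_choose_le\<close>: both the small and the large \<open>d R\<close> then contribute the
  exponent \<rho> + a - \<delta> a / s. The hypothesis \<delta> \<le> s gives \<Lambda> \<ge>
  1.\<close>

lemma sum_choose_powr_le:
  fixes d :: "'r \<Rightarrow> nat" and C \<rho> \<delta> :: real
  assumes "finite \<R>" "n \<ge> 1" "0 \<le> \<delta>" "\<delta> \<le> real s" "a \<le> s" "s > 0"
    and "card \<R> \<le> real n powr \<rho>" "(\<Sum>R\<in>\<R>. real (d R choose s)) \<le> C * real n powr (\<rho> + s - \<delta>)"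
  shows "(\<Sum>R\<in>\<R>. real (d R choose a))
    \<le> (1 + real s ^ s * (C + 1)) * real n powr (\<rho> + a - \<delta> * (a / s))"
proof -
  define \<mu> where "\<mu> = 1 - \<delta> / s"
  define \<Lambda> where "\<Lambda> = real n powr \<mu>"
  have \<mu>: "\<mu> \<ge> 0" using assms by (simp add: \<mu>_def field_simps)
  have pow: "\<Lambda> ^ b = real n powr (\<mu> * b)" for b
    using assms(2) by (simp add: \<Lambda>_def powr_realpow[symmetric] powr_powr)
  have frac: "\<Lambda> ^ a / \<Lambda> ^ s = real n powr (\<mu> * a - \<mu> * s)"
    by (simp add: pow powr_diff)
  have "\<Lambda> \<ge> 1" unfolding \<Lambda>_def using assms(2) \<mu> by (intro ge_one_powr_ge_zero) auto
  from sum_choose_le[OF assms(1,7,8,5,6) this]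
  have "(\<Sum>R\<in>\<R>. real (d R choose a)) \<le> real n powr \<rho> * real n powr (\<mu> * a)
     + real s ^ s * (C * real n powr (\<rho> + s - \<delta>) + real n powr \<rho>) * real n powr (\<mu> * a - \<mu> * s)"
    unfolding frac unfolding pow .
  also have "\<dots> = real n powr (\<rho> + \<mu> * a)
     + real s ^ s * (C * real n powr (\<rho> + s - \<delta> + (\<mu> * a - \<mu> * s)) + real n powr (\<rho> + (\<mu> * a - \<mu> * s)))"
    by (simp only: powr_add[of _ _ "\<mu> * a"] powr_add[of _ _ "\<mu> * a - \<mu> * s"] distrib_left distrib_right mult.assoc)
  also have "\<rho> + s - \<delta> + (\<mu> * a - \<mu> * s) = \<rho> + \<mu> * a"
    using assms(6) by (simp add: \<mu>_def field_simps)
  also have "real n powr (\<rho> + \<mu> * a) + real s ^ s * (C * real n powr (\<rho> + \<mu> * a) + real n powr (\<rho> + (\<mu> * a - \<mu> * s)))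
     \<le> real n powr (\<rho> + \<mu> * a) + real s ^ s * (C * real n powr (\<rho> + \<mu> * a) + real n powr (\<rho> + \<mu> * a))"
    using assms(2) \<mu> by (intro add_left_mono mult_left_mono powr_mono) auto
  also have "\<dots> = (1 + real s ^ s * (C + 1)) * real n powr (\<rho> + \<mu> * a)"
    by (simp add: algebra_simps)
  also have "\<rho> + \<mu> * a = \<rho> + a - \<delta> * (a / s)" by (simp add: \<mu>_def algebra_simps)
  finally show ?thesis .
qed

lemma copies_upper_bound:
  fixes r p :: nat and a s :: "nat \<Rightarrow> nat"
  assumes r: "r \<ge> 2" and a: "\<forall>i\<in>{1..r}. a i > 0" and s: "\<forall>i\<in>{1..r-1}. s i > 0"
    and as1: "a 1 \<le> s 1" and mono: "\<forall>i\<in>{1..<r-1}. s i \<le> s (i + 1)"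
    and as: "\<forall>i\<in>{2..r}. a i \<le> s (i - 1)" and p: "p > 0"
  shows "\<exists>C\<ge>0. \<forall>n\<ge>1. \<forall>G :: 'v hypergraph. card (verts G) = n \<longrightarrow> uniform r G \<longrightarrow>
     free_of (complete_partite r (s(r := p))) G \<longrightarrow>
     real (card (copies (complete_partite r a) G)) \<le>
       C * real n powr ((\<Sum>i=1..r. real (a i)) - (\<Prod>i=1..r. real (a i)) / (\<Prod>i=1..r-1. real (s i)))"
proof -
  \<comment> \<open>\<open>t j\<close> holds the sizes after \<open>j\<close> lowerings. The last
    size is \<open>a 1\<close> from the start, since the free part is cut down from \<open>p\<close>
    at once. \<open>\<delta> j\<close> is the saving in the exponent that is left at that
    stage.\<close>
  define t where "t j i = (if i = r then a 1 else if i \<le> j then a (i + 1) else s i)" for j i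
  define \<delta> where "\<delta> j = real (a 1) * (\<Prod>i=1..j. real (a (i + 1)) / real (s i))" for j
  define good where "good n G \<longleftrightarrow> card (verts G) = n \<and> uniform r G \<and> free_of (complete_partite r (s(r := p))) G"
    for n and G :: "'v hypergraph"
  have fin: "finite (verts G)" if "good n G" for n G
    using that by (simp add: good_def uniform_def hypergraph_def)
  \<comment> \<open>So \<delta> j \<le> a 1 \<le> s 1 \<le> s (j + 1), which is the condition of
    \<open>sum_choose_powr_le\<close> for the next lowering.\<close>
  have s1: "s 1 \<le> s i" if "1 \<le> i" "i \<le> r - 1" for i
    using that
  proof (induction i rule: dec_induct)
    case (step i)
    then have "s i \<le> s (i + 1)" using mono by auto
    then show ?case using step by simp
  qed simp
  have \<delta>0: "\<delta> j \<ge> 0" for j by (auto simp: \<delta>_def intro!: mult_nonneg_nonneg prod_nonneg)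
  have \<delta>1: "\<delta> j \<le> real (a 1)" if "j \<le> r - 1" for j
  proof -
    have "(\<Prod>i=1..j. real (a (i + 1)) / real (s i)) \<le> 1"
    proof (rule prod_le_1)
      fix i assume "i \<in> {1..j}"
      then have "i + 1 \<in> {2..r}" using that r by auto
      then have "a (i + 1) \<le> s i" using as by fastforce
      then show "0 \<le> real (a (i + 1)) / real (s i) \<and> real (a (i + 1)) / real (s i) \<le> 1"
        by (auto simp: divide_le_eq_1)
    qed
    then show ?thesis unfolding \<delta>_def by (simp add: mult_left_le)
  qed
  have "\<exists>C\<ge>0. \<forall>n\<ge>1. \<forall>G :: 'v hypergraph. good n G \<longrightarrow>
     real (card (grids r (t j) G)) \<le> C * real n powr ((\<Sum>i=1..r. real (t j i)) - \<delta> j)"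
    if "j \<le> r - 1" for j
    using that
  proof (induction j)
    case 0
    show ?case
    \<comment> \<open>Freeness bounds each extension by \<open>p\<close>, so it has at most
      \<open>p ^ a 1\<close> subsets of size \<open>a 1\<close>; the exponent then counts only the
      other \<open>r - 1\<close> parts.\<close>
    proof (intro exI[of _ "real (p ^ a 1)"] conjI allI impI)
      fix n :: nat and G :: "'v hypergraph" assume n: "n \<ge> 1" and G: "good n G"
      define J where "J = {1..r} - {r}"
      let ?RR = "PiE J (\<lambda>i. {S. S \<subseteq> verts G \<and> card S = t 0 i})"
      have rr: "r \<in> {1..r}" using r by simp
      have I: "{1..r} = insert r J" "r \<notin> J" "finite J" using r by (auto simp: J_def)
      have "card (grids r (t 0) G) = (\<Sum>R\<in>?RR. card (extension J G R) choose t 0 r)"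
        unfolding J_def by (rule card_grids_eq[OF fin[OF G] rr])
      also have "\<dots> \<le> (\<Sum>R\<in>?RR. p ^ a 1)"
      proof (rule sum_mono)
        fix R assume "R \<in> ?RR"
        also have "?RR = PiE J (\<lambda>i. {S. S \<subseteq> verts G \<and> card S = (s(r := p)) i})"
          by (rule PiE_cong) (auto simp: t_def J_def)
        finally have R: "R \<in> PiE ({1..r} - {r}) (\<lambda>i. {S. S \<subseteq> verts G \<and> card S = (s(r := p)) i})"
          unfolding J_def .
        have u: "\<forall>i\<in>{1..r}. (s(r := p)) i > 0" using s p by auto
        have "card (extension J G R) < (s(r := p)) r"
          unfolding J_def
          by (rule extension_card_less[where u = "s(r := p)", OF _ _ u _ R]) (use G r in \<open>auto simp: good_def\<close>)
        then have le: "card (extension J G R) \<le> p" by simp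
        have "card (extension J G R) choose a 1 \<le> card (extension J G R) ^ a 1"
          by (cases "a 1 \<le> card (extension J G R)") (auto intro: binomial_le_pow simp: binomial_eq_0)
        also have "\<dots> \<le> p ^ a 1" using le by (rule power_mono) simp
        finally show "card (extension J G R) choose t 0 r \<le> p ^ a 1" by (simp add: t_def)
      qed
      also have "\<dots> = p ^ a 1 * card ?RR" by simp
      also have "\<dots> \<le> p ^ a 1 * n ^ (\<Sum>i\<in>J. t 0 i)"
        using card_subset_tuples_le[OF fin[OF G] I(3)] G by (intro mult_left_mono) (auto simp: good_def)
      finally have "real (card (grids r (t 0) G)) \<le> real (p ^ a 1 * n ^ (\<Sum>i\<in>J. t 0 i))"
        by (simp only: of_nat_le_iff)
      also have "\<dots> = real (p ^ a 1) * real n powr (\<Sum>i\<in>J. real (t 0 i))"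
        using n by (simp flip: of_nat_sum add: powr_realpow)
      also have "(\<Sum>i\<in>J. real (t 0 i)) = (\<Sum>i=1..r. real (t 0 i)) - \<delta> 0"
        unfolding I(1) using I by (simp add: \<delta>_def t_def)
      finally show "real (card (grids r (t 0) G)) \<le> real (p ^ a 1) * real n powr ((\<Sum>i=1..r. real (t 0 i)) - \<delta> 0)" .
    qed simp
  next
    case (Suc j)
    then obtain C where C: "C \<ge> 0" "\<And>n G. n \<ge> 1 \<Longrightarrow> good n G \<Longrightarrow>
        real (card (grids r (t j) G)) \<le> C * real n powr ((\<Sum>i=1..r. real (t j i)) - \<delta> j)"
      by auto
    define \<sigma> where "\<sigma> = s (Suc j)"
    define \<alpha> where "\<alpha> = a (Suc j + 1)"
    define J where "J = {1..r} - {Suc j}"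
    have jr: "Suc j \<in> {1..r}" using Suc.prems by simp
    have I: "{1..r} = insert (Suc j) J" "Suc j \<notin> J" "finite J" using Suc.prems by (auto simp: J_def)
    have tj: "t j (Suc j) = \<sigma>" "t (Suc j) (Suc j) = \<alpha>" "\<And>i. i \<in> J \<Longrightarrow> t (Suc j) i = t j i"
      using Suc.prems r by (auto simp: t_def \<sigma>_def \<alpha>_def J_def)
    have \<sigma>: "\<sigma> > 0" using s Suc.prems by (auto simp: \<sigma>_def)
    have "Suc j + 1 \<in> {2..r}" using Suc.prems by auto
    then have \<alpha>\<sigma>: "\<alpha> \<le> \<sigma>" using as by (fastforce simp: \<sigma>_def \<alpha>_def)
    have "\<delta> j \<le> a 1" using \<delta>1[of j] Suc.prems by simp
    moreover have "a 1 \<le> \<sigma>" using as1 s1[of "Suc j"] Suc.prems by (simp add: \<sigma>_def)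
    ultimately have \<delta>\<sigma>: "\<delta> j \<le> real \<sigma>" by linarith
    have \<delta>Suc: "\<delta> (Suc j) = \<delta> j * (real \<alpha> / real \<sigma>)"
      by (simp add: \<delta>_def \<alpha>_def \<sigma>_def)
    define \<rho> where "\<rho> = (\<Sum>i\<in>J. real (t j i))"
    show ?case
    proof (intro exI[of _ "1 + real \<sigma> ^ \<sigma> * (C + 1)"] conjI allI impI)
      show "0 \<le> 1 + real \<sigma> ^ \<sigma> * (C + 1)" using C(1) by simp
      fix n :: nat and G :: "'v hypergraph" assume n: "n \<ge> 1" and G: "good n G"
      let ?RR = "PiE J (\<lambda>i. {S. S \<subseteq> verts G \<and> card S = t j i})"
      have finR: "finite ?RR" using I(3) fin[OF G] by (intro finite_PiE) auto
      have RR: "PiE J (\<lambda>i. {S. S \<subseteq> verts G \<and> card S = t (Suc j) i}) = ?RR"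
        by (rule PiE_cong) (simp add: tj)
      have c1: "card (grids r (t j) G) = (\<Sum>R\<in>?RR. card (extension J G R) choose \<sigma>)"
        unfolding tj(1)[symmetric] J_def by (rule card_grids_eq[OF fin[OF G] jr])
      have c2: "card (grids r (t (Suc j)) G) = (\<Sum>R\<in>?RR. card (extension J G R) choose \<alpha>)"
        unfolding tj(2)[symmetric] RR[symmetric] unfolding J_def by (rule card_grids_eq[OF fin[OF G] jr])
      have "real (card ?RR) \<le> real (n ^ (\<Sum>i\<in>J. t j i))"
        using card_subset_tuples_le[OF fin[OF G] I(3), of "t j"] G by (simp add: good_def del: of_nat_power)
      also have "\<dots> = real n powr \<rho>" using n by (simp flip: of_nat_sum add: \<rho>_def powr_realpow)
      finally have cR: "real (card ?RR) \<le> real n powr \<rho>" .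
      have "(\<Sum>i=1..r. real (t j i)) - \<delta> j = \<rho> + \<sigma> - \<delta> j"
        unfolding I(1) using I(2,3) by (simp add: \<rho>_def tj)
      then have N: "(\<Sum>R\<in>?RR. real (card (extension J G R) choose \<sigma>)) \<le> C * real n powr (\<rho> + \<sigma> - \<delta> j)"
        using C(2)[OF n G] unfolding c1 by (simp del: sum.insert)
      have "real (card (grids r (t (Suc j)) G)) = (\<Sum>R\<in>?RR. real (card (extension J G R) choose \<alpha>))"
        unfolding c2 by simp
      also have "\<dots> \<le> (1 + real \<sigma> ^ \<sigma> * (C + 1)) * real n powr (\<rho> + \<alpha> - \<delta> j * (\<alpha> / \<sigma>))"
        by (rule sum_choose_powr_le[OF finR n \<delta>0 \<delta>\<sigma> \<alpha>\<sigma> \<sigma> cR N])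
      also have "\<rho> + \<alpha> - \<delta> j * (\<alpha> / \<sigma>) = (\<Sum>i=1..r. real (t (Suc j) i)) - \<delta> (Suc j)"
        unfolding I(1) \<delta>Suc using I(2,3) by (simp add: \<rho>_def tj)
      finally show "real (card (grids r (t (Suc j)) G))
        \<le> (1 + real \<sigma> ^ \<sigma> * (C + 1)) * real n powr ((\<Sum>i=1..r. real (t (Suc j) i)) - \<delta> (Suc j))" .
    qed
  qed
  from this[of "r - 1"] obtain C where C: "C \<ge> 0" "\<And>n G. n \<ge> 1 \<Longrightarrow> good n G \<Longrightarrow>
      real (card (grids r (t (r - 1)) G)) \<le> C * real n powr ((\<Sum>i=1..r. real (t (r - 1) i)) - \<delta> (r - 1))"
    by auto
  \<comment> \<open>The induction ends with the sizes a 2, ..., a r, a 1.\<close>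
  define \<pi> where "\<pi> i = (if i = r then 1 else i + 1)" for i :: nat
  have \<pi>: "bij_betw \<pi> {1..r} {1..r}"
    by (rule bij_betw_byWitness[where f' = "\<lambda>i. if i = 1 then r else i - 1"])
       (use r in \<open>auto simp: \<pi>_def\<close>)
  have t\<pi>: "t (r - 1) i = a (\<pi> i)" if "i \<in> {1..r}" for i
    using that by (auto simp: t_def \<pi>_def)
  have sum: "(\<Sum>i=1..r. real (t (r - 1) i)) = (\<Sum>i=1..r. real (a i))"
    using t\<pi> sum.reindex_bij_betw[OF \<pi>, of "\<lambda>i. real (a i)"] by simp
  have "(\<Prod>i=1..r. real (a i)) = real (a 1) * (\<Prod>i=2..r. real (a i))"
    using r by (subst prod.atLeast_Suc_atMost) (auto simp: numeral_2_eq_2)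
  also have "(\<Prod>i=2..r. real (a i)) = (\<Prod>i=1..r-1. real (a (i + 1)))"
    by (rule prod.reindex_bij_witness[of _ "\<lambda>i. i + 1" "\<lambda>i. i - 1"]) auto
  finally have \<delta>r: "\<delta> (r - 1) = (\<Prod>i=1..r. real (a i)) / (\<Prod>i=1..r-1. real (s i))"
    by (simp add: \<delta>_def prod_dividef)
  have gr: "grids r (\<lambda>i. a (\<pi> i)) G = grids r (t (r - 1)) G" for G :: "'v hypergraph"
  proof -
    have "PiE {1..r} (\<lambda>i. {S. S \<subseteq> verts G \<and> card S = a (\<pi> i)})
        = PiE {1..r} (\<lambda>i. {S. S \<subseteq> verts G \<and> card S = t (r - 1) i})"
      by (rule PiE_cong) (simp only: t\<pi>)
    then show ?thesis unfolding grids_def by simp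
  qed
  show ?thesis
  proof (intro exI[of _ C] conjI allI impI C(1))
    fix n :: nat and G :: "'v hypergraph"
    assume n: "1 \<le> n" and G: "card (verts G) = n" "uniform r G" "free_of (complete_partite r (s(r := p))) G"
    have "real (card (copies (complete_partite r a) G)) \<le> real (card (grids r (\<lambda>i. a (\<pi> i)) G))"
      using card_copies_le_grids[OF G(2) \<pi>, of a] by simp
    also have "\<dots> \<le> C * real n powr ((\<Sum>i=1..r. real (t (r - 1) i)) - \<delta> (r - 1))"
      unfolding gr using C(2)[OF n, of G] G by (simp add: good_def)
    finally show "real (card (copies (complete_partite r a) G)) \<le>
       C * real n powr ((\<Sum>i=1..r. real (a i)) - (\<Prod>i=1..r. real (a i)) / (\<Prod>i=1..r-1. real (s i)))"
      unfolding sum \<delta>r .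
  qed
qed

section \<open>Polynomial systems whose leading forms split\<close>

text \<open>
  Monomials in \<open>k\<close> variables are encoded as words of variable indices. Words that are permutations of
  each other give the same function, so the coefficients in \<open>polys\<close> are not unique; only
  spanning matters below. Functions are compared on \<open>Z\<close> only.
\<close>

definition words :: "nat \<Rightarrow> nat \<Rightarrow> nat list set" where
  "words k E = {l. set l \<subseteq> {..<k} \<and> length l \<le> E}"

definition wmon :: "nat list \<Rightarrow> (nat \<Rightarrow> 'a::comm_ring_1) \<Rightarrow> 'a" where
  "wmon l x = prod_list (map x l)"

definition polys :: "'a::comm_ring_1 set \<Rightarrow> (nat \<Rightarrow> 'a) set \<Rightarrow> nat \<Rightarrow> nat \<Rightarrow> ((nat \<Rightarrow> 'a) \<Rightarrow> 'a) set" where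
  "polys K Z k E = {f. \<exists>c. (\<forall>l. c l \<in> K) \<and> (\<forall>x\<in>Z. f x = (\<Sum>l\<in>words k E. c l * wmon l x))}"

text \<open>Coefficients range over a subset of a type, because two domains inside the same field
  occur: the finite field with \<open>q ^ m\<close> elements for the random tensors, and the whole
  field for counting solutions.\<close>

locale coeff_ring =
  fixes K :: "'a::comm_ring_1 set"
  assumes K_0 [simp]: "0 \<in> K" and K_1 [simp]: "1 \<in> K"
    and K_add: "x \<in> K \<Longrightarrow> y \<in> K \<Longrightarrow> x + y \<in> K"
    and K_uminus: "x \<in> K \<Longrightarrow> - x \<in> K"
    and K_mult: "x \<in> K \<Longrightarrow> y \<in> K \<Longrightarrow> x * y \<in> K"
begin

lemma K_diff: "x \<in> K \<Longrightarrow> y \<in> K \<Longrightarrow> x - y \<in> K"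
  using K_add[OF _ K_uminus, of x y] by simp

lemma K_sum: "(\<And>i. i \<in> I \<Longrightarrow> f i \<in> K) \<Longrightarrow> (\<Sum>i\<in>I. f i) \<in> K"
  by (induction I rule: infinite_finite_induct) (auto intro: K_add)

lemma K_prod: "(\<And>i. i \<in> I \<Longrightarrow> f i \<in> K) \<Longrightarrow> (\<Prod>i\<in>I. f i) \<in> K"
  by (induction I rule: infinite_finite_induct) (auto intro: K_mult)

end

locale coeff_field = coeff_ring K for K :: "'a::field set" +
  assumes K_divide: "x \<in> K \<Longrightarrow> y \<in> K \<Longrightarrow> x / y \<in> K"

lemma coeff_field_UNIV: "coeff_field (UNIV :: 'a::field set)"
  by unfold_locales auto

section \<open>Degree calculus for polynomial functions on a set of points\<close>

lemma finite_words [simp]: "finite (words k E)"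
  unfolding words_def by (rule finite_lists_length_le) simp

lemma words_mono: "E \<le> E' \<Longrightarrow> words k E \<subseteq> words k E'"
  by (auto simp: words_def)

lemma wmon_simps [simp]:
  "wmon [] x = 1" "wmon (j # l) x = x j * wmon l x" "wmon (l @ l') x = wmon l x * wmon l' x"
  "wmon (replicate n j) x = x j ^ n"
  by (auto simp: wmon_def)

context coeff_ring
begin

lemma polys_cong: "f \<in> polys K Z k E \<Longrightarrow> (\<And>x. x \<in> Z \<Longrightarrow> g x = f x) \<Longrightarrow> g \<in> polys K Z k E"
  unfolding polys_def by force

lemma polys_mon: "l \<in> words k E \<Longrightarrow> wmon l \<in> polys K Z k E"
  unfolding polys_def mem_Collect_eq
  by (rule exI[of _ "\<lambda>l'. if l' = l then 1 else 0"]) (simp add: if_distrib[of "\<lambda>y. y * _"] cong: if_cong)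

lemma polys_add: "f \<in> polys K Z k E \<Longrightarrow> g \<in> polys K Z k E \<Longrightarrow> (\<lambda>x. f x + g x) \<in> polys K Z k E"
proof -
  assume "f \<in> polys K Z k E" "g \<in> polys K Z k E"
  then obtain c d where "\<forall>l. c l \<in> K" "\<forall>l. d l \<in> K" "\<forall>x\<in>Z. f x = (\<Sum>l\<in>words k E. c l * wmon l x)"
    "\<forall>x\<in>Z. g x = (\<Sum>l\<in>words k E. d l * wmon l x)"
    by (auto simp: polys_def)
  then show ?thesis unfolding polys_def mem_Collect_eq
    by (intro exI[of _ "\<lambda>l. c l + d l"]) (simp add: sum.distrib distrib_right K_add)
qed

lemma polys_smult: "a \<in> K \<Longrightarrow> f \<in> polys K Z k E \<Longrightarrow> (\<lambda>x. a * f x) \<in> polys K Z k E"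
proof -
  assume "a \<in> K" "f \<in> polys K Z k E"
  then obtain c where "\<forall>l. c l \<in> K" "\<forall>x\<in>Z. f x = (\<Sum>l\<in>words k E. c l * wmon l x)"
    by (auto simp: polys_def)
  then show ?thesis unfolding polys_def mem_Collect_eq
    by (intro exI[of _ "\<lambda>l. a * c l"]) (simp add: sum_distrib_left mult.assoc K_mult \<open>a \<in> K\<close>)
qed

lemma polys_zero: "(\<lambda>x. 0) \<in> polys K Z k E"
  unfolding polys_def by (auto intro!: exI[of _ "\<lambda>_. 0"])

lemma polys_const: "a \<in> K \<Longrightarrow> (\<lambda>x. a) \<in> polys K Z k E"
proof -
  assume "a \<in> K"
  have "(\<lambda>x. a * wmon [] x) \<in> polys K Z k E"
    using \<open>a \<in> K\<close> by (intro polys_smult polys_mon) (auto simp: words_def)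
  then show ?thesis by simp
qed

lemma polys_sum: "(\<And>i. i \<in> I \<Longrightarrow> f i \<in> polys K Z k E) \<Longrightarrow> (\<lambda>x. \<Sum>i\<in>I. f i x) \<in> polys K Z k E"
  by (induction I rule: infinite_finite_induct) (auto intro: polys_zero polys_add)

lemma polys_diff: "f \<in> polys K Z k E \<Longrightarrow> g \<in> polys K Z k E \<Longrightarrow> (\<lambda>x. f x - g x) \<in> polys K Z k E"
  using polys_add[OF _ polys_smult[of "-1" g Z k E], of f] by (simp add: K_uminus)

lemma polys_mono:
  assumes "f \<in> polys K Z k E" "E \<le> E'" shows "f \<in> polys K Z k E'"
proof -
  obtain c where cK: "\<forall>l. c l \<in> K" and c: "\<forall>x\<in>Z. f x = (\<Sum>l\<in>words k E. c l * wmon l x)"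
    using assms(1) by (auto simp: polys_def)
  have "(\<lambda>x. \<Sum>l\<in>words k E. c l * wmon l x) \<in> polys K Z k E'"
    using words_mono[OF assms(2)] cK by (intro polys_sum polys_smult polys_mon) auto
  then show ?thesis by (rule polys_cong) (use c in auto)
qed

lemma polys_mult:
  assumes "f \<in> polys K Z k E" "g \<in> polys K Z k E'"
  shows "(\<lambda>x. f x * g x) \<in> polys K Z k (E + E')"
proof -
  obtain c d where cK: "\<forall>l. c l \<in> K" "\<forall>l. d l \<in> K" and c: "\<forall>x\<in>Z. f x = (\<Sum>l\<in>words k E. c l * wmon l x)"
    and d: "\<forall>x\<in>Z. g x = (\<Sum>l\<in>words k E'. d l * wmon l x)"
    using assms by (auto simp: polys_def)
  have "(\<lambda>x. \<Sum>l\<in>words k E. \<Sum>l'\<in>words k E'. (c l * d l') * wmon (l @ l') x) \<in> polys K Z k (E + E')"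
    using cK by (intro polys_sum polys_smult polys_mon) (auto simp: words_def intro: K_mult)
  then show ?thesis
    by (rule polys_cong) (simp add: c d sum_product algebra_simps)
qed

lemma polys_prod:
  assumes "finite I" "\<And>i. i \<in> I \<Longrightarrow> f i \<in> polys K Z k (e i)"
  shows "(\<lambda>x. \<Prod>i\<in>I. f i x) \<in> polys K Z k (\<Sum>i\<in>I. e i)"
  using assms
  by (induction I rule: finite_induct) (auto intro: polys_const polys_mult)

lemma polys_coord: "j < k \<Longrightarrow> 1 \<le> E \<Longrightarrow> (\<lambda>x. x j) \<in> polys K Z k E"
  by (rule polys_cong[OF polys_mon[of "[j]"]]) (auto simp: words_def)

text \<open>Perturbing every factor of degree \<open>D\<close> below its top degree changes the
  product only below its top degree. It lets the leading forms stand in for the actual factors of a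
  norm.\<close>

lemma polys_prod_diff:
  assumes "finite I" "D \<ge> 1" "\<And>i. i \<in> I \<Longrightarrow> f i \<in> polys K Z k D"
    and "\<And>i. i \<in> I \<Longrightarrow> u i \<in> polys K Z k (D - 1)" and "I \<noteq> {}"
  shows "(\<lambda>x. (\<Prod>i\<in>I. f i x + u i x) - (\<Prod>i\<in>I. f i x)) \<in> polys K Z k (D * card I - 1)"
  using assms(1,5,3,4)
proof (induction I rule: finite_ne_induct)
  case (singleton i)
  have "u i \<in> polys K Z k (D * card {i} - 1)" using singleton by simp
  then show ?case by (rule polys_cong) simp
next
  case (insert i I)
  have D: "D * card I \<ge> 1" using assms(2) insert.hyps by (simp add: Suc_leI card_gt_0_iff)
  have f: "(\<lambda>x. \<Prod>i\<in>I. f i x) \<in> polys K Z k (D * card I)"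
    using polys_prod[OF insert.hyps(1), of f Z k "\<lambda>_. D"] insert.prems(1) by (auto simp: mult.commute)
  have IH: "(\<lambda>x. (\<Prod>i\<in>I. f i x + u i x) - (\<Prod>i\<in>I. f i x)) \<in> polys K Z k (D * card I - 1)"
    by (rule insert.IH) (use insert.prems in auto)
  have 1: "(\<lambda>x. (f i x + u i x) * ((\<Prod>i\<in>I. f i x + u i x) - (\<Prod>i\<in>I. f i x))) \<in> polys K Z k (D + (D * card I - 1))"
    by (rule polys_mult[OF polys_add IH])
      (use insert.prems polys_mono[of "u i" Z k "D - 1" D] in simp_all)
  have 2: "(\<lambda>x. u i x * (\<Prod>i\<in>I. f i x)) \<in> polys K Z k ((D - 1) + D * card I)"
    by (rule polys_mult[OF _ f]) (use insert.prems in simp)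
  have e: "D + (D * card I - 1) = D * card (insert i I) - 1" "(D - 1) + D * card I = D * card (insert i I) - 1"
    using D assms(2) insert.hyps by simp_all
  show ?case
  proof (rule polys_cong[OF polys_add[OF 1[unfolded e] 2[unfolded e]]])
    fix x
    let ?P = "\<Prod>i\<in>I. f i x + u i x" and ?Q = "\<Prod>i\<in>I. f i x"
    have "(f i x + u i x) * ?P - f i x * ?Q = (f i x + u i x) * (?P - ?Q) + u i x * ?Q"
      by (simp add: algebra_simps)
    then show "(\<Prod>i\<in>insert i I. f i x + u i x) - (\<Prod>i\<in>insert i I. f i x)
        = (f i x + u i x) * (?P - ?Q) + u i x * ?Q"
      using insert.hyps by simp
  qed
qed

end

text \<open>Expanding \<open>\<Prod>\<tau> (\<Sum>i. L i (\<tau> i))\<close> over all selections \<open>\<tau>\<close>, every resulting term contains a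
  complete product \<open>\<Prod>\<sigma> L i \<sigma>\<close>: otherwise a selection of missing indices contradicts itself.\<close>

lemma selection_covers:
  assumes "\<And>\<tau>. \<tau> \<in> PiE I (\<lambda>_. M) \<Longrightarrow> g \<tau> \<in> I"
  shows "\<exists>i\<in>I. \<forall>\<sigma>\<in>M. \<exists>\<tau>\<in>PiE I (\<lambda>_. M). g \<tau> = i \<and> \<tau> i = \<sigma>"
proof (rule ccontr)
  define Q where "Q i \<sigma> \<longleftrightarrow> (\<exists>\<tau>\<in>PiE I (\<lambda>_. M). g \<tau> = i \<and> \<tau> i = \<sigma>)" for i \<sigma>
  assume "\<not> ?thesis"
  then have "\<forall>i\<in>I. \<exists>\<sigma>. \<sigma> \<in> M \<and> \<not> Q i \<sigma>"
    unfolding Q_def[symmetric] by blast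
  then obtain f where f: "\<And>i. i \<in> I \<Longrightarrow> f i \<in> M" "\<And>i. i \<in> I \<Longrightarrow> \<not> Q i (f i)"
    using bchoice[of I "\<lambda>i \<sigma>. \<sigma> \<in> M \<and> \<not> Q i \<sigma>"] by blast
  let ?t = "restrict f I"
  have t: "?t \<in> PiE I (\<lambda>_. M)" using f(1) by auto
  have "Q (g ?t) (f (g ?t))"
    unfolding Q_def by (rule bexI[OF _ t]) (use assms[OF t] in simp)
  with f(2)[OF assms[OF t]] show False by contradiction
qed

text \<open>The product over \<sigma> of the factors \<open>H i \<sigma>\<close> is the constant
  \<open>b\<close> on \<open>Z\<close>, so there the product of the leading forms
  \<open>L i \<sigma>\<close> has degree below \<open>D * m\<close>. For every selection \<tau> the
  hypothesis \<open>inv\<close> writes x_j^D as a combination of the forms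
  \<open>L i (\<tau> i)\<close>. Multiplying these expressions over all \<open>m ^ card I\<close>
  selections gives the required power of x_j. By \<open>selection_covers\<close> each term of the
  expansion contains the full product of forms for some \<open>i\<close>, and therefore drops in
  degree.\<close>

lemma high_power_reduces:
  fixes c :: "'i \<Rightarrow> nat \<Rightarrow> nat \<Rightarrow> 'a::field" and H :: "'i \<Rightarrow> nat \<Rightarrow> (nat \<Rightarrow> 'a) \<Rightarrow> 'a"
  assumes "finite I" "m \<ge> 1" "D \<ge> 1" and j: "j < k"
    and low: "\<And>i \<sigma>. i \<in> I \<Longrightarrow> \<sigma> < m \<Longrightarrow>
           (\<lambda>x. (\<Sum>j'<k. c i \<sigma> j' * x j' ^ D) - H i \<sigma> x) \<in> polys UNIV Z k (D - 1)"
    and eq: "\<And>i x. i \<in> I \<Longrightarrow> x \<in> Z \<Longrightarrow> (\<Prod>\<sigma><m. H i \<sigma> x) = b"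
    and inv: "\<And>\<tau>. \<tau> \<in> PiE I (\<lambda>_. {..<m}) \<Longrightarrow> \<exists>\<alpha>. \<forall>j'<k. (\<Sum>i\<in>I. \<alpha> i * c i (\<tau> i) j') = (if j' = j then 1 else 0)"
  shows "(\<lambda>x. x j ^ (D * m ^ card I)) \<in> polys UNIV Z k (D * m ^ card I - 1)"
proof -
  interpret coeff_field "UNIV :: 'a set" by (rule coeff_field_UNIV)
  define T where "T = PiE I (\<lambda>_. {..<m})"
  have finT: "finite T" unfolding T_def using assms(1) by (intro finite_PiE) auto
  have cardT: "card T = m ^ card I" unfolding T_def using assms(1) by (simp add: card_PiE)
  define L where "L i \<sigma> x = (\<Sum>j'<k. c i \<sigma> j' * x j' ^ D)" for i \<sigma> and x :: "nat \<Rightarrow> 'a"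
  obtain \<alpha> where \<alpha>: "\<And>\<tau> j'. \<tau> \<in> T \<Longrightarrow> j' < k \<Longrightarrow> (\<Sum>i\<in>I. \<alpha> \<tau> i * c i (\<tau> i) j') = (if j' = j then 1 else 0)"
    using inv unfolding T_def[symmetric] by metis
  have LP: "L i \<sigma> \<in> polys UNIV Z k D" for i \<sigma>
    unfolding L_def
  proof (intro polys_sum polys_smult UNIV_I)
    fix j' assume "j' \<in> {..<k}"
    then show "(\<lambda>x. x j' ^ D) \<in> polys UNIV Z k D"
      by (intro polys_cong[OF polys_mon[of "replicate D j'"]]) (auto simp: words_def)
  qed
  have z: "x j ^ D = (\<Sum>i\<in>I. \<alpha> \<tau> i * L i (\<tau> i) x)" if "\<tau> \<in> T" for \<tau> x
  proof -
    have "(\<Sum>i\<in>I. \<alpha> \<tau> i * L i (\<tau> i) x) = (\<Sum>j'<k. \<Sum>i\<in>I. \<alpha> \<tau> i * c i (\<tau> i) j' * x j' ^ D)"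
      unfolding L_def by (subst sum.swap) (simp add: sum_distrib_left mult.assoc)
    also have "\<dots> = (\<Sum>j'<k. (\<Sum>i\<in>I. \<alpha> \<tau> i * c i (\<tau> i) j') * x j' ^ D)"
      by (simp add: sum_distrib_right)
    also have "\<dots> = (\<Sum>j'<k. if j' = j then x j ^ D else 0)"
      using \<alpha>[OF that] by (intro sum.cong) auto
    finally show ?thesis using j by simp
  qed
  have full: "(\<lambda>x. \<Prod>\<sigma><m. L i \<sigma> x) \<in> polys UNIV Z k (D * m - 1)" if "i \<in> I" for i
  proof -
    have HP: "H i \<sigma> \<in> polys UNIV Z k D" if "\<sigma> < m" for \<sigma>
      by (rule polys_cong[OF polys_diff[OF LP[of i \<sigma>] polys_mono[OF low[OF \<open>i \<in> I\<close> that], of D]]])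
         (auto simp: L_def)
    have "(\<lambda>x. (\<Prod>\<sigma><m. H i \<sigma> x + (L i \<sigma> x - H i \<sigma> x)) - (\<Prod>\<sigma><m. H i \<sigma> x)) \<in> polys UNIV Z k (D * card {..<m} - 1)"
      using assms(2,3) HP low[OF \<open>i \<in> I\<close>] by (intro polys_prod_diff) (auto simp: L_def lessThan_empty_iff)
    then have "(\<lambda>x. ((\<Prod>\<sigma><m. L i \<sigma> x) - (\<Prod>\<sigma><m. H i \<sigma> x)) + b) \<in> polys UNIV Z k (D * m - 1)"
      by (intro polys_add polys_const UNIV_I) simp
    then show ?thesis
      by (rule polys_cong) (simp add: eq[OF that])
  qed
  have trm: "(\<lambda>x. \<Prod>\<tau>\<in>T. \<alpha> \<tau> (g \<tau>) * L (g \<tau>) (\<tau> (g \<tau>)) x) \<in> polys UNIV Z k (D * m ^ card I - 1)"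
    if g: "g \<in> PiE T (\<lambda>_. I)" for g
  proof -
    have "\<exists>i\<in>I. \<forall>\<sigma>\<in>{..<m}. \<exists>\<tau>\<in>T. g \<tau> = i \<and> \<tau> i = \<sigma>"
      unfolding T_def by (rule selection_covers) (rule PiE_mem[OF g[unfolded T_def]])
    then obtain i where i: "i \<in> I" "\<forall>\<sigma>\<in>{..<m}. \<exists>\<tau>\<in>T. g \<tau> = i \<and> \<tau> i = \<sigma>" ..
    \<comment> \<open>For each \<sigma> this fixes a selection whose factor in the term is
      \<open>L i \<sigma>\<close>. Distinct \<sigma> give distinct selections, so these
      \<open>m\<close> factors occur at different places and multiply to the full product for
      \<open>i\<close>.\<close>
    then obtain t where t: "\<And>\<sigma>. \<sigma> < m \<Longrightarrow> t \<sigma> \<in> T \<and> g (t \<sigma>) = i \<and> t \<sigma> i = \<sigma>" by (metis lessThan_iff)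
    have inj: "inj_on t {..<m}" by (rule inj_onI) (metis t lessThan_iff)
    define S where "S = t ` {..<m}"
    have S: "S \<subseteq> T" "card S = m" using t inj by (auto simp: S_def card_image)
    have "(\<Prod>\<tau>\<in>S. L (g \<tau>) (\<tau> (g \<tau>)) x) = (\<Prod>\<sigma><m. L i \<sigma> x)" for x
      unfolding S_def using t by (subst prod.reindex[OF inj]) (auto intro!: prod.cong)
    then have 1: "(\<lambda>x. \<Prod>\<tau>\<in>S. L (g \<tau>) (\<tau> (g \<tau>)) x) \<in> polys UNIV Z k (D * m - 1)"
      using full[OF i(1)] by simp
    have 2: "(\<lambda>x. \<Prod>\<tau>\<in>T - S. L (g \<tau>) (\<tau> (g \<tau>)) x) \<in> polys UNIV Z k (D * (card T - m))"
      using polys_prod[of "T - S" "\<lambda>\<tau>. L (g \<tau>) (\<tau> (g \<tau>))" Z k "\<lambda>_. D"] LP finT S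
      by (simp add: card_Diff_subset finite_subset mult.commute)
    have le: "m \<le> card T" using S finT card_mono by blast
    have "D * m - 1 + D * (card T - m) = D * card T - 1"
      using le assms(2,3) by (simp add: diff_mult_distrib2)
    with polys_smult[OF _ polys_mult[OF 1 2], of "\<Prod>\<tau>\<in>T. \<alpha> \<tau> (g \<tau>)"]
    have "(\<lambda>x. (\<Prod>\<tau>\<in>T. \<alpha> \<tau> (g \<tau>)) * ((\<Prod>\<tau>\<in>S. L (g \<tau>) (\<tau> (g \<tau>)) x) * (\<Prod>\<tau>\<in>T - S. L (g \<tau>) (\<tau> (g \<tau>)) x)))
       \<in> polys UNIV Z k (D * m ^ card I - 1)" by (simp add: cardT)
    then show ?thesis
    proof (rule polys_cong)
      fix x
      have "(\<Prod>\<tau>\<in>T. L (g \<tau>) (\<tau> (g \<tau>)) x)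
          = (\<Prod>\<tau>\<in>T - S. L (g \<tau>) (\<tau> (g \<tau>)) x) * (\<Prod>\<tau>\<in>S. L (g \<tau>) (\<tau> (g \<tau>)) x)"
        by (rule prod.subset_diff[OF S(1) finT])
      then show "(\<Prod>\<tau>\<in>T. \<alpha> \<tau> (g \<tau>) * L (g \<tau>) (\<tau> (g \<tau>)) x) = (\<Prod>\<tau>\<in>T. \<alpha> \<tau> (g \<tau>)) *
          ((\<Prod>\<tau>\<in>S. L (g \<tau>) (\<tau> (g \<tau>)) x) * (\<Prod>\<tau>\<in>T - S. L (g \<tau>) (\<tau> (g \<tau>)) x))"
        by (simp add: prod.distrib mult.commute)
    qed
  qed
  have expand: "x j ^ (D * m ^ card I) = (\<Sum>g\<in>PiE T (\<lambda>_. I). \<Prod>\<tau>\<in>T. \<alpha> \<tau> (g \<tau>) * L (g \<tau>) (\<tau> (g \<tau>)) x)" for x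
  proof -
    have "x j ^ (D * m ^ card I) = (\<Prod>\<tau>\<in>T. x j ^ D)"
      by (simp add: cardT power_mult)
    also have "\<dots> = (\<Prod>\<tau>\<in>T. \<Sum>i\<in>I. \<alpha> \<tau> i * L i (\<tau> i) x)"
      using z by (intro prod.cong) auto
    also have "\<dots> = (\<Sum>g\<in>PiE T (\<lambda>_. I). \<Prod>\<tau>\<in>T. \<alpha> \<tau> (g \<tau>) * L (g \<tau>) (\<tau> (g \<tau>)) x)"
      using finT assms(1) by (intro prod_sum_PiE) auto
    finally show ?thesis .
  qed
  have "(\<lambda>x. \<Sum>g\<in>PiE T (\<lambda>_. I). \<Prod>\<tau>\<in>T. \<alpha> \<tau> (g \<tau>) * L (g \<tau>) (\<tau> (g \<tau>)) x) \<in> polys UNIV Z k (D * m ^ card I - 1)"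
    by (rule polys_sum) (rule trm)
  then show ?thesis
    by (rule polys_cong) (rule expand)
qed

text \<open>A word longer than \<open>k * B\<close> repeats some letter at least \<open>B\<close>
  times. Replacing that power by terms of degree below \<open>B\<close> shortens the word, so
  induction on the length brings every monomial down to degree \<open>k * B\<close>, whatever the
  original degree \<open>E\<close>.\<close>

lemma polys_reduce:
  fixes f :: "(nat \<Rightarrow> 'a::field) \<Rightarrow> 'a"
  assumes red: "\<And>j. j < k \<Longrightarrow> (\<lambda>x. x j ^ B) \<in> polys UNIV Z k (B - 1)" and "B \<ge> 1"
    and "f \<in> polys UNIV Z k E"
  shows "f \<in> polys UNIV Z k (k * B)"
proof -
  interpret coeff_field "UNIV :: 'a set" by (rule coeff_field_UNIV)
  have wmon: "wmon l \<in> polys UNIV Z k (k * B)" if "set l \<subseteq> {..<k}" for l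
    using that
  proof (induction "length l" arbitrary: l rule: less_induct)
    case less
    show ?case
    proof (cases "length l \<le> k * B")
      case True
      then show ?thesis using less by (intro polys_mon) (auto simp: words_def)
    next
      case False
      have "\<exists>j<k. count_list l j \<ge> B"
      proof (rule ccontr)
        assume "\<not> ?thesis"
        then have "(\<Sum>j<k. count_list l j) \<le> (\<Sum>j<k. B)" by (intro sum_mono) (auto simp: not_le)
        moreover have "(\<Sum>j<k. count_list l j) = length l"
          using less.prems sum_count_set[of l "{..<k}"] by simp
        ultimately show False using False by simp
      qed
      then obtain j where j: "j < k" "count_list l j \<ge> B" by blast
      \<comment> \<open>The word \<open>l\<close> with \<open>B\<close> occurrences of
        \<open>j\<close> removed, up to order, to which \<open>wmon\<close> is insensitive.\<close>
      define l1 where "l1 = filter (\<lambda>i. i \<noteq> j) l @ replicate (count_list l j - B) j"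
      have len0: "length (filter (\<lambda>i. i \<noteq> j) l) + count_list l j = length l"
        by (induction l) auto
      have len: "length l = B + length l1" using len0 j by (simp add: l1_def)
      have l1set: "set l1 \<subseteq> {..<k}" using less.prems j by (auto simp: l1_def)
      have "wmon l x = wmon (filter (\<lambda>i. i \<noteq> j) l) x * x j ^ count_list l j" for x :: "nat \<Rightarrow> 'a"
        by (induction l) (auto simp: algebra_simps)
      moreover have "x j ^ count_list l j = x j ^ (count_list l j - B) * x j ^ B" for x :: "nat \<Rightarrow> 'a"
        using j by (simp flip: power_add)
      ultimately have m: "wmon l x = x j ^ B * wmon l1 x" for x :: "nat \<Rightarrow> 'a"
        by (simp add: l1_def algebra_simps)
      have "(\<lambda>x. x j ^ B * wmon l1 x) \<in> polys UNIV Z k (B - 1 + length l1)"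
        using l1set by (intro polys_mult red j polys_mon) (auto simp: words_def)
      then obtain c where c: "\<forall>x\<in>Z. wmon l x = (\<Sum>l'\<in>words k (B - 1 + length l1). c l' * wmon l' x)"
        by (auto simp: polys_def m)
      have "(\<lambda>x. \<Sum>l'\<in>words k (B - 1 + length l1). c l' * wmon l' x) \<in> polys UNIV Z k (k * B)"
      proof (intro polys_sum polys_smult UNIV_I)
        fix l' assume "l' \<in> words k (B - 1 + length l1)"
        then show "wmon l' \<in> polys UNIV Z k (k * B)"
          using len assms(2) by (intro less.hyps) (auto simp: words_def)
      qed
      then show ?thesis by (rule polys_cong) (use c in auto)
    qed
  qed
  obtain c where c: "\<forall>x\<in>Z. f x = (\<Sum>l\<in>words k E. c l * wmon l x)"
    using assms(3) by (auto simp: polys_def)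
  have "(\<lambda>x. \<Sum>l\<in>words k E. c l * wmon l x) \<in> polys UNIV Z k (k * B)"
    by (intro polys_sum polys_smult wmon UNIV_I) (auto simp: words_def)
  then show ?thesis by (rule polys_cong) (use c in auto)
qed

context coeff_field
begin

text \<open>Lagrange interpolation: for every other point \<open>y\<close> one linear factor in a
  coordinate where \<open>y\<close> and \<open>z\<close> differ, normalised to 1 at
  \<open>z\<close>. The degree \<open>card Z - 1\<close> matters in
  \<open>dualizable_points\<close>, where it has to stay below \<open>D\<close>.\<close>

lemma polys_indicator:
  fixes Z :: "(nat \<Rightarrow> 'a) set"
  assumes ZK: "\<And>y j. y \<in> Z \<Longrightarrow> j < k \<Longrightarrow> y j \<in> K" and "finite Z" "z \<in> Z"
    and sep: "\<And>y. y \<in> Z \<Longrightarrow> y \<noteq> z \<Longrightarrow> \<exists>j<k. y j \<noteq> z j"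
  shows "(\<lambda>x. if x = z then 1 else 0) \<in> polys K Z k (card Z - 1)"
proof -
  obtain j where j: "\<And>y. y \<in> Z \<Longrightarrow> y \<noteq> z \<Longrightarrow> j y < k \<and> y (j y) \<noteq> z (j y)" using sep by metis
  have "(\<lambda>x. \<Prod>y\<in>Z - {z}. (1 / (z (j y) - y (j y))) * (x (j y) - y (j y))) \<in> polys K Z k (\<Sum>y\<in>Z - {z}. 1)"
    using assms j by (intro polys_prod polys_smult polys_diff polys_const polys_coord) (auto intro!: K_divide K_diff)
  then have "(\<lambda>x. \<Prod>y\<in>Z - {z}. (1 / (z (j y) - y (j y))) * (x (j y) - y (j y))) \<in> polys K Z k (card Z - 1)"
    using assms by simp
  then show ?thesis
  proof (rule polys_cong)
    fix x assume x: "x \<in> Z"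
    show "(if x = z then 1 else 0) = (\<Prod>y\<in>Z - {z}. (1 / (z (j y) - y (j y))) * (x (j y) - y (j y)))"
    proof (cases "x = z")
      case True
      have "(1 / (z (j y) - y (j y))) * (z (j y) - y (j y)) = 1" if "y \<in> Z - {z}" for y
        using j[of y] that by auto
      then show ?thesis using True by (simp only: prod.neutral) simp
    next
      case False
      then have "(\<Prod>y\<in>Z - {z}. (1 / (z (j y) - y (j y))) * (x (j y) - y (j y))) = 0"
        using x \<open>finite Z\<close> by (intro prod_zero) auto
      then show ?thesis using False by simp
    qed
  qed
qed

end

lemma sum_fun_apply: "(\<Sum>i\<in>A. F i) x = (\<Sum>i\<in>A. F i x)"
  by (induction A rule: infinite_finite_induct) auto

text \<open>Dimension count: the indicators of the points of \<open>Z\<close> are linearly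
  independent and lie in the span of the monomial functions. Monomials are cut off to 0 outside
  \<open>Z\<close>, since \<open>polys\<close> controls a function on \<open>Z\<close> only.\<close>

lemma card_le_of_polys:
  fixes Z :: "(nat \<Rightarrow> 'a::field) set"
  assumes "finite Z" and all: "\<And>z. z \<in> Z \<Longrightarrow> (\<lambda>x. if x = z then 1 else 0) \<in> polys UNIV Z k E"
  shows "card Z \<le> card (words k E)"
proof -
  define sc where "sc = (\<lambda>(a::'a) (f :: (nat \<Rightarrow> 'a) \<Rightarrow> 'a) x. a * f x)"
  define \<delta> where "\<delta> = (\<lambda>z x :: nat \<Rightarrow> 'a. if x = z then 1 else (0::'a))"
  define M where "M = (\<lambda>l (x :: nat \<Rightarrow> 'a). if x \<in> Z then wmon l x else 0)"
  have sc: "sc a f x = a * f x" for a f x by (simp add: sc_def)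
  interpret vs: vector_space sc
    by unfold_locales (auto simp: fun_eq_iff algebra_simps sc_def)
  have inj: "inj_on \<delta> Z"
  proof (rule inj_onI)
    fix y z assume "\<delta> y = \<delta> z"
    then have "\<delta> y y = \<delta> z y" by simp
    then show "y = z" by (simp add: \<delta>_def split: if_splits)
  qed
  have key: "g f = 0" if sum0: "(\<Sum>h\<in>\<delta> ` Z. sc (g h) h) = 0" and f: "f \<in> \<delta> ` Z"
    for g :: "((nat \<Rightarrow> 'a) \<Rightarrow> 'a) \<Rightarrow> 'a" and f
  proof -
    obtain z where z: "z \<in> Z" "f = \<delta> z" using f by blast
    have "(\<Sum>h\<in>\<delta> ` Z. sc (g h) h) = (\<Sum>y\<in>Z. sc (g (\<delta> y)) (\<delta> y))"
      by (simp only: sum.reindex[OF inj] o_def)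
    then have "0 = (\<Sum>y\<in>Z. sc (g (\<delta> y)) (\<delta> y)) z"
      by (simp only: sum0 zero_fun_apply)
    also have "\<dots> = (\<Sum>y\<in>Z. if z = y then g (\<delta> y) else 0)"
      unfolding sum_fun_apply sc by (intro sum.cong) (auto simp: \<delta>_def)
    also have "\<dots> = g (\<delta> z)" using z(1) assms(1) by (simp only: sum.delta' if_True)
    finally show "g f = 0" using z(2) by simp
  qed
  have indep: "vs.independent (\<delta> ` Z)"
    unfolding vs.dependent_finite[OF finite_imageI[OF assms(1)]] using key by (metis (no_types))
  have span: "\<delta> z \<in> vs.span (M ` words k E)" if z: "z \<in> Z" for z
  proof -
    obtain c where c: "\<forall>x\<in>Z. (if x = z then 1 else 0) = (\<Sum>l\<in>words k E. c l * wmon l x)"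
      using all[OF z] by (auto simp: polys_def)
    have "\<delta> z = (\<Sum>l\<in>words k E. sc (c l) (M l))"
    proof
      fix x show "\<delta> z x = (\<Sum>l\<in>words k E. sc (c l) (M l)) x"
        unfolding sum_fun_apply sc using c z by (cases "x \<in> Z") (auto simp: \<delta>_def M_def)
    qed
    also have "\<dots> \<in> vs.span (M ` words k E)"
      by (intro vs.span_sum vs.span_scale vs.span_base imageI)
    finally show ?thesis .
  qed
  have "card (\<delta> ` Z) \<le> card (M ` words k E)"
    using vs.independent_span_bound[OF _ indep, of "M ` words k E"] span by auto
  also have "\<dots> \<le> card (words k E)" by (rule card_image_le) simp
  finally show ?thesis using inj by (simp add: card_image)
qed

text \<open>Interpolation gives the indicator of a solution a degree that grows with
  \<open>card Z\<close>. The reduction of high powers brings it down to a degree that depends on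
  \<open>k\<close>, \<open>D\<close>, \<open>m\<close> and \<open>card I\<close> only, so the number
  of monomials up to that degree bounds \<open>card Z\<close>.\<close>

lemma norm_system_solutions:
  fixes c :: "'i \<Rightarrow> nat \<Rightarrow> nat \<Rightarrow> 'a::field" and H :: "'i \<Rightarrow> nat \<Rightarrow> (nat \<Rightarrow> 'a) \<Rightarrow> 'a"
  assumes "finite Z" "finite I" "m \<ge> 1" "D \<ge> 1"
    and sep: "\<And>y z. y \<in> Z \<Longrightarrow> z \<in> Z \<Longrightarrow> y \<noteq> z \<Longrightarrow> \<exists>j<k. y j \<noteq> z j"
    and low: "\<And>i \<sigma>. i \<in> I \<Longrightarrow> \<sigma> < m \<Longrightarrow>
           (\<lambda>x. (\<Sum>j'<k. c i \<sigma> j' * x j' ^ D) - H i \<sigma> x) \<in> polys UNIV Z k (D - 1)"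
    and eq: "\<And>i x. i \<in> I \<Longrightarrow> x \<in> Z \<Longrightarrow> (\<Prod>\<sigma><m. H i \<sigma> x) = b"
    and inv: "\<And>\<tau> j. \<tau> \<in> PiE I (\<lambda>_. {..<m}) \<Longrightarrow> j < k \<Longrightarrow>
           \<exists>\<alpha>. \<forall>j'<k. (\<Sum>i\<in>I. \<alpha> i * c i (\<tau> i) j') = (if j' = j then 1 else 0)"
  shows "card Z \<le> card (words k (k * (D * m ^ card I)))"
proof (rule card_le_of_polys[OF assms(1)])
  interpret coeff_field "UNIV :: 'a set" by (rule coeff_field_UNIV)
  fix z assume z: "z \<in> Z"
  show "(\<lambda>x. if x = z then 1 else 0) \<in> polys UNIV Z k (k * (D * m ^ card I))"
  proof (rule polys_reduce)
    show "(\<lambda>x. if x = z then 1 else 0) \<in> polys UNIV Z k (card Z - 1)"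
      using assms(1) z sep by (intro polys_indicator) auto
    show "(\<lambda>x. x j ^ (D * m ^ card I)) \<in> polys UNIV Z k (D * m ^ card I - 1)" if "j < k" for j
      by (rule high_power_reduces[where c = c and H = H and b = b, OF assms(2-4) that low eq inv[OF _ that]])
    show "1 \<le> D * m ^ card I" using assms by (simp add: Suc_leI)
  qed
qed

section \<open>Finite subfields of an algebraically closed field\<close>

text \<open>For a power \<open>q\<close> of the characteristic these are the elements of the
  subfield with \<open>q\<close> elements. As fixed points of a power map, all finite subfields live
  in one type and are nested without embeddings.\<close>

definition GF :: "nat \<Rightarrow> 'a::field set" where
  "GF q = {x. x ^ q = x}"

lemma GF_0 [simp]: "q > 0 \<Longrightarrow> 0 \<in> GF q" and GF_1 [simp]: "1 \<in> GF q"
  by (auto simp: GF_def)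

lemma GF_mult: "x \<in> GF q \<Longrightarrow> y \<in> GF q \<Longrightarrow> x * y \<in> GF q"
  by (auto simp: GF_def power_mult_distrib)

lemma GF_divide: "x \<in> GF q \<Longrightarrow> y \<in> GF q \<Longrightarrow> x / y \<in> GF q"
  by (auto simp: GF_def power_divide)

lemma GF_prod: "(\<And>i. i \<in> I \<Longrightarrow> f i \<in> GF q) \<Longrightarrow> (\<Prod>i\<in>I. f i) \<in> GF q"
  by (induction I rule: infinite_finite_induct) (auto intro: GF_mult)

lemma GF_power: "x \<in> GF q \<Longrightarrow> x ^ n \<in> GF q"
  by (induction n) (auto intro: GF_mult)

lemma GF_power_q: "x \<in> GF q \<Longrightarrow> x ^ (q ^ n) = x"
  by (induction n) (auto simp: GF_def power_mult)

lemma GF_subset: "GF q \<subseteq> GF (q ^ n)"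
  using GF_power_q by (auto simp: GF_def)

context
  fixes q e :: nat
  assumes prime: "prime CHAR('a::alg_closed_field)" and q: "q = CHAR('a) ^ e" and e: "e > 0"
begin

lemma q_gt_1: "q > 1"
  unfolding q by (rule one_less_power[OF prime_gt_1_nat[OF prime] e])

lemma GF_add: "x \<in> GF q \<Longrightarrow> y \<in> GF q \<Longrightarrow> x + y \<in> (GF q :: 'a set)"
  using freshmans_dream'[OF prime q] by (simp add: GF_def)

lemma GF_uminus: "x \<in> GF q \<Longrightarrow> - x \<in> (GF q :: 'a set)"
proof -
  assume x: "x \<in> GF q"
  have "(-x + x) ^ q = (-x) ^ q + x ^ q" by (rule freshmans_dream'[OF prime q])
  then have "(-x) ^ q + x = 0" using x q_gt_1 by (simp add: GF_def power_0_left)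
  then show ?thesis by (simp add: GF_def eq_neg_iff_add_eq_0)
qed

lemma finite_GF: "finite (GF q :: 'a set)" and card_GF: "card (GF q :: 'a set) = q"
proof -
  define P where "P = monom (1::'a) q + [:0, -1:]"
  have deg: "degree P = q" unfolding P_def
    using q_gt_1 by (subst degree_add_eq_left) (auto simp: degree_monom_eq)
  then have P0: "P \<noteq> 0" using q_gt_1 by auto
  have eq: "GF q = {x. poly P x = 0}" by (auto simp: P_def GF_def poly_monom)
  have "of_nat q = (0::'a)" using e by (simp add: q)
  then have der: "pderiv P = [:-1:]"
    using q_gt_1 by (simp add: P_def pderiv_add pderiv_monom pderiv_pCons)
  obtain A where A: "size A = degree P" "P = smult (lead_coeff P) (\<Prod>x\<in>#A. [:-x, 1:])"
    using alg_closed_imp_factorization[OF P0] by blast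
  \<comment> \<open>\<open>X ^ q - X\<close> has derivative \<open>-1\<close>, hence only simple roots.\<close>
  have simple: "count A x \<le> 1" for x
  proof (rule ccontr)
    assume "\<not> count A x \<le> 1"
    then have "x \<in># A" "x \<in># A - {#x#}" by (auto simp: in_diff_count simp flip: count_greater_zero_iff)
    then obtain B where B: "A = add_mset x (add_mset x B)" by (metis insert_DiffM)
    define Q where "Q = smult (lead_coeff P) (\<Prod>x\<in>#B. [:-x, 1:])"
    have "P = [:-x, 1:] * ([:-x, 1:] * Q)"
      by (subst A(2)) (simp add: B Q_def)
    then have "poly (pderiv P) x = 0" by (simp only: pderiv_mult) simp
    then show False by (simp add: der)
  qed
  have "set_mset A = GF q"
  proof -
    have "poly P x = 0 \<longleftrightarrow> x \<in># A" for x
      using P0 by (subst A(2)) (auto simp: poly_prod_mset prod_mset_zero_iff)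
    then show ?thesis by (auto simp: eq)
  qed
  moreover have "size A = card (set_mset A)"
  proof -
    have "size A = (\<Sum>x\<in>set_mset A. count A x)" by (simp add: size_multiset_overloaded_eq)
    also have "\<dots> = (\<Sum>x\<in>set_mset A. 1)"
    proof (rule sum.cong)
      fix x assume "x \<in># A"
      then show "count A x = 1" using simple[of x] by (simp add: le_Suc_eq flip: count_greater_zero_iff)
    qed simp
    finally show ?thesis by simp
  qed
  ultimately show "finite (GF q :: 'a set)" "card (GF q :: 'a set) = q"
    using A(1) deg by (metis finite_set_mset, metis)
qed

text \<open>Raising to the power \<open>q\<close> shifts the conjugates by one, and y^(q^m) = y
  closes the cycle. Multiplying by \<open>y\<close> and cancelling it turns this cyclic shift into
  two ways of splitting a product of \<open>m + 1\<close> conjugates.\<close>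

lemma norm_in_GF:
  fixes y :: 'a
  assumes "y \<in> GF (q ^ m)"
  shows "(\<Prod>\<sigma><m. y ^ (q ^ \<sigma>)) \<in> GF q"
proof (cases "y = 0")
  case True
  then show ?thesis using q_gt_1 by (intro GF_prod GF_power) auto
next
  case False
  have "(\<Prod>\<sigma><m. y ^ (q ^ \<sigma>)) ^ q = (\<Prod>\<sigma><m. y ^ (q ^ Suc \<sigma>))"
    by (simp add: prod_power_distrib power_mult[symmetric] mult.commute)
  moreover have "y * (\<Prod>\<sigma><m. y ^ (q ^ Suc \<sigma>)) = (\<Prod>\<sigma><Suc m. y ^ (q ^ \<sigma>))"
    by (subst prod.lessThan_Suc_shift) simp
  moreover have "(\<Prod>\<sigma><Suc m. y ^ (q ^ \<sigma>)) = y * (\<Prod>\<sigma><m. y ^ (q ^ \<sigma>))"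
    using assms by (simp add: GF_def mult.commute)
  ultimately show ?thesis using False by (simp add: GF_def)
qed

end

lemma CHAR_bit_closure: "CHAR(bit alg_closure) = 2"
proof -
  have "CHAR(bit) = 2"
    by (rule CHAR_eqI) (auto, metis even_of_nat even_zero)
  then show ?thesis by simp
qed

text \<open>Pigeonhole: the norm maps \<open>q ^ m\<close> elements into \<open>q\<close> values.
  The popular value \<open>b\<close> becomes the one that defines edges, which makes the edge
  probability at least 1 / q for every \<open>m\<close>.\<close>

lemma norm_fibre:
  fixes q e m :: nat
  assumes prime: "prime CHAR('a::alg_closed_field)" and q: "q = CHAR('a) ^ e" and e: "e > 0" and m: "m > 0"
  shows "\<exists>b::'a. q ^ m \<le> q * card {y \<in> GF (q ^ m). (\<Prod>\<sigma><m. y ^ (q ^ \<sigma>)) = b}"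
proof -
  have qm: "q ^ m = CHAR('a) ^ (e * m)" "e * m > 0" using q e m by (auto simp: power_mult)
  let ?N = "\<lambda>y::'a. \<Prod>\<sigma><m. y ^ (q ^ \<sigma>)"
  have "0 \<in> (GF q :: 'a set)" using q_gt_1[OF prime q e] by simp
  then obtain b where "card (GF (q ^ m) :: 'a set) \<le> card (?N -` {b} \<inter> GF (q ^ m)) * card (GF q :: 'a set)"
    using pigeonhole_card[of ?N "GF (q ^ m)" "GF q"] norm_in_GF[OF prime q e]
      finite_GF[OF prime q e] finite_GF[OF prime qm] by blast
  moreover have "?N -` {b} \<inter> GF (q ^ m) = {y \<in> GF (q ^ m). ?N y = b}" by auto
  ultimately show ?thesis
    by (auto simp: card_GF[OF prime q e] card_GF[OF prime qm] mult.commute intro!: exI[of _ b])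
qed

section \<open>Tensors with random coefficients\<close>

text \<open>The injections embed each fibre of \<open>ev\<close> into every other one, so all fibres
  have the same size.\<close>

lemma card_preimage_equidistributed:
  assumes "finite H" "finite Y" and ev: "\<And>h. h \<in> H \<Longrightarrow> ev h \<in> Y"
    and trans: "\<And>y y'. y \<in> Y \<Longrightarrow> y' \<in> Y \<Longrightarrow>
      \<exists>\<phi>. inj_on \<phi> H \<and> \<phi> ` H \<subseteq> H \<and> (\<forall>h\<in>H. ev h = y \<longrightarrow> ev (\<phi> h) = y')"
    and S: "S \<subseteq> Y"
  shows "card {h \<in> H. ev h \<in> S} * card Y = card H * card S"
proof -
  let ?F = "\<lambda>y. {h \<in> H. ev h = y}"
  have le: "card (?F y) \<le> card (?F y')" if yY: "y \<in> Y" "y' \<in> Y" for y y'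
  proof -
    from trans[OF yY] obtain \<phi> where "inj_on \<phi> H \<and> \<phi> ` H \<subseteq> H \<and> (\<forall>h\<in>H. ev h = y \<longrightarrow> ev (\<phi> h) = y')"
      by (rule exE)
    then have \<phi>: "inj_on \<phi> H" "\<phi> ` H \<subseteq> H" "\<forall>h\<in>H. ev h = y \<longrightarrow> ev (\<phi> h) = y'" by simp_all
    have "inj_on \<phi> (?F y)" using \<phi>(1) by (rule inj_on_subset) auto
    moreover have "\<phi> ` ?F y \<subseteq> ?F y'" using \<phi> by auto
    ultimately show ?thesis using assms(1) by (intro card_inj_on_le) auto
  qed
  have sum: "card {h \<in> H. ev h \<in> T} = (\<Sum>y\<in>T. card (?F y))" if "T \<subseteq> Y" for T
  proof -
    have "finite T" using that assms(2) by (rule finite_subset)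
    moreover have "{h \<in> H. ev h \<in> T} = (\<Union>y\<in>T. ?F y)" by auto
    ultimately show ?thesis using assms(1) by (simp only:) (rule card_UN_disjoint, auto)
  qed
  show ?thesis
  proof (cases "S = {}")
    case False
    then obtain y0 where y0: "y0 \<in> Y" using S by blast
    have const: "card (?F y) = card (?F y0)" if "y \<in> Y" for y
      using le[OF that y0] le[OF y0 that] by simp
    have "{h \<in> H. ev h \<in> Y} = H" using ev by auto
    then have "card H = card Y * card (?F y0)" using sum[of Y] const by simp
    moreover have "card {h \<in> H. ev h \<in> S} = card S * card (?F y0)"
      using sum[OF S] const S by (simp add: subset_iff)
    ultimately show ?thesis by simp
  qed simp
qed

text \<open>Linear independence of the vectors in \<open>T\<close>, with coordinates in
  \<open>E\<close>, expressed by a dual system of functionals whose coefficients lie in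
  \<open>K\<close>.\<close>

definition dualizable :: "'a::comm_ring_1 set \<Rightarrow> 'l set \<Rightarrow> ('l \<Rightarrow> 'a) set \<Rightarrow> bool" where
  "dualizable K E T \<longleftrightarrow> finite T \<and> (\<forall>u\<in>T. \<forall>l\<in>E. u l \<in> K) \<and>
     (\<forall>u\<in>T. \<exists>c. (\<forall>l\<in>E. c l \<in> K) \<and> (\<forall>v\<in>T. (\<Sum>l\<in>E. c l * v l) = (if v = u then 1 else 0)))"

text \<open>The \<open>r\<close>-linear form with coefficient array \<open>h\<close>. At vectors of
  monomials it is the value of the random polynomial, at unit vectors it reads off coefficients, so
  both kinds of quantity are handled by one independence lemma.\<close>

definition tensor_eval :: "nat \<Rightarrow> 'l set \<Rightarrow> ((nat \<Rightarrow> 'l) \<Rightarrow> 'a::comm_ring_1) \<Rightarrow> (nat \<Rightarrow> 'l \<Rightarrow> 'a) \<Rightarrow> 'a" where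
  "tensor_eval r E h \<theta> = (\<Sum>e\<in>PiE {1..r} (\<lambda>_. E). h e * (\<Prod>i=1..r. \<theta> i (e i)))"

abbreviation tensors :: "nat \<Rightarrow> 'l set \<Rightarrow> 'a set \<Rightarrow> ((nat \<Rightarrow> 'l) \<Rightarrow> 'a) set" where
  "tensors r E K \<equiv> PiE (PiE {1..r} (\<lambda>_. E)) (\<lambda>_. K)"

lemma tensor_eval_cong: "(\<And>i. i \<in> {1..r} \<Longrightarrow> \<theta> i = \<theta>' i) \<Longrightarrow> tensor_eval r E h \<theta> = tensor_eval r E h \<theta>'"
  unfolding tensor_eval_def by (intro sum.cong refl arg_cong2[where f = "(*)"] prod.cong) auto

lemma tensor_eval_linear:
  assumes "finite E" and i0: "i0 \<in> {1..r}"
  shows "tensor_eval r E h (\<theta>(i0 := u))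
    = (\<Sum>l\<in>E. u l * tensor_eval r E h (\<theta>(i0 := (\<lambda>l'. if l' = l then 1 else 0))))"
proof -
  let ?P = "\<lambda>e. \<Prod>i\<in>{1..r} - {i0}. \<theta> i (e i)"
  have split: "(\<Prod>i=1..r. (\<theta>(i0 := w)) i (e i)) = w (e i0) * ?P e" for w e
    using i0 by (subst prod.remove[OF _ i0]) (auto intro!: prod.cong)
  have "(\<Sum>l\<in>E. u l * tensor_eval r E h (\<theta>(i0 := (\<lambda>l'. if l' = l then 1 else 0))))
     = (\<Sum>e\<in>PiE {1..r} (\<lambda>_. E). \<Sum>l\<in>E. if e i0 = l then u l * (h e * ?P e) else 0)"
    unfolding tensor_eval_def split sum_distrib_left
    by (subst sum.swap) (auto intro!: sum.cong)
  also have "\<dots> = (\<Sum>e\<in>PiE {1..r} (\<lambda>_. E). u (e i0) * (h e * ?P e))"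
    using assms(1) i0 by (intro sum.cong refl) (auto simp: PiE_iff)
  finally show ?thesis unfolding tensor_eval_def split by (simp add: mult.left_commute)
qed

context coeff_ring
begin

text \<open>The products of dual functionals, one per slot, are 1 at a single grid point and 0 at
  the others; combining them realises any table of values.\<close>

lemma tensor_interpolation:
  assumes "finite E" and dual: "\<And>i. i \<in> {1..r} \<Longrightarrow> dualizable K E (\<Theta> i)"
    and t: "\<And>\<theta>. \<theta> \<in> PiE {1..r} \<Theta> \<Longrightarrow> t \<theta> \<in> K"
  shows "\<exists>g. (\<forall>e. g e \<in> K) \<and> (\<forall>\<theta>\<in>PiE {1..r} \<Theta>. tensor_eval r E g \<theta> = t \<theta>)"
proof -
  let ?I = "{1..r}"
  have "\<forall>i\<in>?I. \<forall>u\<in>\<Theta> i. \<exists>c. (\<forall>l\<in>E. c l \<in> K) \<and> (\<forall>v\<in>\<Theta> i. (\<Sum>l\<in>E. c l * v l) = (if v = u then 1 else 0))"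
    using dual by (simp add: dualizable_def)
  then obtain c where cK: "\<And>i u l. i \<in> ?I \<Longrightarrow> u \<in> \<Theta> i \<Longrightarrow> l \<in> E \<Longrightarrow> c i u l \<in> K"
    and c: "\<And>i u v. i \<in> ?I \<Longrightarrow> u \<in> \<Theta> i \<Longrightarrow> v \<in> \<Theta> i \<Longrightarrow> (\<Sum>l\<in>E. c i u l * v l) = (if v = u then 1 else 0)"
    by metis
  have fin: "finite (PiE ?I \<Theta>)" using dual by (intro finite_PiE) (auto simp: dualizable_def)
  define EE where "EE = PiE ?I (\<lambda>_. E)"
  define g where "g e = (if e \<in> EE then \<Sum>\<eta>\<in>PiE ?I \<Theta>. t \<eta> * (\<Prod>i\<in>?I. c i (\<eta> i) (e i)) else 0)" for e
  have "g e \<in> K" for e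
    using t by (auto simp: g_def EE_def intro!: K_sum K_mult K_prod cK)
  moreover have "tensor_eval r E g \<theta> = t \<theta>" if \<theta>: "\<theta> \<in> PiE ?I \<Theta>" for \<theta>
  proof -
    have "tensor_eval r E g \<theta> = (\<Sum>e\<in>EE. (\<Sum>\<eta>\<in>PiE ?I \<Theta>. t \<eta> * (\<Prod>i\<in>?I. c i (\<eta> i) (e i))) * (\<Prod>i\<in>?I. \<theta> i (e i)))"
      unfolding tensor_eval_def EE_def[symmetric] by (intro sum.cong) (auto simp: g_def)
    also have "\<dots> = (\<Sum>\<eta>\<in>PiE ?I \<Theta>. t \<eta> * (\<Sum>e\<in>EE. \<Prod>i\<in>?I. c i (\<eta> i) (e i) * \<theta> i (e i)))"
      unfolding sum_distrib_right sum_distrib_left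
      by (subst sum.swap) (simp add: prod.distrib mult.assoc)
    also have "\<dots> = (\<Sum>\<eta>\<in>PiE ?I \<Theta>. t \<eta> * (\<Prod>i\<in>?I. \<Sum>l\<in>E. c i (\<eta> i) l * \<theta> i l))"
      unfolding EE_def using assms(1) by (subst prod_sum_PiE) auto
    also have "\<dots> = (\<Sum>\<eta>\<in>PiE ?I \<Theta>. if \<eta> = \<theta> then t \<theta> else 0)"
    proof (intro sum.cong refl)
      fix \<eta> assume \<eta>: "\<eta> \<in> PiE ?I \<Theta>"
      have "(\<Prod>i\<in>?I. \<Sum>l\<in>E. c i (\<eta> i) l * \<theta> i l) = (\<Prod>i\<in>?I. if \<theta> i = \<eta> i then 1 else 0)"
        by (intro prod.cong refl c) (use \<eta> \<theta> in auto)
      also have "\<dots> = (if \<eta> = \<theta> then 1 else 0)"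
      proof (cases "\<eta> = \<theta>")
        case False
        then obtain i where "i \<in> ?I" "\<theta> i \<noteq> \<eta> i" using PiE_ext[OF \<eta> \<theta>] by metis
        then show ?thesis using False by (auto intro!: prod_zero bexI[of _ i])
      qed simp
      finally show "t \<eta> * (\<Prod>i\<in>?I. \<Sum>l\<in>E. c i (\<eta> i) l * \<theta> i l) = (if \<eta> = \<theta> then t \<theta> else 0)"
        by simp
    qed
    also have "\<dots> = t \<theta>" using fin \<theta> by simp
    finally show ?thesis .
  qed
  ultimately show ?thesis by (intro exI[of _ g] conjI ballI allI)
qed

lemma tensor_eval_in_K:
  assumes "h \<in> tensors r E K" "\<And>i l. i \<in> {1..r} \<Longrightarrow> l \<in> E \<Longrightarrow> \<theta> i l \<in> K"
  shows "tensor_eval r E h \<theta> \<in> K"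
  unfolding tensor_eval_def using assms
  by (intro K_sum K_mult K_prod) (auto simp: PiE_iff)

text \<open>Adding an interpolating tensor moves any table of values on \<open>J\<close> to any
  other and is injective on tensors. Hence for a uniformly random \<open>h\<close> the values at
  distinct grid points are independent and uniform in \<open>K\<close>.\<close>

lemma tensor_equidistributed:
  assumes "finite K" "finite E" "finite J" and dual: "\<And>i. i \<in> {1..r} \<Longrightarrow> dualizable K E (\<Theta> i)"
    and \<theta>: "\<And>x. x \<in> J \<Longrightarrow> \<theta> x \<in> PiE {1..r} \<Theta>" and inj: "inj_on \<theta> J"
    and S: "S \<subseteq> PiE J (\<lambda>_. K)"
  shows "card {h \<in> tensors r E K. (\<lambda>x\<in>J. tensor_eval r E h (\<theta> x)) \<in> S} * card K ^ card J
    = card (tensors r E K) * card S"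
proof -
  define EE where "EE = PiE {1..r} (\<lambda>_. E)"
  define H where "H = PiE EE (\<lambda>_. K)"
  define Y where "Y = PiE J (\<lambda>_. K)"
  define ev where "ev h = (\<lambda>x\<in>J. tensor_eval r E h (\<theta> x))" for h
  have finEE: "finite EE" unfolding EE_def using assms(2) by (intro finite_PiE) auto
  have finH: "finite H" unfolding H_def by (rule finite_PiE[OF finEE]) (rule assms(1))
  have finY: "finite Y" unfolding Y_def using assms(1,3) by (intro finite_PiE) auto
  have val: "ev h \<in> Y" if "h \<in> H" for h
    unfolding ev_def Y_def
  proof (intro restrict_PiE_iff[THEN iffD2] ballI)
    fix x assume "x \<in> J"
    then show "tensor_eval r E h (\<theta> x) \<in> K"
      using \<theta> dual that unfolding H_def EE_def
      by (intro tensor_eval_in_K) (auto simp: dualizable_def PiE_iff)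
  qed
  have trans: "\<exists>\<phi>. inj_on \<phi> H \<and> \<phi> ` H \<subseteq> H \<and> (\<forall>h\<in>H. ev h = y \<longrightarrow> ev (\<phi> h) = y')"
    if y: "y \<in> Y" "y' \<in> Y" for y y'
  proof -
    define t where "t \<eta> = (if \<eta> \<in> \<theta> ` J then y' (inv_into J \<theta> \<eta>) - y (inv_into J \<theta> \<eta>) else 0)" for \<eta>
    have tx: "t (\<theta> x) = y' x - y x" if "x \<in> J" for x
      using that inj by (simp add: t_def)
    have "t \<eta> \<in> K" for \<eta>
    proof (cases "\<eta> \<in> \<theta> ` J")
      case True
      then obtain x where "x \<in> J" "\<eta> = \<theta> x" by blast
      then show ?thesis using tx y by (auto simp: Y_def intro!: K_diff)
    qed (simp add: t_def)
    then have "\<exists>g. (\<forall>e. g e \<in> K) \<and> (\<forall>\<eta>\<in>PiE {1..r} \<Theta>. tensor_eval r E g \<eta> = t \<eta>)"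
      by (intro tensor_interpolation[OF assms(2) dual])
    then obtain g where g0: "(\<forall>e. g e \<in> K) \<and> (\<forall>\<eta>\<in>PiE {1..r} \<Theta>. tensor_eval r E g \<eta> = t \<eta>)"
      by (rule exE)
    have g: "g e \<in> K" "\<eta> \<in> PiE {1..r} \<Theta> \<Longrightarrow> tensor_eval r E g \<eta> = t \<eta>" for e \<eta>
      using g0 by simp_all
    define \<phi> where "\<phi> h = (\<lambda>e\<in>EE. h e + g e)" for h
    have 1: "inj_on \<phi> H"
    proof (rule inj_onI)
      fix h h' assume h: "h \<in> H" "h' \<in> H" "\<phi> h = \<phi> h'"
      show "h = h'"
      proof (rule PiE_ext[OF h(1,2)[unfolded H_def]])
        fix e assume "e \<in> EE"
        then show "h e = h' e" using fun_cong[OF h(3), of e] by (simp add: \<phi>_def)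
      qed
    qed
    have 2: "\<phi> ` H \<subseteq> H"
    proof (rule image_subsetI)
      fix h assume h: "h \<in> H"
      have "h e + g e \<in> K" if "e \<in> EE" for e
        using PiE_mem[OF h[unfolded H_def] that] g(1) by (rule K_add)
      then show "\<phi> h \<in> H" unfolding \<phi>_def H_def by (intro restrict_PiE_iff[THEN iffD2] ballI)
    qed
    have 3: "ev (\<phi> h) = y'" if h: "h \<in> H" "ev h = y" for h
    proof (rule ext)
      fix x show "ev (\<phi> h) x = y' x"
      proof (cases "x \<in> J")
        case True
        have "tensor_eval r E (\<phi> h) (\<theta> x) = tensor_eval r E h (\<theta> x) + tensor_eval r E g (\<theta> x)"
          by (simp add: tensor_eval_def \<phi>_def EE_def algebra_simps sum.distrib)
        also have "\<dots> = y x + (y' x - y x)"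
          using fun_cong[OF h(2), of x] True \<theta>[OF True] g(2) tx by (simp add: ev_def)
        finally show ?thesis using True by (simp add: ev_def)
      next
        case False
        then show ?thesis using PiE_arb[OF y(2)[unfolded Y_def]] by (simp add: ev_def)
      qed
    qed
    from 1 2 3 show ?thesis by (intro exI[of _ \<phi>] conjI ballI impI)
  qed
  have "card {h \<in> H. ev h \<in> S} * card Y = card H * card S"
    by (rule card_preimage_equidistributed[OF finH finY val trans S[folded Y_def]])
  then show ?thesis using assms(3) unfolding Y_def H_def EE_def ev_def by (simp add: card_PiE)
qed

end

section \<open>Matrices whose conjugated rows are dependent\<close>

lemma coeff_field_GF:
  assumes "prime CHAR('a::alg_closed_field)" "q = CHAR('a) ^ e" "e > 0"
  shows "coeff_field (GF q :: 'a set)"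
  using q_gt_1[OF assms] GF_add[OF assms] GF_uminus[OF assms]
  by unfold_locales (auto intro: GF_mult GF_divide)

text \<open>The further power \<open>q ^ (m - \<sigma>)\<close> completes
  \<open>q ^ \<sigma>\<close> to \<open>q ^ m\<close>, which acts as the identity.\<close>

lemma frobenius_inj:
  assumes "x \<in> GF (q ^ m)" "y \<in> GF (q ^ m)" "\<sigma> \<le> m" "x ^ (q ^ \<sigma>) = y ^ (q ^ \<sigma>)"
  shows "x = y"
proof -
  have "(z ^ (q ^ \<sigma>)) ^ (q ^ (m - \<sigma>)) = z" if "z \<in> GF (q ^ m)" for z :: 'a
    using that assms(3) by (simp add: GF_def flip: power_mult power_add)
  then show ?thesis using assms by metis
qed

text \<open>
  The exponent \<open>q ^ \<tau> i\<close> conjugates row \<open>i\<close> of the matrix: \<open>\<tau>\<close> selects one conjugate linear factor of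
  every equation.
\<close>

definition frobenius_dependent :: "nat \<Rightarrow> nat \<Rightarrow> nat \<Rightarrow> 'i set \<Rightarrow> 'a::field set \<Rightarrow> ('i \<times> nat \<Rightarrow> 'a) \<Rightarrow> bool" where
  "frobenius_dependent q m k I K M \<longleftrightarrow> (\<exists>\<tau>\<in>PiE I (\<lambda>_. {..<m}). \<exists>\<alpha>\<in>PiE I (\<lambda>_. K).
     (\<exists>i\<in>I. \<alpha> i \<noteq> 0) \<and> (\<forall>j<k. (\<Sum>i\<in>I. \<alpha> i * M (i, j) ^ (q ^ \<tau> i)) = 0))"

text \<open>Union bound over the selection \<tau>, a row \<open>i\<close> whose coefficient is
  normalised to 1, and the remaining \<open>k - 1\<close> coefficients. With these fixed, row
  \<open>i\<close> is determined by the other rows, because its conjugation is injective. One power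
  of \<open>card K\<close> is thereby lost; it stands on the left so that the exponent involves no
  subtraction.\<close>

lemma card_frobenius_dependent:
  fixes K :: "'a::field set" and I :: "'i set"
  assumes K: "coeff_field K" "K = GF (q ^ m)" "finite K" and I: "finite I" "card I = k" and q: "q > 0"
  shows "card {M \<in> PiE (I \<times> {..<k}) (\<lambda>_. K). frobenius_dependent q m k I K M} * card K
    \<le> m ^ k * k * card K ^ (k * k)"
proof -
  interpret coeff_field K by (rule K(1))
  let ?P = "PiE (I \<times> {..<k}) (\<lambda>_. K)"
  let ?A = "\<lambda>i. PiE I (\<lambda>i'. if i' = i then {1} else K)"
  define B where "B \<tau> i \<alpha> = {M \<in> ?P. \<forall>j<k. (\<Sum>i'\<in>I. \<alpha> i' * M (i', j) ^ (q ^ \<tau> i')) = 0}"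
    for \<tau> :: "'i \<Rightarrow> nat" and i :: 'i and \<alpha>
  have finP: "finite ?P" using I K by (intro finite_PiE) auto
  have finA: "finite (?A i)" for i using I K by (intro finite_PiE) auto
  have finT: "finite (PiE I (\<lambda>_. {..<m}))" using I by (intro finite_PiE) auto
  have sub: "{M \<in> ?P. frobenius_dependent q m k I K M}
     \<subseteq> (\<Union>\<tau>\<in>PiE I (\<lambda>_. {..<m}). \<Union>i\<in>I. \<Union>\<alpha>\<in>?A i. B \<tau> i \<alpha>)"
  proof
    fix M assume "M \<in> {M \<in> ?P. frobenius_dependent q m k I K M}"
    then have M: "M \<in> ?P" and "frobenius_dependent q m k I K M" by auto
    then obtain \<tau> \<alpha> i where \<tau>: "\<tau> \<in> PiE I (\<lambda>_. {..<m})" and \<alpha>: "\<alpha> \<in> PiE I (\<lambda>_. K)"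
      and i: "i \<in> I" "\<alpha> i \<noteq> 0"
      and z: "\<And>j. j < k \<Longrightarrow> (\<Sum>i\<in>I. \<alpha> i * M (i, j) ^ (q ^ \<tau> i)) = 0"
      unfolding frobenius_dependent_def by blast
    let ?\<beta> = "\<lambda>i'\<in>I. \<alpha> i' / \<alpha> i"
    have "?\<beta> \<in> ?A i" using \<alpha> i by (auto intro!: K_divide)
    moreover have "M \<in> B \<tau> i ?\<beta>"
      unfolding B_def mem_Collect_eq
    proof (intro conjI M allI impI)
      fix j assume "j < k"
      have "(\<Sum>i'\<in>I. ?\<beta> i' * M (i', j) ^ (q ^ \<tau> i')) = (\<Sum>i'\<in>I. \<alpha> i' * M (i', j) ^ (q ^ \<tau> i')) / \<alpha> i"
        by (simp add: sum_divide_distrib)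
      then show "(\<Sum>i'\<in>I. ?\<beta> i' * M (i', j) ^ (q ^ \<tau> i')) = 0" using z[OF \<open>j < k\<close>] by simp
    qed
    ultimately show "M \<in> (\<Union>\<tau>\<in>PiE I (\<lambda>_. {..<m}). \<Union>i\<in>I. \<Union>\<alpha>\<in>?A i. B \<tau> i \<alpha>)"
      using \<tau> i by blast
  qed
  have cB: "card (B \<tau> i \<alpha>) \<le> card K ^ ((k - 1) * k)"
    if \<tau>: "\<tau> \<in> PiE I (\<lambda>_. {..<m})" and i: "i \<in> I" and \<alpha>: "\<alpha> \<in> ?A i" for \<tau> i \<alpha>
  proof -
    let ?R = "(I - {i}) \<times> {..<k}"
    have "inj_on (\<lambda>M. restrict M ?R) (B \<tau> i \<alpha>)"
    proof (rule inj_onI)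
      fix M N assume M: "M \<in> B \<tau> i \<alpha>" and N: "N \<in> B \<tau> i \<alpha>" and eq: "restrict M ?R = restrict N ?R"
      have MP: "M \<in> ?P" and NP: "N \<in> ?P" using M N by (auto simp: B_def)
      have off: "M (i', j) = N (i', j)" if "i' \<in> I" "i' \<noteq> i" "j < k" for i' j
        using fun_cong[OF eq, of "(i', j)"] that by simp
      have on: "M (i, j) = N (i, j)" if j: "j < k" for j
      proof (rule frobenius_inj)
        show "M (i, j) \<in> GF (q ^ m)" "N (i, j) \<in> GF (q ^ m)"
          using PiE_mem[OF MP, of "(i, j)"] PiE_mem[OF NP, of "(i, j)"] i j K(2) by auto
        show "\<tau> i \<le> m" using \<tau> i by (auto simp: PiE_iff less_imp_le)
        have s: "(\<Sum>i'\<in>I. \<alpha> i' * L (i', j) ^ (q ^ \<tau> i'))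
            = L (i, j) ^ (q ^ \<tau> i) + (\<Sum>i'\<in>I - {i}. \<alpha> i' * L (i', j) ^ (q ^ \<tau> i'))" for L :: "'i \<times> nat \<Rightarrow> 'a"
          using PiE_mem[OF \<alpha> i] by (subst sum.remove[OF I(1) i]) simp
        have r: "(\<Sum>i'\<in>I - {i}. \<alpha> i' * M (i', j) ^ (q ^ \<tau> i')) = (\<Sum>i'\<in>I - {i}. \<alpha> i' * N (i', j) ^ (q ^ \<tau> i'))"
          using off j by (intro sum.cong) auto
        have "(\<Sum>i'\<in>I. \<alpha> i' * M (i', j) ^ (q ^ \<tau> i')) = 0" "(\<Sum>i'\<in>I. \<alpha> i' * N (i', j) ^ (q ^ \<tau> i')) = 0"
          using M N j by (auto simp: B_def)
        then show "M (i, j) ^ (q ^ \<tau> i) = N (i, j) ^ (q ^ \<tau> i)"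
          unfolding s r by (metis add_right_cancel)
      qed
      show "M = N"
      proof (rule PiE_ext[OF MP NP])
        fix x assume x: "x \<in> I \<times> {..<k}"
        then obtain i' j where "x = (i', j)" "i' \<in> I" "j < k" by auto
        then show "M x = N x" using on off by (cases "i' = i") auto
      qed
    qed
    moreover have "(\<lambda>M. restrict M ?R) ` B \<tau> i \<alpha> \<subseteq> PiE ?R (\<lambda>_. K)"
    proof (rule image_subsetI)
      fix M assume "M \<in> B \<tau> i \<alpha>"
      then have "M \<in> ?P" by (simp add: B_def)
      then have "M x \<in> K" if "x \<in> ?R" for x using that by (intro PiE_mem[of M "I \<times> {..<k}"]) auto
      then show "restrict M ?R \<in> PiE ?R (\<lambda>_. K)" by (intro restrict_PiE_iff[THEN iffD2] ballI)
    qed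
    moreover have "finite (PiE ?R (\<lambda>_. K))" using I K by (intro finite_PiE) auto
    ultimately have "card (B \<tau> i \<alpha>) \<le> card (PiE ?R (\<lambda>_. K))" by (rule card_inj_on_le)
    also have "\<dots> = card K ^ ((k - 1) * k)"
      using I i by (simp add: card_PiE card_cartesian_product)
    finally show ?thesis .
  qed
  have cA: "card (?A i) = card K ^ (k - 1)" if "i \<in> I" for i
  proof -
    have "card (?A i) = (\<Prod>i'\<in>I. card (if i' = i then {1} else K))" using I by (simp add: card_PiE)
    also have "\<dots> = (\<Prod>i'\<in>I - {i}. card K)"
      by (subst prod.remove[OF I(1) that]) (auto intro!: prod.cong)
    finally show ?thesis using I that by simp
  qed
  have "card {M \<in> ?P. frobenius_dependent q m k I K M}
     \<le> card (\<Union>\<tau>\<in>PiE I (\<lambda>_. {..<m}). \<Union>i\<in>I. \<Union>\<alpha>\<in>?A i. B \<tau> i \<alpha>)"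
    using finT I(1) finA finP by (intro card_mono sub finite_UN_I) (auto simp: B_def)
  also have "\<dots> \<le> (\<Sum>\<tau>\<in>PiE I (\<lambda>_. {..<m}). \<Sum>i\<in>I. \<Sum>\<alpha>\<in>?A i. card (B \<tau> i \<alpha>))"
    by (intro card_UN_le[THEN order_trans] sum_mono finT I(1) finA order_refl)
  also have "\<dots> \<le> (\<Sum>\<tau>\<in>PiE I (\<lambda>_. {..<m}). \<Sum>i\<in>I. \<Sum>\<alpha>\<in>?A i. card K ^ ((k - 1) * k))"
    by (intro sum_mono cB)
  also have "\<dots> = (\<Sum>\<tau>\<in>PiE I (\<lambda>_. {..<m}). \<Sum>i\<in>I. card K ^ (k - 1) * card K ^ ((k - 1) * k))"
    by (intro sum.cong refl) (simp add: cA)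
  also have "\<dots> = m ^ k * k * (card K ^ (k - 1) * card K ^ ((k - 1) * k))"
    using I by (simp add: card_PiE)
  finally have "card {M \<in> ?P. frobenius_dependent q m k I K M} * card K
     \<le> m ^ k * k * (card K ^ (k - 1) * card K ^ ((k - 1) * k)) * card K"
    by (rule mult_right_mono) simp
  also have "\<dots> \<le> m ^ k * k * card K ^ (k * k)"
  proof (cases k)
    case (Suc k')
    have "card K ^ (k - 1) * card K ^ ((k - 1) * k) * card K = card K ^ (k * k)"
      unfolding Suc by (simp add: power_add[symmetric] flip: power_Suc2)
    then show ?thesis by (simp add: mult.assoc)
  qed simp
  finally show ?thesis .
qed

text \<open>Independence says that the linear map \<open>L\<close> is injective. Its domain and
  codomain are finite of the same size, so it is onto and reaches the unit vector at
  \<open>j\<close>.\<close>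

lemma frobenius_independent_dual:
  fixes K :: "'a::field set"
  assumes K: "coeff_field K" "finite K" and I: "finite I" "card I = k"
    and M: "M \<in> PiE (I \<times> {..<k}) (\<lambda>_. K)" "\<not> frobenius_dependent q m k I K M"
    and \<tau>: "\<tau> \<in> PiE I (\<lambda>_. {..<m})" and j: "j < k" and pow: "\<And>x n. x \<in> K \<Longrightarrow> x ^ n \<in> K"
  shows "\<exists>\<alpha>. \<forall>j'<k. (\<Sum>i\<in>I. \<alpha> i * M (i, j') ^ (q ^ \<tau> i)) = (if j' = j then 1 else 0)"
proof -
  interpret coeff_field K by (rule K(1))
  define L where "L \<alpha> = (\<lambda>j'\<in>{..<k}. \<Sum>i\<in>I. \<alpha> i * M (i, j') ^ (q ^ \<tau> i))" for \<alpha>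
  let ?A = "PiE I (\<lambda>_. K)" and ?Y = "PiE {..<k} (\<lambda>_. K)"
  have img: "L ` ?A \<subseteq> ?Y"
  proof (rule image_subsetI)
    fix \<alpha> assume \<alpha>: "\<alpha> \<in> ?A"
    show "L \<alpha> \<in> ?Y" unfolding L_def
      by (intro restrict_PiE_iff[THEN iffD2] ballI K_sum K_mult pow)
         (use \<alpha> PiE_mem[OF M(1)] in auto)
  qed
  have inj: "inj_on L ?A"
  proof (rule inj_onI)
    fix \<alpha> \<beta> assume ab: "\<alpha> \<in> ?A" "\<beta> \<in> ?A" "L \<alpha> = L \<beta>"
    let ?\<gamma> = "\<lambda>i\<in>I. \<alpha> i - \<beta> i"
    have "?\<gamma> \<in> ?A" using ab by (auto intro!: K_diff)
    moreover have "(\<Sum>i\<in>I. ?\<gamma> i * M (i, j') ^ (q ^ \<tau> i)) = 0" if "j' < k" for j'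
    proof -
      have "(\<Sum>i\<in>I. ?\<gamma> i * M (i, j') ^ (q ^ \<tau> i)) = (\<Sum>i\<in>I. \<alpha> i * M (i, j') ^ (q ^ \<tau> i)) - (\<Sum>i\<in>I. \<beta> i * M (i, j') ^ (q ^ \<tau> i))"
        by (simp add: algebra_simps sum_subtractf)
      also have "\<dots> = 0" using fun_cong[OF ab(3), of j'] that by (simp add: L_def)
      finally show ?thesis .
    qed
    ultimately have "\<forall>i\<in>I. ?\<gamma> i = 0" using M(2) \<tau> unfolding frobenius_dependent_def by blast
    then show "\<alpha> = \<beta>" by (intro PiE_ext[OF ab(1,2)]) auto
  qed
  have "card (L ` ?A) = card ?Y" using inj I by (simp add: card_image card_PiE)
  moreover have "finite ?Y" using K by (intro finite_PiE) auto
  ultimately have surj: "L ` ?A = ?Y" using img by (intro card_subset_eq) auto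
  let ?d = "\<lambda>j'\<in>{..<k}. if j' = j then 1 else 0"
  have "?d \<in> ?Y" by auto
  then obtain \<alpha> where \<alpha>: "L \<alpha> = ?d" using surj by (metis imageE)
  have "(\<Sum>i\<in>I. \<alpha> i * M (i, j') ^ (q ^ \<tau> i)) = (if j' = j then 1 else 0)" if "j' < k" for j'
  proof -
    have "L \<alpha> j' = ?d j'" by (simp only: \<alpha>)
    then show ?thesis using that by (simp add: L_def)
  qed
  then show ?thesis by blast
qed

text \<open>The two kinds of words have different tasks. Those shorter than \<open>D\<close>
  separate points; the pure powers alone make up the top degree, so that leading forms are linear in
  the x_j^D and their dependence is a matter of linear algebra.\<close>

definition basis_words :: "nat \<Rightarrow> nat \<Rightarrow> nat list set" where
  "basis_words k D = words k (D - 1) \<union> (\<lambda>j. replicate D j) ` {..<k}"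

text \<open>The Veronese vector of the point \<open>x\<close>. It is indexed by all words, so the
  word \<open>[j]\<close> recovers \<open>x j\<close> whatever \<open>D\<close> is.\<close>

definition mvec :: "(nat \<Rightarrow> 'a::comm_ring_1) \<Rightarrow> nat list \<Rightarrow> 'a" where
  "mvec x = (\<lambda>l. wmon l x)"

text \<open>Put into one slot of \<open>tensor_eval\<close>, it extracts the coefficient of the
  monomial \<open>l\<close> of that block.\<close>

definition unit_vec :: "nat list \<Rightarrow> nat list \<Rightarrow> 'a::comm_ring_1" where
  "unit_vec l = (\<lambda>l'. if l' = l then 1 else 0)"

lemma finite_basis_words [simp]: "finite (basis_words k D)"
  by (simp add: basis_words_def)

lemma set_basis_words: "l \<in> basis_words k D \<Longrightarrow> set l \<subseteq> {..<k}"
  by (auto simp: basis_words_def words_def)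

lemma mvec_inj:
  assumes "x \<in> PiE {..<k} B" "y \<in> PiE {..<k} B" "mvec x = mvec y"
  shows "x = y"
proof (rule PiE_ext[OF assms(1,2)])
  fix j show "x j = y j" using fun_cong[OF assms(3), of "[j]"] by (simp add: mvec_def wmon_def)
qed

lemma unit_vec_inj: "unit_vec l = (unit_vec l' :: nat list \<Rightarrow> 'a::comm_ring_1) \<Longrightarrow> l = l'"
  by (drule fun_cong[of _ _ l]) (simp add: unit_vec_def split: if_splits)

lemma (in coeff_ring) wmon_in_K: "(\<And>j. j < k \<Longrightarrow> x j \<in> K) \<Longrightarrow> set l \<subseteq> {..<k} \<Longrightarrow> wmon l x \<in> K"
  by (induction l) (auto intro: K_mult)

text \<open>The coefficients of the polynomial indicator of \<open>z\<close> form the functional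
  dual to \<open>mvec z\<close>. Its degree is at most \<open>card A - 1\<close>, hence below
  \<open>D\<close> or zero, so only words of the first kind in \<open>basis_words\<close>
  occur.\<close>

lemma (in coeff_field) dualizable_points:
  assumes A: "finite A" "A \<subseteq> PiE {..<k} (\<lambda>_. B)" "B \<subseteq> K" and D: "card A \<le> D"
  shows "dualizable K (basis_words k D) (mvec ` A)"
  unfolding dualizable_def
proof (intro conjI ballI)
  show "finite (mvec ` A)" using A(1) by simp
next
  fix u l assume "u \<in> mvec ` A" and l: "l \<in> basis_words k D"
  then obtain x where x: "x \<in> A" "u = mvec x" by (auto elim: imageE)
  have "x j \<in> K" if "j < k" for j using PiE_mem[of x "{..<k}" "\<lambda>_. B" j] x A that by auto
  then show "u l \<in> K" unfolding x(2) mvec_def by (rule wmon_in_K[OF _ set_basis_words[OF l]])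
next
  fix u assume "u \<in> mvec ` A"
  then obtain z where z: "z \<in> A" "u = mvec z" by (auto elim: imageE)
  have AK: "y j \<in> K" if "y \<in> A" "j < k" for y j using PiE_mem[of y "{..<k}" "\<lambda>_. B" j] A that by auto
  have sep: "\<exists>j<k. y j \<noteq> z j" if "y \<in> A" "y \<noteq> z" for y
  proof (rule ccontr)
    assume "\<not> ?thesis"
    then have "y = z" using that z A(2) by (intro PiE_ext[of y "{..<k}" "\<lambda>_. B" z]) auto
    then show False using that by simp
  qed
  have "(\<lambda>x. if x = z then 1 else 0) \<in> polys K A k (card A - 1)"
    by (rule polys_indicator) (use AK A(1) z(1) sep in simp_all)
  then obtain c where c: "\<forall>l. c l \<in> K" "\<forall>x\<in>A. (if x = z then 1 else 0) = (\<Sum>l\<in>words k (card A - 1). c l * wmon l x)"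
    by (auto simp: polys_def)
  define c' where "c' l = (if l \<in> words k (card A - 1) then c l else 0)" for l
  have sub: "words k (card A - 1) \<subseteq> basis_words k D"
    using words_mono[OF diff_le_mono[OF D, of 1], of k] by (auto simp: basis_words_def)
  show "\<exists>c. (\<forall>l\<in>basis_words k D. c l \<in> K) \<and>
     (\<forall>v\<in>mvec ` A. (\<Sum>l\<in>basis_words k D. c l * v l) = (if v = u then 1 else 0))"
  proof (intro exI[of _ c'] conjI ballI)
    show "c' l \<in> K" for l using c(1) by (simp add: c'_def)
    fix v assume "v \<in> mvec ` A"
    then obtain x where x: "x \<in> A" "v = mvec x" by (auto elim: imageE)
    have "(\<Sum>l\<in>basis_words k D. c' l * v l) = (\<Sum>l\<in>words k (card A - 1). c l * wmon l x)"
      using sub by (intro sum.mono_neutral_cong_right) (auto simp: c'_def x mvec_def)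
    also have "\<dots> = (if x = z then 1 else 0)" using c(2) x(1) by simp
    also have "x = z \<longleftrightarrow> v = u" using mvec_inj[of x k "\<lambda>_. B" z] x z A(2) by auto
    finally show "(\<Sum>l\<in>basis_words k D. c' l * v l) = (if v = u then 1 else 0)" .
  qed
qed

lemma (in coeff_ring) dualizable_units:
  assumes "finite L" "L \<subseteq> E" "finite E"
  shows "dualizable K E ((unit_vec :: nat list \<Rightarrow> nat list \<Rightarrow> 'a) ` L)"
  unfolding dualizable_def
proof (intro conjI ballI)
  show "finite ((unit_vec :: nat list \<Rightarrow> nat list \<Rightarrow> 'a) ` L)" using assms(1) by simp
next
  fix u :: "nat list \<Rightarrow> 'a" and l assume "u \<in> unit_vec ` L"
  then show "u l \<in> K" by (auto simp: unit_vec_def)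
next
  fix u :: "nat list \<Rightarrow> 'a" assume "u \<in> unit_vec ` L"
  then obtain l where l: "l \<in> L" "u = unit_vec l" by (auto elim: imageE)
  show "\<exists>c. (\<forall>l\<in>E. c l \<in> K) \<and> (\<forall>v\<in>unit_vec ` L. (\<Sum>l\<in>E. c l * v l) = (if v = u then 1 else 0))"
  proof (intro exI[of _ u] conjI ballI)
    show "u l' \<in> K" for l' by (simp add: l unit_vec_def)
    fix v :: "nat list \<Rightarrow> 'a" assume "v \<in> unit_vec ` L"
    then obtain l' where l': "l' \<in> L" "v = unit_vec l'" by (auto elim: imageE)
    have "(\<Sum>l''\<in>E. u l'' * v l'') = (\<Sum>l''\<in>E. if l'' = l then v l'' else 0)"
      by (intro sum.cong) (auto simp: l unit_vec_def)
    also have "\<dots> = v l" using assms l by auto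
    also have "\<dots> = (if v = u then 1 else 0)"
      using unit_vec_inj[of l' l] by (auto simp: l l' unit_vec_def)
    finally show "(\<Sum>l''\<in>E. u l'' * v l'') = (if v = u then 1 else 0)" .
  qed
qed

section \<open>Counting grids and selecting an outcome\<close>

lemma card_small_subsets_le:
  assumes "finite V"
  shows "card {S. S \<subseteq> V \<and> S \<noteq> {} \<and> card S \<le> D} \<le> card V ^ D"
proof -
  have "{S. S \<subseteq> V \<and> S \<noteq> {} \<and> card S \<le> D} \<subseteq> (\<lambda>f. f ` {..<D}) ` PiE {..<D} (\<lambda>_. V)"
  proof
    fix S assume "S \<in> {S. S \<subseteq> V \<and> S \<noteq> {} \<and> card S \<le> D}"
    then have S: "S \<subseteq> V" "S \<noteq> {}" "card S \<le> D" by auto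
    then have fin: "finite S" using assms finite_subset by blast
    obtain g where g: "bij_betw g {..<card S} S"
      using finite_same_card_bij[of "{..<card S}" S] fin by auto
    have pos: "0 < card S" using S fin by (simp add: card_gt_0_iff)
    \<comment> \<open>Indices from \<open>card S\<close> on repeat \<open>g 0\<close>, an element of
      \<open>S\<close> because \<open>S\<close> is nonempty.\<close>
    define f where "f = (\<lambda>i\<in>{..<D}. if i < card S then g i else g 0)"
    have gS: "g i \<in> S" if "i < card S" for i using bij_betwE[OF g] that by simp
    have "f ` {..<D} = S"
    proof
      show "f ` {..<D} \<subseteq> S" using gS pos by (auto simp: f_def)
      show "S \<subseteq> f ` {..<D}"
      proof
        fix v assume "v \<in> S"
        then obtain i where "i < card S" "v = g i" using g by (auto simp: bij_betw_def)
        then show "v \<in> f ` {..<D}" using S(3) by (intro image_eqI[of _ _ i]) (auto simp: f_def)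
      qed
    qed
    moreover have "f \<in> PiE {..<D} (\<lambda>_. V)"
      unfolding f_def using gS pos S(1) by (intro restrict_PiE_iff[THEN iffD2]) auto
    ultimately show "S \<in> (\<lambda>f. f ` {..<D}) ` PiE {..<D} (\<lambda>_. V)"
      by (intro image_eqI[of _ _ f]) auto
  qed
  then have "card {S. S \<subseteq> V \<and> S \<noteq> {} \<and> card S \<le> D} \<le> card (PiE {..<D} (\<lambda>_. V))"
    using assms by (intro surj_card_le finite_PiE) auto
  then show ?thesis by (simp add: card_PiE)
qed

text \<open>Each \<open>A\<close> holds for at least a fraction 1 / P of all outcomes. The bad
  outcomes form at most a fraction 1 / (2 P), so even if every \<open>A\<close> held for all of them
  they would supply at most half of the incidences. Some outcome outside \<open>B\<close> therefore
  reaches half the average.\<close>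

lemma exists_good_outside_bad:
  fixes P :: nat
  assumes H: "finite H" "H \<noteq> {}" and bad: "B \<subseteq> H" "2 * P * card B \<le> card H" and "P > 0"
    and G: "finite G" "\<And>A. A \<in> G \<Longrightarrow> card H \<le> P * card {h \<in> H. R h A}"
  shows "\<exists>h\<in>H - B. card G \<le> 2 * P * card {A \<in> G. R h A}"
proof (rule ccontr)
  assume "\<not> ?thesis"
  then have small: "2 * P * card {A \<in> G. R h A} < card G" if "h \<in> H - B" for h using that by force
  have "card H > 0" using H by (simp add: card_gt_0_iff)
  moreover have "2 * card B \<le> 2 * P * card B" using \<open>P > 0\<close> by simp
  ultimately have "card B < card H" using bad(2) by linarith
  then have ne: "H - B \<noteq> {}" using bad(1) by auto
  have "card H * card G = (\<Sum>A\<in>G. card H)" by simp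
  also have "\<dots> \<le> (\<Sum>A\<in>G. P * card {h \<in> H. R h A})" by (rule sum_mono) (rule G(2))
  also have "\<dots> = P * (\<Sum>A\<in>G. \<Sum>h\<in>H. if R h A then 1 else 0)"
    using H(1) by (simp add: sum_distrib_left sum.If_cases Int_def)
  also have "\<dots> = P * (\<Sum>h\<in>H. card {A \<in> G. R h A})"
    using G(1) by (subst sum.swap) (simp add: sum.If_cases Int_def)
  finally have "2 * (card H * card G) \<le> 2 * (P * (\<Sum>h\<in>H. card {A \<in> G. R h A}))" by simp
  also have "\<dots> = (\<Sum>h\<in>H. 2 * P * card {A \<in> G. R h A})"
    by (simp only: sum_distrib_left mult.assoc)
  also have "\<dots> = (\<Sum>h\<in>H - B. 2 * P * card {A \<in> G. R h A}) + (\<Sum>h\<in>B. 2 * P * card {A \<in> G. R h A})"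
    using H(1) bad(1) by (rule sum.subset_diff[rotated])
  also have "\<dots> < (\<Sum>h\<in>H - B. card G) + (\<Sum>h\<in>B. 2 * P * card G)"
    using H(1) ne small by (intro add_less_le_mono sum_strict_mono sum_mono mult_left_mono card_mono G(1)) auto
  also have "\<dots> = card (H - B) * card G + 2 * P * card B * card G" by simp
  also have "\<dots> \<le> card H * card G + card H * card G"
    using bad H(1) by (intro add_mono mult_right_mono card_mono) auto
  finally show False by simp
qed

section \<open>Random norm hypergraphs\<close>

locale random_norm_hypergraph =
  fixes r k D m q e :: nat and b :: "'a::alg_closed_field"
  assumes prime: "prime CHAR('a)" and q: "q = CHAR('a) ^ e" and e: "e > 0" and m: "m > 0"
    and D: "D > 0" and k: "k > 0"
begin

abbreviation "K \<equiv> (GF (q ^ m) :: 'a set)"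
abbreviation "V \<equiv> PiE {..<k} (\<lambda>_. GF q :: 'a set)"
abbreviation "E \<equiv> basis_words k D"

text \<open>The product of the conjugates is the norm from \<open>K\<close> to \<open>GF q\<close>
  of the random polynomial at \<open>x\<close>. The value \<open>b\<close> is arbitrary in this
  locale; only the lemmas that count copies assume that many elements of \<open>K\<close> have norm
  \<open>b\<close>.\<close>

definition edge :: "((nat \<Rightarrow> nat list) \<Rightarrow> 'a) \<Rightarrow> (nat \<Rightarrow> nat \<Rightarrow> 'a) \<Rightarrow> bool" where
  "edge h x \<longleftrightarrow> (\<Prod>\<sigma><m. tensor_eval r E h (\<lambda>i. mvec (x i)) ^ (q ^ \<sigma>)) = b"

lemma qm: "q ^ m = CHAR('a) ^ (e * m)" "e * m > 0"
  using q e m by (auto simp: power_mult)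

sublocale coeff_field K
  by (rule coeff_field_GF[OF prime qm])

lemma finite_K: "finite K" and card_K: "card K = q ^ m"
  using finite_GF[OF prime qm] card_GF[OF prime qm] by auto

lemma finite_Fq: "finite (GF q :: 'a set)" and card_Fq: "card (GF q :: 'a set) = q"
  using finite_GF[OF prime q e] card_GF[OF prime q e] by auto

lemma finite_V: "finite V" and card_V: "card V = q ^ k"
  using finite_Fq card_Fq by (auto simp: card_PiE intro!: finite_PiE)

lemma Fq_K: "GF q \<subseteq> K" by (rule GF_subset)

lemma dualizable_grid: "S \<subseteq> V \<Longrightarrow> card S \<le> D \<Longrightarrow> dualizable K E (mvec ` S)"
  using finite_subset[OF _ finite_V] by (intro dualizable_points[OF _ _ Fq_K]) auto

definition top_vec :: "nat \<Rightarrow> nat list \<Rightarrow> 'a" where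
  "top_vec j = unit_vec (replicate D j)"

text \<open>Evaluated here, a tensor gives the coefficient of the pure power x_j^D in block
  \<open>i0\<close> after the other blocks have been fixed at \<open>w\<close>. With rows
  \<open>w\<close> and columns \<open>j\<close> these values form the matrix of leading
  forms.\<close>

definition node :: "nat \<Rightarrow> (nat \<Rightarrow> nat \<Rightarrow> 'a) \<times> nat \<Rightarrow> nat \<Rightarrow> nat list \<Rightarrow> 'a" where
  "node i0 = (\<lambda>(w, j). \<lambda>i\<in>{1..r}. if i = i0 then top_vec j else mvec (w i))"

text \<open>The set \<open>bad i0 S\<close> consists of the \<open>h\<close> for which the equations in block \<open>i0\<close> given by the grid \<open>S\<close> have
  dependent leading factors.\<close>

definition bad :: "nat \<Rightarrow> (nat \<Rightarrow> (nat \<Rightarrow> 'a) set) \<Rightarrow> ((nat \<Rightarrow> nat list) \<Rightarrow> 'a) set" where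
  "bad i0 S = {h \<in> tensors r E K. frobenius_dependent q m k (PiE ({1..r} - {i0}) S) K
     (\<lambda>p\<in>PiE ({1..r} - {i0}) S \<times> {..<k}. tensor_eval r E h (node i0 p))}"

lemma finite_tensors: "finite (tensors r E K)"
  by (intro finite_PiE finite_K) auto

text \<open>The nodes are distinct points of a product of dualizable systems: unit vectors in block
  \<open>i0\<close>, point vectors elsewhere. So the \<open>k * k\<close> matrix entries are
  independent and uniform, and the count of dependent matrices becomes a probability of at most m^k
  k / card K.\<close>

lemma card_bad:
  assumes i0: "i0 \<in> {1..r}" and S: "\<And>i. i \<in> {1..r} - {i0} \<Longrightarrow> S i \<subseteq> V \<and> card (S i) \<le> D"
    and prod: "(\<Prod>i\<in>{1..r} - {i0}. card (S i)) = k"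
  shows "card (bad i0 S) * card K \<le> m ^ k * k * card (tensors r E K)"
proof -
  define W where "W = PiE ({1..r} - {i0}) S"
  define \<Theta> where "\<Theta> i = (if i = i0 then unit_vec ` (\<lambda>j. replicate D j) ` {..<k} else mvec ` S i)" for i
  define B where "B = {M \<in> PiE (W \<times> {..<k}) (\<lambda>_. K). frobenius_dependent q m k W K M}"
  have finS: "finite (S i)" if "i \<in> {1..r} - {i0}" for i
    using S[OF that] finite_subset[OF _ finite_V] by blast
  have finW: "finite W" unfolding W_def using finS by (intro finite_PiE) auto
  have cardW: "card W = k" unfolding W_def using prod by (simp add: card_PiE)
  have dual: "dualizable K E (\<Theta> i)" if "i \<in> {1..r}" for i
  proof (cases "i = i0")
    case True
    have "dualizable K E ((unit_vec :: nat list \<Rightarrow> nat list \<Rightarrow> 'a) ` (\<lambda>j. replicate D j) ` {..<k})"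
      by (rule dualizable_units) (auto simp: basis_words_def)
    then show ?thesis using True by (simp add: \<Theta>_def)
  next
    case False
    then show ?thesis using dualizable_grid S[of i] that by (simp add: \<Theta>_def)
  qed
  have node: "node i0 p \<in> PiE {1..r} \<Theta>" if "p \<in> W \<times> {..<k}" for p
  proof -
    obtain w j where p: "p = (w, j)" "w \<in> W" "j < k" using \<open>p \<in> W \<times> {..<k}\<close> by auto
    have "(if i = i0 then top_vec j else mvec (w i)) \<in> \<Theta> i" if "i \<in> {1..r}" for i
      using PiE_mem[OF p(2)[unfolded W_def], of i] that p(3) by (auto simp: \<Theta>_def top_vec_def)
    then show ?thesis unfolding p(1) node_def split by (intro restrict_PiE_iff[THEN iffD2] ballI)
  qed
  have inj: "inj_on (node i0) (W \<times> {..<k})"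
  proof (rule inj_onI)
    fix p p' assume pp: "p \<in> W \<times> {..<k}" "p' \<in> W \<times> {..<k}" "node i0 p = node i0 p'"
    obtain w j w' j' where p: "p = (w, j)" "p' = (w', j')" "w \<in> W" "w' \<in> W" using pp by auto
    have "top_vec j = top_vec j'" using fun_cong[OF pp(3), of i0] i0 by (simp add: p node_def)
    then have "replicate D j = replicate D j'" unfolding top_vec_def by (rule unit_vec_inj)
    then have "j = j'" using D by (simp add: replicate_eq_replicate)
    moreover have "w = w'"
    proof (rule PiE_ext[OF p(3)[unfolded W_def] p(4)[unfolded W_def]])
      fix i assume i: "i \<in> {1..r} - {i0}"
      have "mvec (w i) = mvec (w' i)" using fun_cong[OF pp(3), of i] i by (simp add: p node_def)
      moreover have "w i \<in> V" "w' i \<in> V"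
        using PiE_mem[OF p(3)[unfolded W_def] i] PiE_mem[OF p(4)[unfolded W_def] i] S[OF i] by auto
      ultimately show "w i = w' i" by (intro mvec_inj)
    qed
    ultimately show "p = p'" by (simp add: p)
  qed
  have bad: "bad i0 S = {h \<in> tensors r E K. (\<lambda>p\<in>W \<times> {..<k}. tensor_eval r E h (node i0 p)) \<in> B}"
  proof -
    have "(\<lambda>p\<in>W \<times> {..<k}. tensor_eval r E h (node i0 p)) \<in> PiE (W \<times> {..<k}) (\<lambda>_. K)"
      if h: "h \<in> tensors r E K" for h
    proof (intro restrict_PiE_iff[THEN iffD2] ballI)
      fix p assume "p \<in> W \<times> {..<k}"
      then have p: "node i0 p \<in> PiE {1..r} \<Theta>" by (rule node)
      show "tensor_eval r E h (node i0 p) \<in> K"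
      proof (rule tensor_eval_in_K[OF h])
        fix i l assume "i \<in> {1..r}" "l \<in> E"
        then show "node i0 p i l \<in> K" using PiE_mem[OF p, of i] dual[of i] by (auto simp: dualizable_def)
      qed
    qed
    then show ?thesis unfolding bad_def B_def W_def[symmetric] by blast
  qed
  have eqd: "card (bad i0 S) * card K ^ (k * k) = card (tensors r E K) * card B"
  proof -
    have "card (bad i0 S) * card K ^ card (W \<times> {..<k}) = card (tensors r E K) * card B"
      unfolding bad using finite_K finW dual node inj
      by (intro tensor_equidistributed[where \<Theta> = \<Theta>]) (auto simp: B_def)
    then show ?thesis by (simp add: card_cartesian_product cardW)
  qed
  have "card B * card K \<le> m ^ k * k * card K ^ (k * k)"
    unfolding B_def using q_gt_1[OF prime q e]
    by (intro card_frobenius_dependent coeff_field_axioms refl finite_K finW cardW) auto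
  then have "card (tensors r E K) * (card B * card K) \<le> card (tensors r E K) * (m ^ k * k * card K ^ (k * k))"
    by (rule mult_left_mono) simp
  then have "(card (bad i0 S) * card K) * card K ^ (k * k) \<le> (m ^ k * k * card (tensors r E K)) * card K ^ (k * k)"
    using eqd by (simp add: mult_ac)
  moreover have "card K ^ (k * k) > 0" using q_gt_1[OF prime q e] by (simp add: card_K)
  ultimately show ?thesis by (rule mult_right_le_imp_le)
qed

text \<open>Each of the \<open>k\<close> tuples \<open>w\<close> of the grid contributes one norm
  equation in \<open>z\<close>, which splits into \<open>m\<close> conjugate polynomials of degree
  \<open>D\<close>. Since \<open>h\<close> is not bad, every selection of one leading form per
  equation is independent, and \<open>norm_system_solutions\<close> applies.\<close>

lemma card_extension_le:
  assumes i0: "i0 \<in> {1..r}" and S: "\<And>i. i \<in> {1..r} - {i0} \<Longrightarrow> S i \<subseteq> V \<and> card (S i) \<le> D"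
    and prod: "(\<Prod>i\<in>{1..r} - {i0}. card (S i)) = k"
    and h: "h \<in> tensors r E K" "h \<notin> bad i0 S"
  shows "card {z \<in> V. \<forall>w\<in>PiE ({1..r} - {i0}) S. edge h (w(i0 := z))} \<le> card (words k (k * (D * m ^ k)))"
proof -
  define W where "W = PiE ({1..r} - {i0}) S"
  define Z where "Z = {z \<in> V. \<forall>w\<in>W. edge h (w(i0 := z))}"
  define M where "M = (\<lambda>p\<in>W \<times> {..<k}. tensor_eval r E h (node i0 p))"
  define T where "T w l = tensor_eval r E h ((\<lambda>i. mvec (w i))(i0 := unit_vec l))" for w l
  define c where "c w \<sigma> j = T w (replicate D j) ^ (q ^ \<sigma>)" for w \<sigma> j
  define N where "N w \<sigma> z = tensor_eval r E h (\<lambda>i. mvec ((w(i0 := z)) i)) ^ (q ^ \<sigma>)" for w \<sigma> z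
  have finS: "finite (S i)" if "i \<in> {1..r} - {i0}" for i
    using S[OF that] finite_subset[OF _ finite_V] by blast
  have finW: "finite W" unfolding W_def using finS by (intro finite_PiE) auto
  have cardW: "card W = k" unfolding W_def using prod by (simp add: card_PiE)
  have MT: "M (w, j) = T w (replicate D j)" if "w \<in> W" "j < k" for w j
  proof -
    have "tensor_eval r E h (node i0 (w, j)) = T w (replicate D j)"
      unfolding T_def by (rule tensor_eval_cong) (auto simp: node_def top_vec_def)
    then show ?thesis using that by (simp add: M_def)
  qed
  have TK: "T w l \<in> K" if w: "w \<in> W" for w l
    unfolding T_def
  proof (rule tensor_eval_in_K[OF h(1)])
    fix i l' assume i: "i \<in> {1..r}" and l': "l' \<in> E"
    show "((\<lambda>i. mvec (w i))(i0 := unit_vec l)) i l' \<in> K"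
    proof (cases "i = i0")
      case True
      then show ?thesis by (simp add: unit_vec_def)
    next
      case False
      then have "w i \<in> V" using PiE_mem[OF w[unfolded W_def], of i] S[of i] i by auto
      then have "w i j \<in> K" if "j < k" for j using PiE_mem[of "w i" "{..<k}" _ j] that Fq_K by auto
      then have "wmon l' (w i) \<in> K" using set_basis_words[OF l'] by (rule wmon_in_K)
      then show ?thesis using False by (simp add: mvec_def)
    qed
  qed
  have Mm: "M \<in> PiE (W \<times> {..<k}) (\<lambda>_. K)"
  proof -
    have "tensor_eval r E h (node i0 p) \<in> K" if p: "p \<in> W \<times> {..<k}" for p
    proof -
      obtain w j where "p = (w, j)" "w \<in> W" "j < k" using p by auto
      then show ?thesis using MT[of w j] TK[of w] p by (auto simp: M_def)
    qed
    then show ?thesis unfolding M_def by (intro restrict_PiE_iff[THEN iffD2] ballI)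
  qed
  have indep: "\<not> frobenius_dependent q m k W K M"
    using h unfolding bad_def M_def W_def by simp
  \<comment> \<open>The power map is additive and fixes \<open>wmon l z\<close>, because
    \<open>z\<close> has coordinates in \<open>GF q\<close>. Conjugation thus affects only the
    coefficients, and every conjugate factor is again a polynomial in \<open>z\<close>.\<close>
  have Nz: "N w \<sigma> z = (\<Sum>l\<in>E. wmon l z * T w l ^ (q ^ \<sigma>))" if z: "z \<in> V" for w \<sigma> z
  proof -
    have "tensor_eval r E h (\<lambda>i. mvec ((w(i0 := z)) i)) = tensor_eval r E h ((\<lambda>i. mvec (w i))(i0 := mvec z))"
      by (rule tensor_eval_cong) auto
    also have "\<dots> = (\<Sum>l\<in>E. mvec z l * T w l)"
      unfolding T_def unit_vec_def by (rule tensor_eval_linear[OF _ i0]) simp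
    finally have "N w \<sigma> z = (\<Sum>l\<in>E. mvec z l * T w l) ^ (q ^ \<sigma>)" by (simp add: N_def)
    also have "\<dots> = (\<Sum>l\<in>E. (mvec z l * T w l) ^ (q ^ \<sigma>))"
      by (rule freshmans_dream_sum'[OF prime, of _ "e * \<sigma>"]) (simp add: q power_mult)
    also have "\<dots> = (\<Sum>l\<in>E. wmon l z * T w l ^ (q ^ \<sigma>))"
    proof (intro sum.cong refl)
      fix l assume "l \<in> E"
      then have l: "set l \<subseteq> {..<k}" by (rule set_basis_words)
      have Fq: "coeff_field (GF q :: 'a set)" by (rule coeff_field_GF[OF prime q e])
      have "wmon l z \<in> GF q"
        by (rule coeff_ring.wmon_in_K[OF coeff_field.axioms(1)[OF Fq] _ l]) (use z in auto)
      then show "(mvec z l * T w l) ^ (q ^ \<sigma>) = wmon l z * T w l ^ (q ^ \<sigma>)"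
        by (simp add: mvec_def power_mult_distrib GF_power_q)
    qed
    finally show ?thesis .
  qed
  have disj: "words k (D - 1) \<inter> (\<lambda>j. replicate D j) ` {..<k} = {}" using D by (auto simp: words_def)
  have rinj: "inj_on (\<lambda>j. replicate D j) {..<k}" using D by (auto simp: inj_on_def replicate_eq_replicate)
  interpret U: coeff_field "UNIV :: 'a set" by (rule coeff_field_UNIV)
  have "card Z \<le> card (words k (k * (D * m ^ card W)))"
  proof (rule norm_system_solutions[where I = W and c = c and H = N and b = b])
    show "finite Z" using finite_V by (simp add: Z_def)
    show "finite W" by (rule finW)
    show "1 \<le> m" "1 \<le> D" using m D by auto
    show "\<exists>j<k. y j \<noteq> z j" if "y \<in> Z" "z \<in> Z" "y \<noteq> z" for y z
    proof (rule ccontr)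
      assume "\<not> (\<exists>j<k. y j \<noteq> z j)"
      moreover have "y \<in> V" "z \<in> V" using that by (auto simp: Z_def)
      ultimately have "y = z" by (intro PiE_ext[of y "{..<k}" "\<lambda>_. GF q" z]) auto
      then show False using that by simp
    qed
    show "(\<lambda>x. (\<Sum>j'<k. c w \<sigma> j' * x j' ^ D) - N w \<sigma> x) \<in> polys UNIV Z k (D - 1)" for w \<sigma>
    proof (rule U.polys_cong)
      show "(\<lambda>x. \<Sum>l\<in>words k (D - 1). - (T w l ^ (q ^ \<sigma>)) * wmon l x) \<in> polys UNIV Z k (D - 1)"
        by (intro U.polys_sum U.polys_smult U.polys_mon UNIV_I)
      fix z assume "z \<in> Z"
      then have "z \<in> V" by (simp add: Z_def)
      then have "N w \<sigma> z = (\<Sum>l\<in>words k (D - 1). wmon l z * T w l ^ (q ^ \<sigma>))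
          + (\<Sum>l\<in>(\<lambda>j. replicate D j) ` {..<k}. wmon l z * T w l ^ (q ^ \<sigma>))"
        unfolding Nz[OF \<open>z \<in> V\<close>] basis_words_def using disj by (intro sum.union_disjoint) auto
      also have "(\<Sum>l\<in>(\<lambda>j. replicate D j) ` {..<k}. wmon l z * T w l ^ (q ^ \<sigma>)) = (\<Sum>j'<k. c w \<sigma> j' * z j' ^ D)"
        by (subst sum.reindex[OF rinj]) (simp add: c_def mult.commute)
      finally show "(\<Sum>j'<k. c w \<sigma> j' * z j' ^ D) - N w \<sigma> z = (\<Sum>l\<in>words k (D - 1). - (T w l ^ (q ^ \<sigma>)) * wmon l z)"
        by (simp add: sum_negf mult.commute)
    qed
    show "(\<Prod>\<sigma><m. N w \<sigma> x) = b" if "w \<in> W" "x \<in> Z" for w x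
      using that by (simp add: Z_def edge_def N_def)
    show "\<exists>\<alpha>. \<forall>j'<k. (\<Sum>i\<in>W. \<alpha> i * c i (\<tau> i) j') = (if j' = j then 1 else 0)"
      if \<tau>: "\<tau> \<in> PiE W (\<lambda>_. {..<m})" and j: "j < k" for \<tau> j
    proof -
      obtain \<alpha> where \<alpha>: "\<forall>j'<k. (\<Sum>i\<in>W. \<alpha> i * M (i, j') ^ (q ^ \<tau> i)) = (if j' = j then 1 else 0)"
        using frobenius_independent_dual[OF coeff_field_axioms finite_K finW cardW Mm indep \<tau> j GF_power] by blast
      have "(\<Sum>i\<in>W. \<alpha> i * c i (\<tau> i) j') = (if j' = j then 1 else 0)" if "j' < k" for j'
      proof -
        have "(\<Sum>i\<in>W. \<alpha> i * c i (\<tau> i) j') = (\<Sum>i\<in>W. \<alpha> i * M (i, j') ^ (q ^ \<tau> i))"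
          by (intro sum.cong refl) (simp add: c_def MT that)
        then show ?thesis using \<alpha> that by simp
      qed
      then show ?thesis by (intro exI[of _ \<alpha>] allI impI)
    qed
  qed
  then have "card Z \<le> card (words k (k * (D * m ^ k)))" by (simp only: cardW)
  then show ?thesis unfolding Z_def W_def .
qed

text \<open>The values at the transversals of \<open>A\<close> are independent and uniform in
  \<open>K\<close>, and each has norm \<open>b\<close> with probability at least 1 / q.\<close>

lemma card_complete_grid:
  assumes A: "\<And>i. i \<in> {1..r} \<Longrightarrow> A i \<subseteq> V \<and> card (A i) \<le> D"
    and b: "q ^ m \<le> q * card {y \<in> K. (\<Prod>\<sigma><m. y ^ (q ^ \<sigma>)) = b}"
  shows "card (tensors r E K)
    \<le> q ^ (\<Prod>i=1..r. card (A i)) * card {h \<in> tensors r E K. \<forall>x\<in>PiE {1..r} A. edge h x}"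
proof -
  define P where "P = PiE {1..r} A"
  define B where "B = {y \<in> K. (\<Prod>\<sigma><m. y ^ (q ^ \<sigma>)) = b}"
  define node' where "node' x = (\<lambda>i\<in>{1..r}. mvec (x i))" for x :: "nat \<Rightarrow> nat \<Rightarrow> 'a"
  define \<Theta> where "\<Theta> i = mvec ` A i" for i
  have finA: "finite (A i)" if "i \<in> {1..r}" for i
    using A[OF that] finite_subset[OF _ finite_V] by blast
  have finP: "finite P" unfolding P_def using finA by (intro finite_PiE) auto
  have cardP: "card P = (\<Prod>i=1..r. card (A i))" by (simp add: P_def card_PiE)
  have finB: "finite B" using finite_K by (simp add: B_def)
  have dual: "dualizable K E (\<Theta> i)" if "i \<in> {1..r}" for i
    unfolding \<Theta>_def using A[OF that] by (intro dualizable_grid) auto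
  have node: "node' x \<in> PiE {1..r} \<Theta>" if "x \<in> P" for x
    unfolding node'_def \<Theta>_def using PiE_mem[OF that[unfolded P_def]]
    by (intro restrict_PiE_iff[THEN iffD2] ballI imageI)
  have inj: "inj_on node' P"
  proof (rule inj_onI)
    fix x y assume xy: "x \<in> P" "y \<in> P" "node' x = node' y"
    show "x = y"
    proof (rule PiE_ext[OF xy(1,2)[unfolded P_def]])
      fix i assume i: "i \<in> {1..r}"
      have "mvec (x i) = mvec (y i)" using fun_cong[OF xy(3), of i] i by (simp add: node'_def)
      moreover have "x i \<in> V" "y i \<in> V"
        using PiE_mem[OF xy(1)[unfolded P_def] i] PiE_mem[OF xy(2)[unfolded P_def] i] A[OF i] by auto
      ultimately show "x i = y i" by (intro mvec_inj)
    qed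
  qed
  have val: "tensor_eval r E h (node' x) \<in> K" if h: "h \<in> tensors r E K" and "x \<in> P" for h x
  proof (rule tensor_eval_in_K[OF h])
    fix i l assume "i \<in> {1..r}" "l \<in> E"
    then show "node' x i l \<in> K" using PiE_mem[OF node[OF \<open>x \<in> P\<close>], of i] dual[of i] by (auto simp: dualizable_def)
  qed
  have te: "tensor_eval r E h (\<lambda>i. mvec (x i)) = tensor_eval r E h (node' x)" for h x
    by (rule tensor_eval_cong) (simp add: node'_def)
  have eq: "{h \<in> tensors r E K. \<forall>x\<in>P. edge h x}
     = {h \<in> tensors r E K. (\<lambda>x\<in>P. tensor_eval r E h (node' x)) \<in> PiE P (\<lambda>_. B)}" (is "?L = ?R")
  proof (intro Collect_cong conj_cong refl)
    fix h assume h: "h \<in> tensors r E K"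
    have "(\<lambda>x\<in>P. tensor_eval r E h (node' x)) \<in> PiE P (\<lambda>_. B) \<longleftrightarrow> (\<forall>x\<in>P. tensor_eval r E h (node' x) \<in> B)"
      by (rule restrict_PiE_iff)
    also have "\<dots> \<longleftrightarrow> (\<forall>x\<in>P. edge h x)"
      using val[OF h] by (auto simp: B_def edge_def te)
    finally show "(\<forall>x\<in>P. edge h x) \<longleftrightarrow> (\<lambda>x\<in>P. tensor_eval r E h (node' x)) \<in> PiE P (\<lambda>_. B)" by simp
  qed
  have "card ?R * card K ^ card P = card (tensors r E K) * card (PiE P (\<lambda>_. B))"
    by (rule tensor_equidistributed[where \<Theta> = \<Theta>, OF finite_K _ finP dual node inj])
       (auto simp: B_def PiE_iff)
  then have c: "card ?L * card K ^ card P = card (tensors r E K) * card B ^ card P"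
    unfolding eq using finP by (simp add: card_PiE)
  have "card K ^ card P \<le> (q * card B) ^ card P"
    using b by (intro power_mono) (auto simp: card_K B_def)
  then have "card (tensors r E K) * card K ^ card P \<le> card (tensors r E K) * (q * card B) ^ card P"
    by (rule mult_left_mono) simp
  also have "\<dots> = q ^ card P * (card (tensors r E K) * card B ^ card P)" by (simp add: power_mult_distrib)
  also have "\<dots> = (q ^ card P * card ?L) * card K ^ card P" unfolding c[symmetric] by simp
  finally have "card (tensors r E K) * card K ^ card P \<le> (q ^ card P * card ?L) * card K ^ card P" .
  moreover have "card K ^ card P > 0" using q_gt_1[OF prime q e] by (simp add: card_K)
  ultimately have "card (tensors r E K) \<le> q ^ card P * card ?L" by (rule mult_right_le_imp_le)
  then show ?thesis unfolding cardP unfolding P_def .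
qed

text \<open>All free blocks \<open>i0\<close> are controlled at once, because a copy of the
  forbidden hypergraph may place its part of size \<open>p\<close> in any part of the host.\<close>

lemma exists_good_tensor:
  assumes r: "r \<ge> 1" and a: "\<forall>i\<in>{1..r}. a i \<le> D"
    and m_eq: "m = k * D * (r - 1) + (\<Prod>i=1..r. a i) + 1" and large: "2 * (r * (m ^ k * k)) \<le> q"
    and b: "q ^ m \<le> q * card {y \<in> K. (\<Prod>\<sigma><m. y ^ (q ^ \<sigma>)) = b}"
  shows "\<exists>h. (\<forall>i0\<in>{1..r}. \<forall>S\<in>PiE ({1..r} - {i0}) (\<lambda>_. {S. S \<subseteq> V \<and> S \<noteq> {} \<and> card S \<le> D}).
        (\<Prod>i\<in>{1..r} - {i0}. card (S i)) = k \<longrightarrow>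
        card {z \<in> V. \<forall>w\<in>PiE ({1..r} - {i0}) S. edge h (w(i0 := z))} \<le> card (words k (k * (D * m ^ k)))) \<and>
     (\<Prod>i=1..r. q ^ k choose a i) \<le> 2 * q ^ (\<Prod>i=1..r. a i) *
        card {A \<in> PiE {1..r} (\<lambda>i. {S. S \<subseteq> V \<and> card S = a i}). \<forall>x\<in>PiE {1..r} A. edge h x}"
proof -
  define H where "H = tensors r E K"
  define SS where "SS i0 = PiE ({1..r} - {i0}) (\<lambda>_. {S. S \<subseteq> V \<and> S \<noteq> {} \<and> card S \<le> D})" for i0
  define SK where "SK i0 = {S \<in> SS i0. (\<Prod>i\<in>{1..r} - {i0}. card (S i)) = k}" for i0
  define Bad where "Bad = (\<Union>i0\<in>{1..r}. \<Union>S\<in>SK i0. bad i0 S)"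
  define GG where "GG = PiE {1..r} (\<lambda>i. {S. S \<subseteq> V \<and> card S = a i})"
  define P where "P = q ^ (\<Prod>i=1..r. a i)"
  \<comment> \<open>Bounds the number of grids for one \<open>i0\<close>: they consist of
    \<open>r - 1\<close> nonempty sets of at most \<open>D\<close> among \<open>q ^ k\<close>
    points.\<close>
  define N where "N = (q ^ k) ^ (D * (r - 1))"
  define c where "c = m ^ k * k"
  have q1: "q > 1" by (rule q_gt_1[OF prime q e])
  have finH: "finite H" unfolding H_def by (rule finite_tensors)
  have neH: "H \<noteq> {}" unfolding H_def PiE_eq_empty_iff using K_0 by blast
  have finSS: "finite (SS i0)" for i0
    unfolding SS_def using finite_V by (intro finite_PiE) auto
  have cardSK: "card (SK i0) \<le> N" if "i0 \<in> {1..r}" for i0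
  proof -
    have "card (SK i0) \<le> card (SS i0)" using finSS by (intro card_mono) (auto simp: SK_def)
    also have "\<dots> = card {S. S \<subseteq> V \<and> S \<noteq> {} \<and> card S \<le> D} ^ (r - 1)"
      unfolding SS_def using that by (simp add: card_PiE)
    also have "\<dots> \<le> (card V ^ D) ^ (r - 1)"
      by (intro power_mono card_small_subsets_le finite_V) simp
    finally show ?thesis by (simp add: N_def card_V power_mult)
  qed
  have cb: "card (bad i0 S) * card K \<le> c * card H" if i0: "i0 \<in> {1..r}" and S: "S \<in> SK i0" for i0 S
    unfolding H_def c_def
  proof (rule card_bad[OF i0])
    show "S i \<subseteq> V \<and> card (S i) \<le> D" if "i \<in> {1..r} - {i0}" for i
      using PiE_mem[of S "{1..r} - {i0}" "\<lambda>_. {S. S \<subseteq> V \<and> S \<noteq> {} \<and> card S \<le> D}" i] S that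
      by (simp add: SK_def SS_def)
    show "(\<Prod>i\<in>{1..r} - {i0}. card (S i)) = k" using S by (simp add: SK_def)
  qed
  have finSK: "finite (SK i0)" for i0 using finSS by (simp add: SK_def)
  have "card Bad \<le> (\<Sum>i0\<in>{1..r}. \<Sum>S\<in>SK i0. card (bad i0 S))"
    unfolding Bad_def by (intro card_UN_le[THEN order_trans] sum_mono finSK order_refl) auto
  then have "card Bad * card K \<le> (\<Sum>i0\<in>{1..r}. \<Sum>S\<in>SK i0. card (bad i0 S)) * card K"
    by (rule mult_right_mono) simp
  also have "\<dots> = (\<Sum>i0\<in>{1..r}. \<Sum>S\<in>SK i0. card (bad i0 S) * card K)"
    by (simp only: sum_distrib_right)
  also have "\<dots> \<le> (\<Sum>i0\<in>{1..r}. \<Sum>S\<in>SK i0. c * card H)"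
    by (intro sum_mono cb)
  also have "\<dots> = (\<Sum>i0\<in>{1..r}. card (SK i0) * (c * card H))" by simp
  also have "\<dots> \<le> (\<Sum>i0\<in>{1..r}. N * (c * card H))"
    by (intro sum_mono mult_right_mono cardSK) auto
  also have "\<dots> = N * (r * c * card H)" by simp
  finally have "card Bad * card K \<le> N * (r * c * card H)" .
  \<comment> \<open>This identity is the purpose of the choice of \<open>m\<close>: the factor
    \<open>N\<close> pays for the union over grids, \<open>P\<close> for the probability of a copy,
    and \<open>q\<close> for the constant 2 r c.\<close>
  moreover have "card K = N * (P * q)"
  proof -
    have "q ^ m = q ^ (k * (D * (r - 1))) * (P * q)"
      by (subst m_eq) (simp add: P_def power_add mult.assoc)
    then show ?thesis unfolding card_K N_def power_mult[of q k, symmetric] .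
  qed
  ultimately have "N * (card Bad * P * q) \<le> N * (r * c * card H)" by (simp only: mult_ac)
  moreover have "N > 0" using q1 by (simp add: N_def)
  ultimately have B1: "card Bad * P * q \<le> r * c * card H" by (rule mult_left_le_imp_le)
  have "(r * c) * (2 * P * card Bad) = card Bad * P * (2 * (r * c))" by simp
  also have "\<dots> \<le> card Bad * P * q" using large unfolding c_def by (rule mult_left_mono) simp
  also have "\<dots> \<le> (r * c) * card H" using B1 .
  finally have "(r * c) * (2 * P * card Bad) \<le> (r * c) * card H" .
  moreover have "r * c > 0" using r m k by (simp add: c_def)
  ultimately have B2: "2 * P * card Bad \<le> card H" by (rule mult_left_le_imp_le)
  have finG: "finite GG" unfolding GG_def using finite_V by (intro finite_PiE) auto
  have "\<exists>h\<in>H - Bad. card GG \<le> 2 * P * card {A \<in> GG. \<forall>x\<in>PiE {1..r} A. edge h x}"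
  proof (rule exists_good_outside_bad[OF finH neH _ B2 _ finG])
    show "Bad \<subseteq> H" by (auto simp: Bad_def H_def bad_def)
    show "P > 0" using q1 by (simp add: P_def)
    fix A assume A: "A \<in> GG"
    have A': "A i \<subseteq> V \<and> card (A i) = a i" if "i \<in> {1..r}" for i
      using PiE_mem[OF A[unfolded GG_def] that] by simp
    have "(\<Prod>i=1..r. card (A i)) = (\<Prod>i=1..r. a i)" using A' by (intro prod.cong) auto
    moreover have "card H \<le> q ^ (\<Prod>i=1..r. card (A i)) * card {h \<in> H. \<forall>x\<in>PiE {1..r} A. edge h x}"
      unfolding H_def using A' a by (intro card_complete_grid b) auto
    ultimately show "card H \<le> P * card {h \<in> H. \<forall>x\<in>PiE {1..r} A. edge h x}"
      by (simp add: P_def)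
  qed
  then obtain h where h: "h \<in> H" "h \<notin> Bad"
    and big: "card GG \<le> 2 * P * card {A \<in> GG. \<forall>x\<in>PiE {1..r} A. edge h x}" by auto
  have "card GG = (\<Prod>i=1..r. q ^ k choose a i)"
    unfolding GG_def using finite_V by (simp add: card_PiE n_subsets card_V)
  moreover have "card {z \<in> V. \<forall>w\<in>PiE ({1..r} - {i0}) S. edge h (w(i0 := z))} \<le> card (words k (k * (D * m ^ k)))"
    if i0: "i0 \<in> {1..r}" and S: "S \<in> SS i0" and prod: "(\<Prod>i\<in>{1..r} - {i0}. card (S i)) = k" for i0 S
  proof (rule card_extension_le[OF i0 _ prod])
    show "S i \<subseteq> V \<and> card (S i) \<le> D" if "i \<in> {1..r} - {i0}" for i
      using PiE_mem[of S "{1..r} - {i0}" "\<lambda>_. {S. S \<subseteq> V \<and> S \<noteq> {} \<and> card S \<le> D}" i] S that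
      by (simp add: SS_def)
    show "h \<in> tensors r E K" using h(1) by (simp add: H_def)
    show "h \<notin> bad i0 S" using h(2) i0 S prod unfolding Bad_def SK_def by blast
  qed
  ultimately show ?thesis using big unfolding SS_def GG_def P_def
    by (intro exI[of _ h] conjI ballI impI) simp_all
qed

end

section \<open>From tuples to a partite hypergraph\<close>

text \<open>
  In an \<open>r\<close>-partite host every edge meets every part of the host once, so two vertices in the same
  part of a copy of a complete \<open>r\<close>-partite hypergraph lie in the same part of the host. The bijection
  \<open>c\<close> records which one.
\<close>

lemma partite_host:
  fixes V :: "'v set" and F :: "(nat \<Rightarrow> 'v) \<Rightarrow> bool"
  assumes V: "finite V" and r: "r \<ge> 1" and n: "r * card V \<le> n"
  shows "\<exists>G :: nat hypergraph. verts G = {..<n} \<and> uniform r G \<and>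
    (\<forall>u. (\<forall>i\<in>{1..r}. u i > 0) \<longrightarrow> \<not> free_of (complete_partite r u) G \<longrightarrow>
      (\<exists>c S. bij_betw c {1..r} {1..r} \<and> S \<in> PiE ({1..r} - {c r}) (\<lambda>_. Pow V) \<and>
        (\<forall>i\<in>{1..r} - {r}. card (S (c i)) = u i) \<and>
        u r \<le> card {z \<in> V. \<forall>w\<in>PiE ({1..r} - {c r}) S. F (w(c r := z))})) \<and>
    (\<forall>a. (\<forall>i\<in>{1..r}. a i > 0) \<longrightarrow>
      card {A \<in> PiE {1..r} (\<lambda>i. {S. S \<subseteq> V \<and> card S = a i}). \<forall>x\<in>PiE {1..r} A. F x}
        \<le> card (copies (complete_partite r a) G))"
proof -
  let ?I = "{1..r}"
  have "card (?I \<times> V) \<le> card {..<n}" using n by (simp add: card_cartesian_product)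
  then obtain \<iota> where \<iota>: "inj_on \<iota> (?I \<times> V)" "\<iota> ` (?I \<times> V) \<subseteq> {..<n}"
    using inj_on_iff_card_le[of "?I \<times> V" "{..<n}"] V by auto
  \<comment> \<open>\<iota> places \<open>r\<close> disjoint copies of \<open>V\<close> among the
    \<open>n\<close> vertices, and the vertices left over are isolated. \<open>col\<close> recovers
    the part and the point from a vertex.\<close>
  define ed where "ed x = (\<lambda>i. \<iota> (i, x i)) ` ?I" for x
  define col where "col = inv_into (?I \<times> V) \<iota>"
  define T where "T = PiE ?I (\<lambda>_. V)"
  define G where "G = ({..<n}, ed ` {x \<in> T. F x})"
  have col: "col (\<iota> (i, z)) = (i, z)" if "i \<in> ?I" "z \<in> V" for i z
    unfolding col_def using that \<iota>(1) by (intro inv_into_f_f) auto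
  have \<iota>n: "\<iota> (i, z) \<in> {..<n}" if "i \<in> ?I" "z \<in> V" for i z
    using \<iota>(2) that by blast
  have injz: "inj_on (\<lambda>z. \<iota> (i, z)) V" if i: "i \<in> ?I" for i
  proof (rule inj_onI)
    fix z z' assume z: "z \<in> V" "z' \<in> V" "\<iota> (i, z) = \<iota> (i, z')"
    then have "(i, z) = (i, z')" using col[OF i z(1)] col[OF i z(2)] by metis
    then show "z = z'" by (metis prod.inject)
  qed
  have TV: "x i \<in> V" if "x \<in> T" "i \<in> ?I" for x i
    using PiE_mem[of x ?I "\<lambda>_. V" i] that unfolding T_def by simp
  have ed_inj: "x = y" if x: "x \<in> T" and y: "y \<in> T" and eq: "ed x = ed y" for x y
  proof (rule PiE_ext[OF x[unfolded T_def] y[unfolded T_def]])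
    fix i assume i: "i \<in> ?I"
    then have "\<iota> (i, x i) \<in> ed x" unfolding ed_def by (rule imageI)
    then have "\<iota> (i, x i) \<in> ed y" by (simp only: eq)
    then obtain j where j: "j \<in> ?I" "\<iota> (i, x i) = \<iota> (j, y j)" unfolding ed_def by blast
    then have "(i, x i) = (j, y j)" using col[OF i TV[OF x i]] col[OF j(1) TV[OF y j(1)]] by metis
    then show "x i = y i" by (metis prod.inject)
  qed
  have unif: "uniform r G"
  proof -
    have "ed x \<subseteq> {..<n} \<and> card (ed x) = r" if x: "x \<in> T" for x
    proof
      show "ed x \<subseteq> {..<n}" unfolding ed_def
      proof (rule image_subsetI)
        fix i assume i: "i \<in> ?I"
        show "\<iota> (i, x i) \<in> {..<n}" by (rule \<iota>n[OF i TV[OF x i]])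
      qed
      have "inj_on (\<lambda>i. \<iota> (i, x i)) ?I"
      proof (rule inj_onI)
        fix i j assume ij: "i \<in> ?I" "j \<in> ?I" "\<iota> (i, x i) = \<iota> (j, x j)"
        have "(i, x i) = (j, x j)" using col[OF ij(1) TV[OF x ij(1)]] col[OF ij(2) TV[OF x ij(2)]] ij(3) by metis
        then show "i = j" by (metis prod.inject)
      qed
      then show "card (ed x) = r" by (simp add: ed_def card_image)
    qed
    then show ?thesis unfolding uniform_def hypergraph_def G_def by auto
  qed
  have edge_iff: "ed y \<in> edges G \<longleftrightarrow> F y" if y: "y \<in> T" for y
  proof
    assume "ed y \<in> edges G"
    then obtain x where x: "x \<in> T" "F x" "ed y = ed x" by (auto simp: G_def)
    then show "F y" using ed_inj[OF y x(1,3)] by simp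
  qed (use y in \<open>auto simp: G_def\<close>)
  have notfree: "\<exists>c S. bij_betw c ?I ?I \<and> S \<in> PiE (?I - {c r}) (\<lambda>_. Pow V) \<and>
        (\<forall>i\<in>?I - {r}. card (S (c i)) = u i) \<and>
        u r \<le> card {z \<in> V. \<forall>w\<in>PiE (?I - {c r}) S. F (w(c r := z))}"
    if u: "\<forall>i\<in>?I. u i > 0" and nf: "\<not> free_of (complete_partite r u) G" for u
  proof -
    from nf obtain H where "H \<in> copies (complete_partite r u) G" by (auto simp: free_of_def)
    then obtain A where A: "\<And>i. i \<in> ?I \<Longrightarrow> card (A i) = u i" and tr: "transversals r A \<subseteq> edges G"
      by (rule copies_partE) blast
    define d where "d x i = fst (col (x i))" for x :: "nat \<Rightarrow> nat" and i :: nat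
    \<comment> \<open>A transversal of the copy is a host edge, so its \<open>r\<close> vertices
      occupy each of the \<open>r\<close> host parts once.\<close>
    have tr': "bij_betw (d x) ?I ?I \<and> (\<forall>i\<in>?I. col (x i) \<in> ?I \<times> V \<and> \<iota> (col (x i)) = x i)"
      if x: "x \<in> PiE ?I A" for x
    proof -
      have "x ` ?I \<in> edges G" using tr x by (auto simp: transversals_def)
      then obtain y where y: "y \<in> T" "x ` ?I = ed y" by (auto simp: G_def)
      have 1: "col (x i) \<in> ?I \<times> V \<and> \<iota> (col (x i)) = x i" if "i \<in> ?I" for i
      proof -
        have "x i \<in> ed y" using y(2) that by blast
        then obtain j where "j \<in> ?I" "x i = \<iota> (j, y j)" unfolding ed_def by blast
        then show ?thesis using col[of j "y j"] TV[OF y(1)] by simp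
      qed
      have "?I \<subseteq> d x ` ?I"
      proof
        fix j assume j: "j \<in> ?I"
        then have "\<iota> (j, y j) \<in> x ` ?I" unfolding y(2) ed_def by blast
        then obtain i where i: "i \<in> ?I" "x i = \<iota> (j, y j)" by (metis imageE)
        then have "d x i = j" using col[OF j TV[OF y(1) j]] by (simp add: d_def)
        then show "j \<in> d x ` ?I" using i(1) by blast
      qed
      moreover have "d x ` ?I \<subseteq> ?I"
      proof (rule image_subsetI)
        fix i assume "i \<in> ?I"
        from 1[OF this] show "d x i \<in> ?I" unfolding d_def by (auto simp: mem_Times_iff)
      qed
      ultimately have "d x ` ?I = ?I" by simp
      then have "bij_betw (d x) ?I ?I" by (simp add: bij_betw_def eq_card_imp_inj_on)
      then show ?thesis using 1 by simp
    qed
    have "\<forall>i\<in>?I. \<exists>v. v \<in> A i"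
    proof
      fix i assume "i \<in> ?I"
      then have "card (A i) > 0" using A u by simp
      then show "\<exists>v. v \<in> A i" by (auto simp: card_gt_0_iff)
    qed
    then obtain x0' where x0': "\<And>i. i \<in> ?I \<Longrightarrow> x0' i \<in> A i"
      using bchoice[of ?I "\<lambda>i v. v \<in> A i"] by blast
    define x0 where "x0 = restrict x0' ?I"
    have x0: "x0 \<in> PiE ?I A" unfolding x0_def using x0' by (intro restrict_PiE_iff[THEN iffD2]) auto
    define c where "c = d x0"
    have c: "bij_betw c ?I ?I" using tr'[OF x0] by (simp add: c_def)
    have cI: "c i \<in> ?I" if "i \<in> ?I" for i using bij_betwE[OF c] that by blast
    \<comment> \<open>Exchanging the \<open>i\<close>-th vertex of \<open>x0\<close> for
      \<open>v\<close> leaves the other host parts occupied, so \<open>v\<close> must lie in the one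
      that became vacant, namely \<open>c i\<close>.\<close>
    have colA: "\<exists>z\<in>V. v = \<iota> (c i, z)" if i: "i \<in> ?I" and v: "v \<in> A i" for i v
    proof -
      define x where "x = x0(i := v)"
      have x: "x \<in> PiE ?I A"
        unfolding x_def using i v x0 by (auto simp: PiE_iff extensional_def)
      have off: "d x j = c j" if "j \<noteq> i" for j using that by (simp add: d_def x_def c_def)
      have "d x i \<notin> c ` (?I - {i})"
      proof
        assume "d x i \<in> c ` (?I - {i})"
        then obtain j where j: "j \<in> ?I - {i}" "d x i = c j" by blast
        then have "d x i = d x j" using off by simp
        moreover have "inj_on (d x) ?I" using tr'[OF x] by (simp add: bij_betw_def)
        ultimately show False using j(1) i by (auto dest: inj_onD)
      qed
      moreover have "d x i \<in> c ` ?I" using tr'[OF x] c i by (auto simp: bij_betw_def)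
      moreover have "c ` ?I = insert (c i) (c ` (?I - {i}))" using i by blast
      ultimately have "d x i = c i" by blast
      then have "fst (col v) = c i" by (simp add: d_def x_def)
      moreover have "col (x i) \<in> ?I \<times> V \<and> \<iota> (col (x i)) = x i" using tr'[OF x] i by blast
      then have "snd (col v) \<in> V" "\<iota> (fst (col v), snd (col v)) = v" by (simp_all add: x_def mem_Times_iff)
      ultimately show ?thesis by (intro bexI[of _ "snd (col v)"]) simp_all
    qed
    define B where "B i = {z \<in> V. \<iota> (c i, z) \<in> A i}" for i
    have cardB: "card (B i) = u i" if i: "i \<in> ?I" for i
    proof -
      have "(\<lambda>z. \<iota> (c i, z)) ` B i = A i" using colA[OF i] by (auto simp: B_def)
      moreover have "inj_on (\<lambda>z. \<iota> (c i, z)) (B i)"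
        by (rule inj_on_subset[OF injz[OF cI[OF i]]]) (auto simp: B_def)
      ultimately show ?thesis using A[OF i] card_image by metis
    qed
    define c' where "c' = inv_into ?I c"
    have c': "c' (c i) = i" if "i \<in> ?I" for i
      using c that by (simp add: c'_def bij_betw_def)
    have rI: "r \<in> ?I" using r by simp
    define S where "S = (\<lambda>j\<in>?I - {c r}. B (c' j))"
    have S: "S (c i) = B i" if "i \<in> ?I - {r}" for i
    proof -
      have "c i \<noteq> c r" using inj_onD[OF bij_betw_imp_inj_on[OF c], of i r] that rI by blast
      then show ?thesis using that cI[of i] c'[of i] by (simp add: S_def)
    qed
    have "S \<in> PiE (?I - {c r}) (\<lambda>_. Pow V)"
      unfolding S_def by (intro restrict_PiE_iff[THEN iffD2]) (auto simp: B_def)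
    moreover have "\<forall>i\<in>?I - {r}. card (S (c i)) = u i" using S cardB by simp
    moreover have "B r \<subseteq> {z \<in> V. \<forall>w\<in>PiE (?I - {c r}) S. F (w(c r := z))}"
    proof
      fix z assume z: "z \<in> B r"
      have "F (w(c r := z))" if w: "w \<in> PiE (?I - {c r}) S" for w
      proof -
        define y where "y = w(c r := z)"
        define x where "x = (\<lambda>i\<in>?I. \<iota> (c i, y (c i)))"
        have yB: "y (c i) \<in> B i" if i: "i \<in> ?I" for i
        proof (cases "i = r")
          case True
          then show ?thesis using z by (simp add: y_def)
        next
          case False
          then have ne: "c i \<noteq> c r" using inj_onD[OF bij_betw_imp_inj_on[OF c], of i r] i rI by blast
          then have "w (c i) \<in> S (c i)" using PiE_mem[OF w, of "c i"] cI[OF i] by simp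
          then show ?thesis using S[of i] i False ne by (simp add: y_def)
        qed
        have "x \<in> PiE ?I A"
          unfolding x_def using yB by (intro restrict_PiE_iff[THEN iffD2]) (auto simp: B_def)
        then have "x ` ?I \<in> edges G" using tr by (auto simp: transversals_def)
        moreover have "x ` ?I = ed y"
        proof -
          have "x ` ?I = (\<lambda>j. \<iota> (j, y j)) ` c ` ?I" by (simp add: x_def image_image)
          then show ?thesis using c by (simp add: ed_def bij_betw_def)
        qed
        moreover have "y \<in> T"
        proof -
          have "y j \<in> V" if "j \<in> ?I" for j
          proof -
            have "j \<in> c ` ?I" using c \<open>j \<in> ?I\<close> by (simp add: bij_betw_def)
            then obtain i where "i \<in> ?I" "j = c i" by blast
            then show ?thesis using yB[of i] by (simp add: B_def)
          qed
          moreover have "y j = undefined" if "j \<notin> ?I" for j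
            using that cI[OF rI] PiE_arb[OF w, of j] by (auto simp: y_def)
          ultimately show ?thesis unfolding T_def by (intro PiE_I)
        qed
        ultimately show ?thesis using edge_iff[of y] by (simp add: y_def)
      qed
      then show "z \<in> {z \<in> V. \<forall>w\<in>PiE (?I - {c r}) S. F (w(c r := z))}"
        using z by (simp add: B_def)
    qed
    then have "u r \<le> card {z \<in> V. \<forall>w\<in>PiE (?I - {c r}) S. F (w(c r := z))}"
      unfolding cardB[OF rI, symmetric] using V by (intro card_mono) auto
    ultimately show ?thesis using c by (intro exI[of _ c] exI[of _ S] conjI)
  qed
  have many: "card {A \<in> PiE ?I (\<lambda>i. {S. S \<subseteq> V \<and> card S = a i}). \<forall>x\<in>PiE ?I A. F x}
        \<le> card (copies (complete_partite r a) G)" (is "card ?GG \<le> _")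
    if a: "\<forall>i\<in>?I. a i > 0" for a
  proof (rule card_inj_on_le)
    define B where "B A = (\<lambda>i\<in>?I. (\<lambda>z. \<iota> (i, z)) ` A i)" for A :: "nat \<Rightarrow> 'v set"
    let ?f = "\<lambda>A. (\<Union>i\<in>?I. B A i, transversals r (B A))"
    have AV: "A i \<subseteq> V \<and> card (A i) = a i" if "A \<in> ?GG" "i \<in> ?I" for A i
      using PiE_mem[of A ?I "\<lambda>i. {S. S \<subseteq> V \<and> card S = a i}" i] that by simp
    show "?f ` ?GG \<subseteq> copies (complete_partite r a) G"
    proof (rule image_subsetI)
      fix A assume A: "A \<in> ?GG"
      show "?f A \<in> copies (complete_partite r a) G"
      proof (rule grid_copy[OF unif _ a])
        show "B A \<in> grids r a G"
          unfolding grids_def mem_Collect_eq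
        proof (intro conjI ballI)
          have "(\<lambda>z. \<iota> (i, z)) ` A i \<subseteq> verts G \<and> card ((\<lambda>z. \<iota> (i, z)) ` A i) = a i" if i: "i \<in> ?I" for i
          proof
            show "(\<lambda>z. \<iota> (i, z)) ` A i \<subseteq> verts G" using \<iota>n[OF i] AV[OF A i] by (auto simp: G_def)
            have "inj_on (\<lambda>z. \<iota> (i, z)) (A i)" by (rule inj_on_subset[OF injz[OF i]]) (use AV[OF A i] in blast)
            then show "card ((\<lambda>z. \<iota> (i, z)) ` A i) = a i" using AV[OF A i] by (simp add: card_image)
          qed
          then show "B A \<in> PiE ?I (\<lambda>i. {S. S \<subseteq> verts G \<and> card S = a i})"
            unfolding B_def by (intro restrict_PiE_iff[THEN iffD2] ballI CollectI)
          fix x assume x: "x \<in> PiE ?I (B A)"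
          define y where "y = (\<lambda>i\<in>?I. snd (col (x i)))"
          have y: "y i \<in> A i \<and> x i = \<iota> (i, y i)" if i: "i \<in> ?I" for i
          proof -
            have "x i \<in> (\<lambda>z. \<iota> (i, z)) ` A i" using PiE_mem[OF x i] i by (simp add: B_def)
            then obtain z where z: "z \<in> A i" "x i = \<iota> (i, z)" by blast
            then have "z \<in> V" using AV[OF A i] by blast
            then have "col (x i) = (i, z)" unfolding z(2) by (rule col[OF i])
            then show ?thesis using z i by (simp add: y_def)
          qed
          have "y \<in> PiE ?I A" unfolding PiE_iff using y by (simp add: y_def)
          then have "F y" using A by simp
          have "y i \<in> V" if "i \<in> ?I" for i using y[OF that] AV[OF A that] by blast
          then have "y \<in> T" unfolding T_def PiE_iff by (simp add: y_def)
          then have "ed y \<in> edges G" using \<open>F y\<close> edge_iff by simp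
          moreover have "x ` ?I = ed y" unfolding ed_def using y by (intro image_cong) auto
          ultimately show "x ` ?I \<in> edges G" by simp
        qed
      qed
    qed
    show "inj_on ?f ?GG"
    proof (rule inj_onI)
      fix A A' assume A: "A \<in> ?GG" "A' \<in> ?GG" and eq: "?f A = ?f A'"
      \<comment> \<open>Injectivity needs only the vertex set of the copy: the host label \<iota>
        (i, z) records to which part a vertex belongs.\<close>
      have mem: "z \<in> C i \<longleftrightarrow> z \<in> V \<and> \<iota> (i, z) \<in> (\<Union>i\<in>?I. B C i)" if C: "C \<in> ?GG" and i: "i \<in> ?I" for C i z
      proof
        assume "z \<in> C i"
        then show "z \<in> V \<and> \<iota> (i, z) \<in> (\<Union>i\<in>?I. B C i)" using AV[OF C i] i by (auto simp: B_def)
      next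
        assume z: "z \<in> V \<and> \<iota> (i, z) \<in> (\<Union>i\<in>?I. B C i)"
        then obtain j z' where j: "j \<in> ?I" "z' \<in> C j" "\<iota> (i, z) = \<iota> (j, z')" by (auto simp: B_def)
        have "z' \<in> V" using AV[OF C j(1)] j(2) by blast
        then have "(i, z) = (j, z')" using col[OF i, of z] col[OF j(1), of z'] j(3) z by metis
        then show "z \<in> C i" using j(2) by (metis prod.inject)
      qed
      have un: "(\<Union>i\<in>?I. B A i) = (\<Union>i\<in>?I. B A' i)" using eq by simp
      have "A i = A' i" if "i \<in> ?I" for i
        by (rule Set.set_eqI) (simp only: mem[OF A(1) that] mem[OF A(2) that] un)
      then show "A = A'" using A by (intro PiE_ext[of A ?I _ A']) auto
    qed
    have "finite (verts G)" using unif by (simp add: uniform_def hypergraph_def)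
    moreover have "finite (edges G)"
      using V unfolding G_def T_def by (auto intro!: finite_imageI finite_subset[OF _ finite_PiE[of ?I "\<lambda>_. V"]])
    ultimately have "finite (Pow (verts G) \<times> Pow (edges G))" by simp
    then show "finite (copies (complete_partite r a) G)"
      by (rule finite_subset[rotated]) (auto simp: copies_def subhypergraph_def)
  qed
  have "verts G = {..<n}" by (simp add: G_def)
  then show ?thesis using unif notfree many by (intro exI[of _ G] conjI allI impI)
qed

section \<open>Asymptotics\<close>

text \<open>Makes the exponent of the theorem nonnegative, so that a lower bound in terms of the
  number of points per part can be passed on to \<open>n\<close>.\<close>

lemma prod_le_first_times_prod:
  fixes a s :: "nat \<Rightarrow> nat"
  assumes "r \<ge> 1" "\<forall>i\<in>{2..r}. a i \<le> s (i - 1)"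
  shows "(\<Prod>i=1..r. a i) \<le> a 1 * (\<Prod>i=1..r-1. s i)"
proof -
  have "(\<Prod>i=1..r. a i) = a 1 * (\<Prod>i=2..r. a i)"
    using assms(1) by (subst prod.atLeast_Suc_atMost) (auto simp: numeral_2_eq_2)
  also have "(\<Prod>i=2..r. a i) = (\<Prod>i=1..r-1. a (i + 1))"
    by (rule prod.reindex_bij_witness[of _ "\<lambda>i. i + 1" "\<lambda>i. i - 1"]) auto
  also have "\<dots> \<le> (\<Prod>i=1..r-1. s i)"
  proof (intro prod_mono conjI)
    fix i assume "i \<in> {1..r-1}"
    then have "i + 1 \<in> {2..r}" by auto
    with assms(2) show "a (i + 1) \<le> s i" by fastforce
  qed simp
  finally show ?thesis by simp
qed

text \<open>Consecutive admissible vertex numbers \<open>r * (2 ^ e) ^ k\<close> differ by the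
  constant factor \<open>2 ^ k\<close>, so restricting \<open>q\<close> to powers of 2 loses only a
  constant.\<close>

lemma dyadic_scale:
  fixes r k n e0 :: nat
  assumes "r \<ge> 1" "k \<ge> 1" "r * (2 ^ e0) ^ k \<le> n"
  shows "\<exists>e\<ge>e0. r * (2 ^ e) ^ k \<le> n \<and> n < r * (2 ^ (e + 1)) ^ k"
proof -
  \<comment> \<open>The least such \<open>e\<close> works: beyond \<open>e0\<close>, minimality says
    that \<open>n\<close> has already passed the scale of \<open>e\<close>.\<close>
  define Q where "Q e \<longleftrightarrow> e \<ge> e0 \<and> n < r * (2 ^ (e + 1)) ^ k" for e
  have "n < 2 ^ n" by (rule less_exp)
  also have "(2::nat) ^ n \<le> 2 ^ (n + e0 + 1)" by (rule power_increasing) auto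
  also have "\<dots> \<le> (2 ^ (n + e0 + 1)) ^ k" using assms(2) by (intro self_le_power) auto
  also have "\<dots> \<le> r * (2 ^ (n + e0 + 1)) ^ k" using assms(1) by simp
  finally have "Q (n + e0)" by (simp add: Q_def)
  then have L: "Q (LEAST e. Q e)" by (rule LeastI)
  define e where "e = (LEAST e. Q e)"
  have "r * (2 ^ e) ^ k \<le> n"
  proof (cases "e = e0")
    case False
    then have "e > e0" using L by (simp add: Q_def e_def)
    moreover have "\<not> Q (e - 1)" using \<open>e > e0\<close> unfolding e_def by (intro not_less_Least) auto
    ultimately show ?thesis by (auto simp: Q_def)
  qed (use assms(3) in simp)
  then show ?thesis using L by (auto simp: Q_def e_def)
qed

text \<open>\<open>D\<close> exceeds every \<open>a i\<close> and \<open>s i\<close>, so both the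
  copies and the grids of the forbidden hypergraph have sets of admissible size. The bound on
  \<open>p\<close> is the solution bound of \<open>card_extension_le\<close>, which does not involve
  \<open>q\<close>; a forbidden copy would have an extension larger than that.\<close>

lemma dense_free_hypergraph:
  fixes r :: nat and a s :: "nat \<Rightarrow> nat"
  defines "k \<equiv> \<Prod>i=1..r-1. s i" and "D \<equiv> (\<Sum>i=1..r. a i) + (\<Sum>i=1..r-1. s i) + 1"
  defines "m \<equiv> k * D * (r - 1) + (\<Prod>i=1..r. a i) + 1"
  assumes r: "r \<ge> 2" and a: "\<forall>i\<in>{1..r}. a i > 0" and s: "\<forall>i\<in>{1..r-1}. s i > 0"
    and p: "p > card (words k (k * (D * m ^ k)))"
    and e: "e > 0" and large: "2 * (r * (m ^ k * k)) \<le> 2 ^ e" and n: "r * (2 ^ e) ^ k \<le> n"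
  shows "\<exists>G :: nat hypergraph. verts G = {..<n} \<and> uniform r G \<and> free_of (complete_partite r (s(r := p))) G \<and>
    (\<Prod>i=1..r. (2 ^ e) ^ k choose a i) \<le> 2 * (2 ^ e) ^ (\<Prod>i=1..r. a i) * card (copies (complete_partite r a) G)"
proof -
  define q :: nat where "q = 2 ^ e"
  \<comment> \<open>The algebraic closure of the two-element field contains every
    \<open>GF (2 ^ e)\<close>, so one fixed type serves for all \<open>n\<close>.\<close>
  have char: "CHAR(bit alg_closure) = 2" by (rule CHAR_bit_closure)
  have k: "k > 0" unfolding k_def using s by (intro prod_pos) auto
  have prime: "prime CHAR(bit alg_closure)" by (simp only: char two_is_prime_nat)
  have q: "q = CHAR(bit alg_closure) ^ e" by (simp only: char q_def)
  have m_eq: "m = k * D * (r - 1) + (\<Prod>i=1..r. a i) + 1" by (simp only: m_def)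
  have m0: "m > 0" by (simp add: m_def)
  have D0: "D > 0" by (simp add: D_def)
  have aD: "\<forall>i\<in>{1..r}. a i \<le> D"
    using member_le_sum[of _ "{1..r}" a] by (fastforce simp: D_def)
  have sD: "s i \<le> D" if "i \<in> {1..r-1}" for i
    using member_le_sum[of i "{1..r-1}" s] that by (simp add: D_def)
  obtain b :: "bit alg_closure" where b: "q ^ m \<le> q * card {y \<in> GF (q ^ m). (\<Prod>\<sigma><m. y ^ (q ^ \<sigma>)) = b}"
    using norm_fibre[OF prime q e m0] by (rule exE)
  interpret random_norm_hypergraph r k D m q e b
    using prime q e m0 D0 k by unfold_locales auto
  have r1: "r \<ge> 1" using r by simp
  obtain h where ext: "\<forall>i0\<in>{1..r}. \<forall>S\<in>PiE ({1..r} - {i0}) (\<lambda>_. {S. S \<subseteq> V \<and> S \<noteq> {} \<and> card S \<le> D}).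
        (\<Prod>i\<in>{1..r} - {i0}. card (S i)) = k \<longrightarrow>
        card {z \<in> V. \<forall>w\<in>PiE ({1..r} - {i0}) S. edge h (w(i0 := z))} \<le> card (words k (k * (D * m ^ k)))"
    and many: "(\<Prod>i=1..r. q ^ k choose a i) \<le> 2 * q ^ (\<Prod>i=1..r. a i) *
        card {A \<in> PiE {1..r} (\<lambda>i. {S. S \<subseteq> V \<and> card S = a i}). \<forall>x\<in>PiE {1..r} A. edge h x}"
    using exists_good_tensor[OF r1 aD m_eq large[folded q_def] b] by (elim exE conjE)
  have "r * card V \<le> n" unfolding card_V using n by (simp only: q_def)
  from partite_host[OF finite_V r1 this, of "edge h"]
  obtain G :: "nat hypergraph" where G: "verts G = {..<n}" "uniform r G"
    and nf: "\<forall>u. (\<forall>i\<in>{1..r}. u i > 0) \<longrightarrow> \<not> free_of (complete_partite r u) G \<longrightarrow>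
      (\<exists>c S. bij_betw c {1..r} {1..r} \<and> S \<in> PiE ({1..r} - {c r}) (\<lambda>_. Pow V) \<and>
        (\<forall>i\<in>{1..r} - {r}. card (S (c i)) = u i) \<and>
        u r \<le> card {z \<in> V. \<forall>w\<in>PiE ({1..r} - {c r}) S. edge h (w(c r := z))})"
    and cp: "\<forall>a. (\<forall>i\<in>{1..r}. a i > 0) \<longrightarrow>
      card {A \<in> PiE {1..r} (\<lambda>i. {S. S \<subseteq> V \<and> card S = a i}). \<forall>x\<in>PiE {1..r} A. edge h x}
        \<le> card (copies (complete_partite r a) G)"
    by (elim exE conjE)
  have "free_of (complete_partite r (s(r := p))) G"
  proof (rule ccontr)
    assume nfr: "\<not> free_of (complete_partite r (s(r := p))) G"
    have "\<forall>i\<in>{1..r}. (s(r := p)) i > 0" using s p by auto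
    \<comment> \<open>\<open>c r\<close> is the part of the host that contains the part of size
      \<open>p\<close>; it acts as the free block \<open>i0\<close>.\<close>
    from nf[rule_format (no_asm), OF this nfr] obtain c S where c: "bij_betw c {1..r} {1..r}"
      and S: "S \<in> PiE ({1..r} - {c r}) (\<lambda>_. Pow V)" "\<forall>i\<in>{1..r} - {r}. card (S (c i)) = (s(r := p)) i"
      and pc: "(s(r := p)) r \<le> card {z \<in> V. \<forall>w\<in>PiE ({1..r} - {c r}) S. edge h (w(c r := z))}"
      by (elim exE conjE)
    have rI: "r \<in> {1..r}" using r by simp
    have I: "{1..r} - {r} = {1..r-1}" using r by auto
    have cr: "c r \<in> {1..r}" using bij_betwE[OF c] rI by blast
    have c2: "bij_betw c ({1..r} - {r}) ({1..r} - {c r})"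
      using bij_betw_DiffI[OF c, of "{r}" "{c r}"] rI cr by (simp add: bij_betw_def)
    have cS: "card (S (c i)) = s i" if "i \<in> {1..r} - {r}" for i using S(2) that by simp
    have prod: "(\<Prod>i\<in>{1..r} - {c r}. card (S i)) = k"
    proof -
      have "(\<Prod>i\<in>{1..r} - {c r}. card (S i)) = (\<Prod>i\<in>{1..r} - {r}. card (S (c i)))"
        by (rule prod.reindex_bij_betw[OF c2, symmetric])
      also have "\<dots> = (\<Prod>i\<in>{1..r} - {r}. s i)" by (intro prod.cong refl cS)
      finally show ?thesis by (simp only: I k_def)
    qed
    have "S \<in> PiE ({1..r} - {c r}) (\<lambda>_. {S. S \<subseteq> V \<and> S \<noteq> {} \<and> card S \<le> D})"
    proof (rule PiE_I)
      fix j assume j: "j \<in> {1..r} - {c r}"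
      then have "j \<in> c ` ({1..r} - {r})" using c2 by (simp add: bij_betw_def)
      then obtain i where i: "i \<in> {1..r} - {r}" "j = c i" by blast
      have "s i > 0" "s i \<le> D" using s sD i(1) I by auto
      then have "card (S j) > 0" "card (S j) \<le> D" using cS[OF i(1)] i(2) by auto
      moreover have "S j \<subseteq> V" using PiE_mem[OF S(1) j] by simp
      ultimately show "S j \<in> {S. S \<subseteq> V \<and> S \<noteq> {} \<and> card S \<le> D}" by auto
    qed (rule PiE_arb[OF S(1)])
    with ext cr prod have "card {z \<in> V. \<forall>w\<in>PiE ({1..r} - {c r}) S. edge h (w(c r := z))}
        \<le> card (words k (k * (D * m ^ k)))"
      by simp
    with pc p show False by simp
  qed
  moreover have "(\<Prod>i=1..r. q ^ k choose a i) \<le> 2 * q ^ (\<Prod>i=1..r. a i) * card (copies (complete_partite r a) G)"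
    by (rule order_trans[OF many mult_left_mono[OF cp[rule_format (no_asm), OF a]]]) simp
  ultimately show ?thesis using G unfolding q_def by (intro exI[of _ G] conjI)
qed

text \<open>With x = q^k points per part there are at least x^A / (2 F q^P) copies, and q^P is x to
  the power P / k. The threshold for \<open>p\<close> depends on \<open>r\<close>, \<open>a\<close>
  and \<open>s\<close> only.\<close>

lemma copies_lower_bound:
  fixes r :: nat and a s :: "nat \<Rightarrow> nat"
  assumes r: "r \<ge> 2" and a: "\<forall>i\<in>{1..r}. a i > 0" and s: "\<forall>i\<in>{1..r-1}. s i > 0"
    and as: "\<forall>i\<in>{2..r}. a i \<le> s (i - 1)"
  shows "\<exists>C::nat. \<forall>p>C. \<exists>c>0. \<exists>n0. \<forall>n\<ge>n0. \<exists>G :: nat hypergraph. verts G = {..<n} \<and> uniform r G \<and>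
     free_of (complete_partite r (s(r := p))) G \<and>
     c * real n powr ((\<Sum>i=1..r. real (a i)) - (\<Prod>i=1..r. real (a i)) / (\<Prod>i=1..r-1. real (s i)))
       \<le> real (card (copies (complete_partite r a) G))"
proof -
  define k where "k = (\<Prod>i=1..r-1. s i)"
  define D where "D = (\<Sum>i=1..r. a i) + (\<Sum>i=1..r-1. s i) + 1"
  define A where "A = (\<Sum>i=1..r. a i)"
  define P where "P = (\<Prod>i=1..r. a i)"
  define m where "m = k * D * (r - 1) + P + 1"
  \<comment> \<open>The first summand meets the condition \<open>large\<close>; the summand
    \<open>D\<close> gives \<open>a i \<le> q ^ k\<close>, as the lower bound on the binomial
    coefficients requires.\<close>
  define L where "L = 2 * (r * (m ^ k * k)) + D"
  define \<epsilon> where "\<epsilon> = real A - real P / real k"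
  define F where "F = (\<Prod>i=1..r. real (a i) ^ a i)"
  \<comment> \<open>The factor 2 is lost in averaging, \<open>F\<close> in the binomial
    coefficients, and the power compensates for n < r 2^k q^k.\<close>
  define c where "c = 1 / (2 * F) * (1 / (real r * 2 ^ k)) powr \<epsilon>"
  note defs = m_def D_def P_def k_def
  have k: "k > 0" unfolding k_def using s by (intro prod_pos) auto
  have F: "F > 0" unfolding F_def using a by (intro prod_pos) auto
  have c: "c > 0" using F r by (simp add: c_def)
  have aD: "a i \<le> D" if "i \<in> {1..r}" for i
    using member_le_sum[of i "{1..r}" a] that by (simp add: D_def)
  have \<epsilon>: "\<epsilon> \<ge> 0"
  proof -
    have "P \<le> a 1 * k" unfolding P_def k_def using r as by (intro prod_le_first_times_prod) auto
    then have "real P \<le> real (a 1) * real k" by (metis of_nat_le_iff of_nat_mult)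
    then have "real P / real k \<le> real (a 1)" using k by (simp add: divide_le_eq)
    moreover have "a 1 \<le> A" unfolding A_def using r by (intro member_le_sum) auto
    ultimately show ?thesis by (simp add: \<epsilon>_def)
  qed
  have expo: "(\<Sum>i=1..r. real (a i)) - (\<Prod>i=1..r. real (a i)) / (\<Prod>i=1..r-1. real (s i)) = \<epsilon>"
    by (simp add: \<epsilon>_def A_def P_def k_def)
  have "\<exists>G :: nat hypergraph. verts G = {..<n} \<and> uniform r G \<and>
      free_of (complete_partite r (s(r := p))) G \<and> c * real n powr \<epsilon> \<le> real (card (copies (complete_partite r a) G))"
    if p: "p > card (words k (k * (D * m ^ k)))" and n: "n \<ge> r * (2 ^ (L + 1)) ^ k" for p n
  proof -
    obtain e where e: "e \<ge> L + 1" "r * (2 ^ e) ^ k \<le> n" "n < r * (2 ^ (e + 1)) ^ k"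
      using dyadic_scale[of r k "L + 1" n] r k n by auto
    define q :: nat where "q = 2 ^ e"
    have "e < q" unfolding q_def by (rule less_exp)
    then have qL: "L \<le> q" using e(1) by simp
    then have large: "2 * (r * (m ^ k * k)) \<le> 2 ^ e" by (simp add: L_def q_def)
    have q0: "q > 0" by (simp add: q_def)
    have "\<exists>G :: nat hypergraph. verts G = {..<n} \<and> uniform r G \<and> free_of (complete_partite r (s(r := p))) G \<and>
       (\<Prod>i=1..r. (2 ^ e) ^ k choose a i) \<le> 2 * (2 ^ e) ^ (\<Prod>i=1..r. a i) * card (copies (complete_partite r a) G)"
      using dense_free_hypergraph[OF r a s p[unfolded defs] _ large[unfolded defs] e(2)[unfolded defs]] e(1)
      unfolding defs by simp
    then obtain G :: "nat hypergraph" where G: "verts G = {..<n}" "uniform r G"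
        "free_of (complete_partite r (s(r := p))) G"
      and N: "(\<Prod>i=1..r. q ^ k choose a i) \<le> 2 * q ^ P * card (copies (complete_partite r a) G)"
      unfolding q_def P_def by (elim exE conjE)
    define x where "x = real (q ^ k)"
    have x0: "x > 0" using q0 by (simp add: x_def)
    have "x ^ A / F = (\<Prod>i=1..r. (x / real (a i)) ^ a i)"
      unfolding A_def F_def by (simp add: power_sum prod_dividef power_divide)
    also have "\<dots> \<le> (\<Prod>i=1..r. real (q ^ k choose a i))"
    proof (intro prod_mono conjI)
      fix i assume i: "i \<in> {1..r}"
      have "a i \<le> q" using aD[OF i] qL by (simp add: L_def)
      also have "q \<le> q ^ k" using q0 k by (intro self_le_power) auto
      finally show "(x / real (a i)) ^ a i \<le> real (q ^ k choose a i)"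
        unfolding x_def by (rule binomial_ge_n_over_k_pow_k)
      show "0 \<le> (x / real (a i)) ^ a i" using x0 by simp
    qed
    also have "\<dots> = real (\<Prod>i=1..r. q ^ k choose a i)" by simp
    also have "\<dots> \<le> real (2 * q ^ P * card (copies (complete_partite r a) G))"
      using N by (simp only: of_nat_le_iff)
    also have "\<dots> = 2 * real q ^ P * real (card (copies (complete_partite r a) G))" by simp
    finally have main: "x ^ A / F \<le> 2 * real q ^ P * real (card (copies (complete_partite r a) G))" .
    have "real q ^ P = x powr (real P / real k)"
    proof -
      have "x powr (real P / real k) = real q powr (real k * (real P / real k))"
        using q0 by (simp add: x_def powr_realpow[symmetric] powr_powr)
      also have "\<dots> = real q ^ P" using q0 k by (simp add: powr_realpow)
      finally show ?thesis by simp
    qed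
    moreover have "x ^ A = x powr real A" using x0 by (simp add: powr_realpow)
    ultimately have le: "x powr real A / F
        \<le> real (card (copies (complete_partite r a) G)) * (2 * x powr (real P / real k))"
      using main by (simp add: mult_ac)
    have "1 / (2 * F) * x powr \<epsilon> = x powr real A / F / (2 * x powr (real P / real k))"
      by (simp add: \<epsilon>_def powr_diff)
    also have "\<dots> \<le> real (card (copies (complete_partite r a) G))"
      using le x0 by (subst pos_divide_le_eq) auto
    finally have "1 / (2 * F) * x powr \<epsilon> \<le> real (card (copies (complete_partite r a) G))" .
    moreover have "c * real n powr \<epsilon> \<le> 1 / (2 * F) * x powr \<epsilon>"
    proof -
      have "n \<le> r * (2 ^ k * q ^ k)" using e(3) by (simp add: q_def power_mult_distrib)
      then have "real n \<le> real (r * (2 ^ k * q ^ k))" by (simp only: of_nat_le_iff)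
      also have "\<dots> = (real r * 2 ^ k) * x" by (simp add: x_def)
      finally have "real n \<le> (real r * 2 ^ k) * x" .
      then have "1 / (real r * 2 ^ k) * real n \<le> x" using r by (simp add: field_simps)
      then have "(1 / (real r * 2 ^ k) * real n) powr \<epsilon> \<le> x powr \<epsilon>"
        using \<epsilon> by (intro powr_mono2) auto
      then have "(1 / (real r * 2 ^ k)) powr \<epsilon> * real n powr \<epsilon> \<le> x powr \<epsilon>"
        by (subst (asm) powr_mult) auto
      then have "1 / (2 * F) * ((1 / (real r * 2 ^ k)) powr \<epsilon> * real n powr \<epsilon>) \<le> 1 / (2 * F) * x powr \<epsilon>"
        using F by (intro mult_left_mono) auto
      then show ?thesis by (simp only: c_def mult.assoc)
    qed
    ultimately have "c * real n powr \<epsilon> \<le> real (card (copies (complete_partite r a) G))" by (rule order_trans[rotated])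
    then show ?thesis using G by (intro exI[of _ G] conjI)
  qed
  then show ?thesis unfolding expo using c
    by (intro exI[of _ "card (words k (k * (D * m ^ k)))"] allI impI exI[of _ c] conjI
        exI[of _ "r * (2 ^ (L + 1)) ^ k"])
qed

theorem theorem1p1:
  fixes r :: nat and a s :: "nat \<Rightarrow> nat"
  assumes "r \<ge> 2"
    and "\<forall>i\<in>{1..r}. a i > 0"
    and "\<forall>i\<in>{1..r-1}. s i > 0"
    and "a 1 < s 1"
    and "\<forall>i\<in>{1..<r-1}. s i \<le> s (i + 1)"
    and "\<forall>i\<in>{2..r}. a i \<le> s (i - 1)"
  shows "\<exists>c::real. c > 0 \<and> (\<forall>p::nat. real p \<ge> c \<longrightarrow>
           (\<lambda>n. real (ex_number r n (complete_partite r a) (complete_partite r (s(r := p)))))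
             \<in> \<Theta>(\<lambda>n. real n powr
                   ((\<Sum>i=1..r. real (a i)) - (\<Prod>i=1..r. real (a i)) / (\<Prod>i=1..r-1. real (s i)))))"
proof -
  define \<epsilon> where "\<epsilon> = (\<Sum>i=1..r. real (a i)) - (\<Prod>i=1..r. real (a i)) / (\<Prod>i=1..r-1. real (s i))"
  obtain C :: nat where C: "\<forall>p>C. \<exists>c>0. \<exists>n0. \<forall>n\<ge>n0. \<exists>G :: nat hypergraph. verts G = {..<n} \<and> uniform r G \<and>
     free_of (complete_partite r (s(r := p))) G \<and> c * real n powr \<epsilon> \<le> real (card (copies (complete_partite r a) G))"
    using copies_lower_bound[OF assms(1,2,3,6)] unfolding \<epsilon>_def[symmetric] by (rule exE)
  have "(\<lambda>n. real (ex_number r n (complete_partite r a) (complete_partite r (s(r := p)))))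
       \<in> \<Theta>(\<lambda>n. real n powr \<epsilon>)" if p: "p > C" for p
  proof (rule bigthetaI)
    let ?K = "complete_partite r (s(r := p))"
    let ?ex = "\<lambda>n. real (ex_number r n (complete_partite r a) ?K)"
    let ?N = "\<lambda>n. {card (copies (complete_partite r a) G) | G :: nat hypergraph.
       verts G = {..<n} \<and> uniform r G \<and> free_of ?K G}"
    have edge: "edges ?K \<noteq> {}"
      using assms(3) p by (intro complete_partite_has_edge) auto
    have fin: "finite (?N n)" and ne: "?N n \<noteq> {}" for n
      by (rule ex_number_set_finite) (rule ex_number_set_nonempty[OF edge])
    have "\<exists>C\<ge>0. \<forall>n\<ge>1. \<forall>G :: nat hypergraph. card (verts G) = n \<longrightarrow> uniform r G \<longrightarrow>
        free_of ?K G \<longrightarrow> real (card (copies (complete_partite r a) G)) \<le> C * real n powr \<epsilon>"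
      unfolding \<epsilon>_def using assms p by (intro copies_upper_bound) auto
    then obtain Cu where Cu: "\<forall>n\<ge>1. \<forall>G :: nat hypergraph. card (verts G) = n \<longrightarrow> uniform r G \<longrightarrow>
        free_of ?K G \<longrightarrow> real (card (copies (complete_partite r a) G)) \<le> Cu * real n powr \<epsilon>"
      by (elim exE conjE)
    have "?ex n \<le> Cu * real n powr \<epsilon>" if n: "n \<ge> 1" for n
    proof -
      have "ex_number r n (complete_partite r a) ?K \<in> ?N n"
        unfolding ex_number_def by (rule Max_in[OF fin ne])
      then obtain G :: "nat hypergraph"
        where "ex_number r n (complete_partite r a) ?K = card (copies (complete_partite r a) G)"
        and G: "verts G = {..<n}" "uniform r G" "free_of ?K G" by blast
      moreover have "card (verts G) = n" by (simp add: G(1))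
      ultimately show ?thesis using Cu[rule_format, OF n _ G(2,3)] by simp
    qed
    then show "?ex \<in> O(\<lambda>n. real n powr \<epsilon>)"
      by (intro bigoI[of _ Cu] eventually_sequentiallyI[of 1]) simp
    obtain c n0 where c: "c > 0" and G: "\<forall>n\<ge>n0. \<exists>G :: nat hypergraph. verts G = {..<n} \<and> uniform r G \<and>
       free_of ?K G \<and> c * real n powr \<epsilon> \<le> real (card (copies (complete_partite r a) G))"
      using C[rule_format, OF p] by (elim exE conjE)
    have "c * real n powr \<epsilon> \<le> ?ex n" if n: "n \<ge> n0" for n
    proof -
      obtain G :: "nat hypergraph" where G: "verts G = {..<n}" "uniform r G" "free_of ?K G"
        "c * real n powr \<epsilon> \<le> real (card (copies (complete_partite r a) G))"
        using G[rule_format, OF n] by (elim exE conjE)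
      have "card (copies (complete_partite r a) G) \<le> ex_number r n (complete_partite r a) ?K"
        unfolding ex_number_def using G by (intro Max_ge[OF fin]) blast
      with G(4) show ?thesis by linarith
    qed
    then show "?ex \<in> \<Omega>(\<lambda>n. real n powr \<epsilon>)"
      using c by (intro landau_omega.bigI[of c] eventually_sequentiallyI[of n0]) auto
  qed
  then show ?thesis unfolding \<epsilon>_def
    by (intro exI[of _ "real C + 1"] conjI allI impI) auto
qed

end
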